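(* Let $\{Y_t\}$ satisfy $Y_0=0$, $Y_t=\rho Y_{t-1}+\epsilon_t$, $t\ge 1$, with $\rho=1$, where $\{\epsilon_t\}$ satisfies (E1), and let $K$ satisfy (K1)-(K3) (conditions given in the context). Let $\widetilde{D}_T$ be the weighted $t$-type Dickey-Fuller process and $\kappa\in(0,1)$. Then $$\widetilde{D}_T\Rightarrow\widetilde{\mathcal{D}}_\vartheta\qquad\text{in }(D[\kappa,1],d),$$ as $T\to\infty$, where $$\widetilde{\mathcal{D}}_\vartheta(s)=\frac{\frac12\left\{\vartheta K(0)B(s)^2+\vartheta\zeta\int_0^s B(r)^2K'(\zeta(s-r))\,dr-\vartheta^{-1}\int_0^s K(\zeta(s-r))\,dr\right\}}{\left\{\int_0^s B(r)^2\,dr\right\}^{1/2}}$$ for $s\in(0,1]$ and $\widetilde{\mathcal{D}}_\vartheta(0)=0$, with $\vartheta=\eta/\sigma$ and $B$ a standard Brownian motion. The process $\widetilde{\mathcal{D}}_\vartheta$ is continuous a.s.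
   Context: Notation: $\Rightarrow$ denotes weak convergence in the space of cadlag functions (on the indicated interval) equipped with the Skorokhod metric $d$; $\lfloor\cdot\rfloor$ is the floor function. (E1): $\{\epsilon_t\}$ is strictly stationary with mean zero, $E|\epsilon_1|^4<\infty$, $\sum_{t=1}^\infty \mathrm{Cov}(\epsilon_1^2,\epsilon_{1+t}^2)<\infty$, and for constants $0<\eta,\eta'<\infty$, as $T\to\infty$, in $D[0,1]$, $$T^{-1/2}\sum_{i\le\lfloor Ts\rfloor}\epsilon_i\Rightarrow\eta B(s),\qquad T^{-1/2}\sum_{i\le\lfloor Ts\rfloor}(\epsilon_i^2-E\epsilon_i^2)\Rightarrow\eta' B^{(2)}(s),$$ with $B,B^{(2)}$ standard Brownian motions started at $0$. Put $\sigma^2=E\epsilon_1^2$; the scale parameter $\eta$ is given by $\eta^2=\lim_{T\to\infty}\eta_T^2$, $\eta_T^2=\sigma^2+2\sum_{t=1}^T\frac{T-t}{T}E(\epsilon_1\epsilon_{1+t})$. Kernel $K:\mathbb{R}\to[0,\infty)$: (K1) $\|K\|_\infty<\infty$, $\int K(z)\,dz=1$, $\int zK(z)\,dz=0$; (K2) $K$ is $C^2$ with bounded derivative; (K3) $K$ has bounded variation. The bandwidth $h=h_T>0$ satisfies $T/h_T\to\zeta$ as $T\to\infty$ for some $1\le\zeta<\infty$. Weighted Dickey-Fuller process: with $\Delta Y_t=Y_t-Y_{t-1}$ and the convention $0/0=0$, $$D_T(s)=\frac{\lfloor Ts\rfloor^{-1}\sum_{t=1}^{\lfloor Ts\rfloor}Y_{t-1}\Delta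 Y_t\,K((\lfloor Ts\rfloor-t)/h)}{\lfloor Ts\rfloor^{-2}\sum_{t=1}^{\lfloor Ts\rfloor}Y_{t-1}^2},\qquad s\in[0,1].$$ $t$-type process: for $n\ge 2$ let $\widehat\rho_n=\sum_{t=1}^nY_{t-1}Y_t\big/\sum_{t=1}^nY_{t-1}^2$, $S_n^2=(n-1)^{-1}\sum_{t=1}^n(Y_t-\widehat\rho_nY_{t-1})^2$, $\widehat\xi_n=\{S_n^2/\sum_{t=1}^nY_{t-1}^2\}^{1/2}$. Then $\widetilde{D}_T(s)=D_T(s)/(\lfloor Ts\rfloor\,\widehat\xi_{\lfloor Ts\rfloor})$ for $s\in(0,1]$ and $\widetilde{D}_T(0)=0$.
   Formalization: Almost sure continuity of the limit process is stated on (0,1] (which contains every [κ,1]) and not at s=0, where it fails for K(0)>0: by Brownian scaling the ratio does not tend to the assigned value 0 as s→0. *)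

theory Defs
  imports "HOL-Probability.Probability"
begin

definition cadlag_paths :: "real \<Rightarrow> real \<Rightarrow> (real \<Rightarrow> real) set" where
  "cadlag_paths a b = {x \<in> extensional {a..b}.
     (\<forall>t\<in>{a..<b}. (x \<longlongrightarrow> x t) (at_right t)) \<and>
     (\<forall>t\<in>{a<..b}. \<exists>l. (x \<longlongrightarrow> l) (at_left t))}"

text \<open>An increasing surjection of \<^term>\<open>{a..b}\<close> onto itself is automatically a homeomorphism.\<close>

definition time_changes :: "real \<Rightarrow> real \<Rightarrow> (real \<Rightarrow> real) set" where
  "time_changes a b = {l. strict_mono_on {a..b} l \<and> l ` {a..b} = {a..b}}"

definition skorokhod_bound :: "real \<Rightarrow> real \<Rightarrow> (real \<Rightarrow> real) \<Rightarrow> (real \<Rightarrow> real) \<Rightarrow> real \<Rightarrow> bool" where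
  "skorokhod_bound a b x y e \<longleftrightarrow> 0 \<le> e \<and>
     (\<exists>l\<in>time_changes a b. \<forall>t\<in>{a..b}. \<bar>l t - t\<bar> \<le> e \<and> \<bar>x t - y (l t)\<bar> \<le> e)"

text \<open>The value off the carrier is irrelevant, but the library's metric-space locale wants
  nonnegativity and symmetry there as well.\<close>

definition skorokhod_dist :: "real \<Rightarrow> real \<Rightarrow> (real \<Rightarrow> real) \<Rightarrow> (real \<Rightarrow> real) \<Rightarrow> real" where
  "skorokhod_dist a b x y =
     (if x \<in> cadlag_paths a b \<and> y \<in> cadlag_paths a b then Inf {e. skorokhod_bound a b x y e} else 0)"

lemma cadlag_locally_bounded:
  assumes x: "x \<in> cadlag_paths a b" and t: "t \<in> {a..b}"
  shows "\<exists>U C. open U \<and> t \<in> U \<and> (\<forall>s\<in>U \<inter> {a..b}. \<bar>x s\<bar> \<le> C)"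
proof -
  have R: "\<exists>d>0. \<exists>C. \<forall>s\<in>{t<..<t+d} \<inter> {a..b}. \<bar>x s\<bar> \<le> C"
  proof (cases "t < b")
    case True
    then have "(x \<longlongrightarrow> x t) (at_right t)" using x t by (auto simp: cadlag_paths_def)
    then have "eventually (\<lambda>s. dist (x s) (x t) < 1) (at_right t)" by (rule tendstoD) simp
    then obtain c where c: "c > t" "\<forall>s>t. s < c \<longrightarrow> dist (x s) (x t) < 1"
      unfolding eventually_at_right_field by auto
    have "\<forall>s\<in>{t<..<t+(c-t)} \<inter> {a..b}. \<bar>x s\<bar> \<le> \<bar>x t\<bar> + 1"
      using c by (force simp: dist_real_def)
    then show ?thesis using c(1) by (intro exI[of _ "c-t"]) auto
  next
    case False
    then show ?thesis using t by (intro exI[of _ 1]) auto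
  qed
  have L: "\<exists>d>0. \<exists>C. \<forall>s\<in>{t-d<..<t} \<inter> {a..b}. \<bar>x s\<bar> \<le> C"
  proof (cases "a < t")
    case True
    then have "t \<in> {a<..b}" using t by simp
    then obtain l where "(x \<longlongrightarrow> l) (at_left t)" using x unfolding cadlag_paths_def by blast
    then have "eventually (\<lambda>s. dist (x s) l < 1) (at_left t)" by (rule tendstoD) simp
    then obtain c where c: "c < t" "\<forall>s>c. s < t \<longrightarrow> dist (x s) l < 1"
      unfolding eventually_at_left_field by auto
    have "\<forall>s\<in>{t-(t-c)<..<t} \<inter> {a..b}. \<bar>x s\<bar> \<le> \<bar>l\<bar> + 1"
      using c by (force simp: dist_real_def)
    then show ?thesis using c(1) by (intro exI[of _ "t-c"]) auto
  next
    case False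
    then show ?thesis using t by (intro exI[of _ 1]) auto
  qed
  obtain d C where d: "d > 0" "\<forall>s\<in>{t<..<t+d} \<inter> {a..b}. \<bar>x s\<bar> \<le> C" using R by blast
  obtain d' C' where d': "d' > 0" "\<forall>s\<in>{t-d'<..<t} \<inter> {a..b}. \<bar>x s\<bar> \<le> C'" using L by blast
  have "\<forall>s\<in>{t-d'<..<t+d} \<inter> {a..b}. \<bar>x s\<bar> \<le> max \<bar>x t\<bar> (max C C')"
  proof
    fix s assume s: "s \<in> {t-d'<..<t+d} \<inter> {a..b}"
    consider "s < t" | "s = t" | "t < s" by linarith
    then show "\<bar>x s\<bar> \<le> max \<bar>x t\<bar> (max C C')"
    proof cases
      case 1 then have "\<bar>x s\<bar> \<le> C'" using s d' by auto then show ?thesis by simp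
    next
      case 3 then have "\<bar>x s\<bar> \<le> C" using s d by auto then show ?thesis by simp
    qed auto
  qed
  then show ?thesis using d(1) d'(1) by (intro exI[of _ "{t-d'<..<t+d}"] exI) auto
qed

lemma cadlag_bounded:
  assumes x: "x \<in> cadlag_paths a b"
  obtains C where "0 \<le> C" "\<And>t. t \<in> {a..b} \<Longrightarrow> \<bar>x t\<bar> \<le> C"
proof -
  have "\<forall>t\<in>{a..b}. \<exists>U C. open U \<and> t \<in> U \<and> (\<forall>s\<in>U \<inter> {a..b}. \<bar>x s\<bar> \<le> C)"
    using cadlag_locally_bounded[OF x] by blast
  then obtain U C where UC: "\<And>t. t \<in> {a..b} \<Longrightarrow> open (U t) \<and> t \<in> U t \<and> (\<forall>s\<in>U t \<inter> {a..b}. \<bar>x s\<bar> \<le> C t)"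
    by metis
  obtain F where F: "F \<subseteq> {a..b}" "finite F" "{a..b} \<subseteq> (\<Union>t\<in>F. U t)"
    by (rule compactE_image[OF compact_Icc[of a b], of "{a..b}" U]) (use UC in auto)
  have "\<bar>x t\<bar> \<le> Max (insert 0 (C ` F))" if t: "t \<in> {a..b}" for t
  proof -
    obtain s where s: "s \<in> F" "t \<in> U s" using F t by blast
    then have "\<bar>x t\<bar> \<le> C s" using UC[of s] F(1) t by auto
    also have "\<dots> \<le> Max (insert 0 (C ` F))" using s F(2) by (intro Max_ge) auto
    finally show ?thesis .
  qed
  moreover have "0 \<le> Max (insert 0 (C ` F))" using F(2) by (intro Max_ge) auto
  ultimately show ?thesis using that by blast
qed

lemma id_time_change: "(\<lambda>t. t) \<in> time_changes a b"
  by (auto simp: time_changes_def strict_mono_on_def)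

lemma time_change_mem: "l \<in> time_changes a b \<Longrightarrow> t \<in> {a..b} \<Longrightarrow> l t \<in> {a..b}"
  by (auto simp: time_changes_def)

lemma time_change_inverse:
  assumes l: "l \<in> time_changes a b"
  shows "inv_into {a..b} l \<in> time_changes a b"
    and "t \<in> {a..b} \<Longrightarrow> l (inv_into {a..b} l t) = t"
    and "t \<in> {a..b} \<Longrightarrow> inv_into {a..b} l t \<in> {a..b}"
proof -
  have sm: "strict_mono_on {a..b} l" and im: "l ` {a..b} = {a..b}"
    using l by (auto simp: time_changes_def)
  have inj: "inj_on l {a..b}" using sm by (rule strict_mono_on_imp_inj_on)
  then have bij: "bij_betw l {a..b} {a..b}" using im by (simp add: bij_betw_def)
  then have bij': "bij_betw (inv_into {a..b} l) {a..b} {a..b}" by (rule bij_betw_inv_into)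
  show 2: "l (inv_into {a..b} l t) = t" if "t \<in> {a..b}" for t
    using that im by (simp add: f_inv_into_f)
  show 3: "inv_into {a..b} l t \<in> {a..b}" if "t \<in> {a..b}" for t
    using that bij' by (meson bij_betwE)
  have "strict_mono_on {a..b} (inv_into {a..b} l)"
  proof (rule strict_mono_onI)
    fix r s assume rs: "r \<in> {a..b}" "s \<in> {a..b}" "r < s"
    show "inv_into {a..b} l r < inv_into {a..b} l s"
    proof (rule ccontr)
      assume "\<not> ?thesis"
      then have "l (inv_into {a..b} l s) \<le> l (inv_into {a..b} l r)"
        using strict_mono_on_leD[OF sm 3[OF rs(2)] 3[OF rs(1)]] by simp
      then show False using 2 rs by auto
    qed
  qed
  then show "inv_into {a..b} l \<in> time_changes a b"
    using bij' by (simp add: time_changes_def bij_betw_def)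
qed

lemma skorokhod_bound_sym:
  assumes "skorokhod_bound a b x y e" shows "skorokhod_bound a b y x e"
proof -
  obtain l where e: "0 \<le> e" and l: "l \<in> time_changes a b"
    and le: "\<forall>t\<in>{a..b}. \<bar>l t - t\<bar> \<le> e \<and> \<bar>x t - y (l t)\<bar> \<le> e"
    using assms by (auto simp: skorokhod_bound_def)
  let ?m = "inv_into {a..b} l"
  have "\<bar>?m t - t\<bar> \<le> e \<and> \<bar>y t - x (?m t)\<bar> \<le> e" if t: "t \<in> {a..b}" for t
    using le[rule_format, OF time_change_inverse(3)[OF l t]]
      time_change_inverse(2)[OF l t] by (simp add: abs_minus_commute)
  then show ?thesis using e time_change_inverse(1)[OF l] unfolding skorokhod_bound_def
    by (intro conjI bexI[of _ ?m]) auto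
qed

lemma skorokhod_bound_trans:
  assumes "skorokhod_bound a b x y e" "skorokhod_bound a b y z e'"
  shows "skorokhod_bound a b x z (e + e')"
proof -
  obtain l where e: "0 \<le> e" and l: "l \<in> time_changes a b"
    and le: "\<forall>t\<in>{a..b}. \<bar>l t - t\<bar> \<le> e \<and> \<bar>x t - y (l t)\<bar> \<le> e"
    using assms(1) by (auto simp: skorokhod_bound_def)
  obtain m where e': "0 \<le> e'" and m: "m \<in> time_changes a b"
    and me: "\<forall>t\<in>{a..b}. \<bar>m t - t\<bar> \<le> e' \<and> \<bar>y t - z (m t)\<bar> \<le> e'"
    using assms(2) by (auto simp: skorokhod_bound_def)
  have "(\<lambda>t. m (l t)) \<in> time_changes a b"
  proof -
    have "strict_mono_on {a..b} (\<lambda>t. m (l t))"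
    proof (rule strict_mono_onI)
      fix r s assume "r \<in> {a..b}" "s \<in> {a..b}" "r < s"
      moreover then have "l r < l s" using l by (auto simp: time_changes_def strict_mono_on_def)
      ultimately show "m (l r) < m (l s)"
        using m time_change_mem[OF l] by (auto simp: time_changes_def strict_mono_on_def)
    qed
    moreover have "(\<lambda>t. m (l t)) ` {a..b} = m ` (l ` {a..b})" by (auto simp: image_image)
    ultimately show ?thesis using l m by (simp add: time_changes_def)
  qed
  moreover have "\<bar>m (l t) - t\<bar> \<le> e + e' \<and> \<bar>x t - z (m (l t))\<bar> \<le> e + e'" if t: "t \<in> {a..b}" for t
    using le[rule_format, OF t] me[rule_format, OF time_change_mem[OF l t]] by linarith
  ultimately show ?thesis using e e' unfolding skorokhod_bound_def
    by (intro conjI add_nonneg_nonneg bexI[of _ "\<lambda>t. m (l t)"]) auto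
qed

lemma skorokhod_bound_ex:
  assumes "x \<in> cadlag_paths a b" "y \<in> cadlag_paths a b"
  shows "\<exists>e. skorokhod_bound a b x y e"
proof -
  obtain C where C: "0 \<le> C" "\<And>t. t \<in> {a..b} \<Longrightarrow> \<bar>x t\<bar> \<le> C" using cadlag_bounded[OF assms(1)] by blast
  obtain D where D: "0 \<le> D" "\<And>t. t \<in> {a..b} \<Longrightarrow> \<bar>y t\<bar> \<le> D" using cadlag_bounded[OF assms(2)] by blast
  have "\<bar>x t - y t\<bar> \<le> C + D" if "t \<in> {a..b}" for t using C(2)[OF that] D(2)[OF that] by linarith
  then have "skorokhod_bound a b x y (C + D)"
    using C(1) D(1) id_time_change[of a b] unfolding skorokhod_bound_def
    by (intro conjI bexI[of _ "\<lambda>t. t"]) auto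
  then show ?thesis by blast
qed

lemma skorokhod_bound_bdd: "bdd_below {e. skorokhod_bound a b x y e}"
  by (rule bdd_belowI[of _ 0]) (auto simp: skorokhod_bound_def)

lemma skorokhod_bound_zero_imp_eq:
  assumes x: "x \<in> cadlag_paths a b" and y: "y \<in> cadlag_paths a b"
    and small: "\<And>e. e > 0 \<Longrightarrow> skorokhod_bound a b x y e"
  shows "x = y"
proof -
  text \<open>Every value of one path is within reach of values of the other at nearby times.\<close>
  have near: "\<exists>s\<in>{a..b}. \<bar>s - t\<bar> \<le> e \<and> \<bar>x t - y s\<bar> \<le> e" if t: "t \<in> {a..b}" and e: "e > 0" for t e
    using small[OF e] t time_change_mem unfolding skorokhod_bound_def by blast
  have "x t = y t" if t: "t \<in> {a..b}" for t
  proof (cases "t < b")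
    case False
    then have tb: "t = b" using t by auto
    have "\<bar>x b - y b\<bar> \<le> e" if e: "e > 0" for e
    proof -
      obtain l where l: "l \<in> time_changes a b" and le: "\<forall>t\<in>{a..b}. \<bar>x t - y (l t)\<bar> \<le> e"
        using small[OF e] unfolding skorokhod_bound_def by blast
      have b: "b \<in> {a..b}" using t by auto
      have "\<exists>r\<in>{a..b}. l r = b" using l b unfolding time_changes_def by (metis (mono_tags, lifting) imageE mem_Collect_eq)
      then obtain r where r: "r \<in> {a..b}" "l r = b" by blast
      have "strict_mono_on {a..b} l" using l by (simp add: time_changes_def)
      then have "l r \<le> l b" using strict_mono_on_leD[of "{a..b}" l r b] r b by auto
      then have "l b = b" using r(2) time_change_mem[OF l b] by auto
      then show ?thesis using le b by force
    qed
    then have "\<bar>x b - y b\<bar> \<le> 0" using field_le_epsilon[of "\<bar>x b - y b\<bar>" 0] by simp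
    then show ?thesis using tb by simp
  next
    case True
    have "\<bar>x t - y t\<bar> \<le> e" if e: "e > 0" for e
    proof -
      have xr: "(x \<longlongrightarrow> x t) (at_right t)" and yr: "(y \<longlongrightarrow> y t) (at_right t)"
        using x y t True by (auto simp: cadlag_paths_def)
      obtain c where c: "c > t" "\<forall>s>t. s < c \<longrightarrow> dist (x s) (x t) < e/3"
        using tendstoD[OF xr, of "e/3"] e unfolding eventually_at_right_field by auto
      obtain c' where c': "c' > t" "\<forall>s>t. s < c' \<longrightarrow> dist (y s) (y t) < e/3"
        using tendstoD[OF yr, of "e/3"] e unfolding eventually_at_right_field by auto
      define d where "d = Min {c - t, c' - t, b - t}"
      have d: "0 < d" "d \<le> c - t" "d \<le> c' - t" "d \<le> b - t" using c c' True by (auto simp: d_def)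
      have tm: "t + d/2 \<in> {a..b}" using d t by auto
      obtain s where s: "s \<in> {a..b}" "\<bar>s - (t + d/2)\<bar> \<le> min (e/3) (d/4)"
          "\<bar>x (t + d/2) - y s\<bar> \<le> min (e/3) (d/4)"
        using near[OF tm, of "min (e/3) (d/4)"] e d by auto
      have "\<bar>s - (t + d/2)\<bar> \<le> d/4" using s(2) by simp
      then have "t < s" "s < c'" using d by linarith+
      then have "dist (y s) (y t) < e/3" using c' by blast
      moreover have "dist (x (t + d/2)) (x t) < e/3" using c(2) d by auto
      moreover have "\<bar>x (t + d/2) - y s\<bar> \<le> e/3" using s(3) by simp
      ultimately show ?thesis unfolding dist_real_def by linarith
    qed
    then have "\<bar>x t - y t\<bar> \<le> 0" using field_le_epsilon[of "\<bar>x t - y t\<bar>" 0] by simp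
    then show ?thesis by simp
  qed
  then show ?thesis using x y by (auto simp: cadlag_paths_def intro: extensionalityI)
qed

lemma Metric_space_skorokhod: "Metric_space (cadlag_paths a b) (skorokhod_dist a b)"
proof
  fix x y z
  let ?D = "cadlag_paths a b" and ?S = "\<lambda>x y. {e. skorokhod_bound a b x y e}"
  show "0 \<le> skorokhod_dist a b x y"
    using skorokhod_bound_ex[of x a b y]
    by (auto simp: skorokhod_dist_def skorokhod_bound_def intro!: cInf_greatest)
  have "?S x y = ?S y x" using skorokhod_bound_sym by blast
  then show "skorokhod_dist a b x y = skorokhod_dist a b y x"
    unfolding skorokhod_dist_def by (simp add: conj_commute)
  show "(skorokhod_dist a b x y = 0) = (x = y)" if x: "x \<in> ?D" and y: "y \<in> ?D"
  proof
    assume "skorokhod_dist a b x y = 0"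
    then have z: "Inf (?S x y) = 0" using x y by (simp add: skorokhod_dist_def)
    show "x = y"
    proof (rule skorokhod_bound_zero_imp_eq[OF x y])
      fix e :: real assume "e > 0"
      then obtain e' where "e' < e" "skorokhod_bound a b x y e'"
        using cInf_lessD[of "?S x y" e] z skorokhod_bound_ex[OF x y] by auto
      then show "skorokhod_bound a b x y e" unfolding skorokhod_bound_def
        by (meson less_le_not_le order_trans)
    qed
  next
    assume "x = y"
    have "skorokhod_bound a b x x 0" using id_time_change[of a b] unfolding skorokhod_bound_def
      by (intro conjI bexI[of _ "\<lambda>t. t"]) auto
    then have "Inf (?S x x) \<le> 0" by (intro cInf_lower skorokhod_bound_bdd) simp
    moreover have "0 \<le> Inf (?S x x)" using skorokhod_bound_ex[OF x x]
      by (auto simp: skorokhod_bound_def intro!: cInf_greatest)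
    ultimately show "skorokhod_dist a b x y = 0" using \<open>x = y\<close> x by (simp add: skorokhod_dist_def)
  qed
  show "skorokhod_dist a b x z \<le> skorokhod_dist a b x y + skorokhod_dist a b y z"
    if x: "x \<in> ?D" and y: "y \<in> ?D" and z: "z \<in> ?D"
  proof -
    have "Inf (?S x z) - Inf (?S x y) \<le> Inf (?S y z)"
    proof (rule cInf_greatest)
      fix e' assume e': "e' \<in> ?S y z"
      have "Inf (?S x z) - e' \<le> Inf (?S x y)"
      proof (rule cInf_greatest)
        fix e assume "e \<in> ?S x y"
        then have "e + e' \<in> ?S x z" using e' skorokhod_bound_trans by blast
        then have "Inf (?S x z) \<le> e + e'" by (intro cInf_lower skorokhod_bound_bdd)
        then show "Inf (?S x z) - e' \<le> e" by simp
      qed (use skorokhod_bound_ex[OF x y] in auto)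
      then show "Inf (?S x z) - Inf (?S x y) \<le> e'" by simp
    qed (use skorokhod_bound_ex[OF y z] in auto)
    then show ?thesis using x y z by (simp add: skorokhod_dist_def)
  qed
qed

definition skorokhod_topology :: "real \<Rightarrow> real \<Rightarrow> (real \<Rightarrow> real) topology" where
  "skorokhod_topology a b = Metric_space.mtopology (cadlag_paths a b) (skorokhod_dist a b)"

definition borel_on :: "'a topology \<Rightarrow> 'a measure" where
  "borel_on S = sigma (topspace S) {U. openin S U}"

definition weak_conv_on :: "'a topology \<Rightarrow> (nat \<Rightarrow> 'a measure) \<Rightarrow> 'a measure \<Rightarrow> bool" where
  "weak_conv_on S \<mu>s \<mu> \<longleftrightarrow>
     (\<forall>f :: 'a \<Rightarrow> real. continuous_map S euclideanreal f \<longrightarrow> bounded (f ` topspace S) \<longrightarrow>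
        (\<lambda>n. \<integral>x. f x \<partial>\<mu>s n) \<longlonglongrightarrow> (\<integral>x. f x \<partial>\<mu>))"

text \<open>A process, indexed by time first, need only have almost all of its paths in the Skorokhod
  space; its law there is that of any genuine random element almost surely equal to it on
  \<^term>\<open>{a..b}\<close>.\<close>

definition skorokhod_version ::
  "'a measure \<Rightarrow> real \<Rightarrow> real \<Rightarrow> (real \<Rightarrow> 'a \<Rightarrow> real) \<Rightarrow> ('a \<Rightarrow> real \<Rightarrow> real) \<Rightarrow> bool" where
  "skorokhod_version M a b X X' \<longleftrightarrow>
     X' \<in> measurable M (borel_on (skorokhod_topology a b)) \<and>
     (AE \<omega> in M. \<forall>t\<in>{a..b}. X' \<omega> t = X t \<omega>)"

definition skorokhod_weak_conv ::
  "real \<Rightarrow> real \<Rightarrow> 'a measure \<Rightarrow> (nat \<Rightarrow> real \<Rightarrow> 'a \<Rightarrow> real) \<Rightarrow> 'b measure \<Rightarrow> (real \<Rightarrow> 'b \<Rightarrow> real) \<Rightarrow> bool" where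
  "skorokhod_weak_conv a b M X N Z \<longleftrightarrow>
     (\<exists>X' Z'. (\<forall>T. skorokhod_version M a b (X T) (X' T)) \<and> skorokhod_version N a b Z Z' \<and>
        weak_conv_on (skorokhod_topology a b)
          (\<lambda>T. distr M (borel_on (skorokhod_topology a b)) (X' T))
          (distr N (borel_on (skorokhod_topology a b)) Z'))"

definition standard_brownian_motion :: "'b measure \<Rightarrow> (real \<Rightarrow> 'b \<Rightarrow> real) \<Rightarrow> bool" where
  "standard_brownian_motion N B \<longleftrightarrow>
     prob_space N \<and>
     (\<forall>t\<ge>0. B t \<in> borel_measurable N) \<and>
     (AE \<omega> in N. B 0 \<omega> = 0) \<and>
     (\<forall>s t. 0 \<le> s \<longrightarrow> s < t \<longrightarrow>
        distributed N lborel (\<lambda>\<omega>. B t \<omega> - B s \<omega>) (\<lambda>x. ennreal (normal_density 0 (sqrt (t - s)) x))) \<and>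
     (\<forall>(\<tau> :: nat \<Rightarrow> real) n. 0 \<le> \<tau> 0 \<longrightarrow> strict_mono \<tau> \<longrightarrow>
        prob_space.indep_vars N (\<lambda>_. borel) (\<lambda>i \<omega>. B (\<tau> (Suc i)) \<omega> - B (\<tau> i) \<omega>) {..<n}) \<and>
     (AE \<omega> in N. continuous_on {0..} (\<lambda>t. B t \<omega>))"

text \<open>Sequences are indexed from 1; index 0 plays no role.\<close>

definition strictly_stationary :: "'a measure \<Rightarrow> (nat \<Rightarrow> 'a \<Rightarrow> real) \<Rightarrow> bool" where
  "strictly_stationary M \<epsilon> \<longleftrightarrow>
     (\<forall>t\<ge>1. \<epsilon> t \<in> borel_measurable M) \<and>
     (\<forall>n k. distr M (\<Pi>\<^sub>M i\<in>{1..n}. borel) (\<lambda>\<omega>. \<lambda>i\<in>{1..n}. \<epsilon> (i + k) \<omega>) =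
            distr M (\<Pi>\<^sub>M i\<in>{1..n}. borel) (\<lambda>\<omega>. \<lambda>i\<in>{1..n}. \<epsilon> i \<omega>))"

definition cov :: "'a measure \<Rightarrow> ('a \<Rightarrow> real) \<Rightarrow> ('a \<Rightarrow> real) \<Rightarrow> real" where
  "cov M X Y = (\<integral>\<omega>. (X \<omega> - (\<integral>\<omega>'. X \<omega>' \<partial>M)) * (Y \<omega> - (\<integral>\<omega>'. Y \<omega>' \<partial>M)) \<partial>M)"

text \<open>The two Brownian limits may live on probability spaces of their own, as only their laws matter.
  The Cesaro-weighted sum in the last conjunct is the variance of
  \<open>(\<epsilon> 1 + \<dots> + \<epsilon> T) / sqrt T\<close>; its limit identifies the scale \<open>\<eta>\<close>.\<close>

definition innovation_conditions ::
  "'a measure \<Rightarrow> (nat \<Rightarrow> 'a \<Rightarrow> real) \<Rightarrow> real \<Rightarrow> real \<Rightarrow>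
   'b measure \<Rightarrow> (real \<Rightarrow> 'b \<Rightarrow> real) \<Rightarrow> 'c measure \<Rightarrow> (real \<Rightarrow> 'c \<Rightarrow> real) \<Rightarrow> bool" where
  "innovation_conditions M \<epsilon> \<eta> \<eta>' N B N2 B2 \<longleftrightarrow>
     prob_space M \<and> strictly_stationary M \<epsilon> \<and>
     integrable M (\<lambda>\<omega>. \<bar>\<epsilon> 1 \<omega>\<bar> ^ 4) \<and> (\<integral>\<omega>. \<epsilon> 1 \<omega> \<partial>M) = 0 \<and>
     summable (\<lambda>t. cov M (\<lambda>\<omega>. (\<epsilon> 1 \<omega>)\<^sup>2) (\<lambda>\<omega>. (\<epsilon> (1 + Suc t) \<omega>)\<^sup>2)) \<and>
     0 < \<eta> \<and> 0 < \<eta>' \<and>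
     standard_brownian_motion N B \<and> standard_brownian_motion N2 B2 \<and>
     skorokhod_weak_conv 0 1 M
       (\<lambda>T s \<omega>. (1 / sqrt (real T)) * (\<Sum>i = 1..nat \<lfloor>real T * s\<rfloor>. \<epsilon> i \<omega>))
       N (\<lambda>s \<omega>. \<eta> * B s \<omega>) \<and>
     skorokhod_weak_conv 0 1 M
       (\<lambda>T s \<omega>. (1 / sqrt (real T)) *
          (\<Sum>i = 1..nat \<lfloor>real T * s\<rfloor>. (\<epsilon> i \<omega>)\<^sup>2 - (\<integral>\<omega>'. (\<epsilon> i \<omega>')\<^sup>2 \<partial>M)))
       N2 (\<lambda>s \<omega>. \<eta>' * B2 s \<omega>) \<and>
     (\<lambda>T. (\<integral>\<omega>. (\<epsilon> 1 \<omega>)\<^sup>2 \<partial>M) +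
          2 * (\<Sum>t = 1..T. (real T - real t) / real T * (\<integral>\<omega>. \<epsilon> 1 \<omega> * \<epsilon> (1 + t) \<omega> \<partial>M)))
       \<longlonglongrightarrow> \<eta>\<^sup>2"

definition bounded_variation :: "(real \<Rightarrow> real) \<Rightarrow> bool" where
  "bounded_variation f \<longleftrightarrow>
     (\<exists>C. \<forall>(x :: nat \<Rightarrow> real) n. mono x \<longrightarrow> (\<Sum>i<n. \<bar>f (x (Suc i)) - f (x i)\<bar>) \<le> C)"

definition kernel_conditions :: "(real \<Rightarrow> real) \<Rightarrow> bool" where
  "kernel_conditions K \<longleftrightarrow>
     (\<forall>z. 0 \<le> K z) \<and>
     bounded (range K) \<and>
     has_bochner_integral lborel K 1 \<and> has_bochner_integral lborel (\<lambda>z. z * K z) 0 \<and>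
     (\<forall>z. K differentiable (at z)) \<and> (\<forall>z. deriv K differentiable (at z)) \<and>
     continuous_on UNIV (deriv (deriv K)) \<and> bounded (range (deriv K)) \<and>
     bounded_variation K"

text \<open>The library's \<open>x / 0 = 0\<close> subsumes the convention \<open>0 / 0 = 0\<close>: for a path started at 0, a
  vanishing denominator here or in the \<open>t\<close>-type process below forces either \<open>n \<le> 1\<close> or
  \<open>y 0 = \<dots> = y (n - 1) = 0\<close>, and the numerator vanishes too.\<close>

definition weighted_DF :: "(real \<Rightarrow> real) \<Rightarrow> real \<Rightarrow> (nat \<Rightarrow> real) \<Rightarrow> nat \<Rightarrow> real \<Rightarrow> real" where
  "weighted_DF K h y T s = (let n = nat \<lfloor>real T * s\<rfloor> in
     ((1 / real n) * (\<Sum>t = 1..n. y (t - 1) * (y t - y (t - 1)) * K ((real n - real t) / h))) /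
     ((1 / (real n)\<^sup>2) * (\<Sum>t = 1..n. (y (t - 1))\<^sup>2)))"

definition rho_hat :: "(nat \<Rightarrow> real) \<Rightarrow> nat \<Rightarrow> real" where
  "rho_hat y n = (\<Sum>t = 1..n. y (t - 1) * y t) / (\<Sum>t = 1..n. (y (t - 1))\<^sup>2)"

definition S_sq :: "(nat \<Rightarrow> real) \<Rightarrow> nat \<Rightarrow> real" where
  "S_sq y n = (1 / (real n - 1)) * (\<Sum>t = 1..n. (y t - rho_hat y n * y (t - 1))\<^sup>2)"

definition xi_hat :: "(nat \<Rightarrow> real) \<Rightarrow> nat \<Rightarrow> real" where
  "xi_hat y n = sqrt (S_sq y n / (\<Sum>t = 1..n. (y (t - 1))\<^sup>2))"

definition t_type_DF :: "(real \<Rightarrow> real) \<Rightarrow> real \<Rightarrow> (nat \<Rightarrow> real) \<Rightarrow> nat \<Rightarrow> real \<Rightarrow> real" where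
  "t_type_DF K h y T s = (if s = 0 then 0 else
     weighted_DF K h y T s / (real (nat \<lfloor>real T * s\<rfloor>) * xi_hat y (nat \<lfloor>real T * s\<rfloor>)))"

definition limit_DF :: "(real \<Rightarrow> real) \<Rightarrow> real \<Rightarrow> real \<Rightarrow> (real \<Rightarrow> real) \<Rightarrow> real \<Rightarrow> real" where
  "limit_DF K \<zeta> \<theta> w s = (if s = 0 then 0 else
     (1 / 2) * (\<theta> * K 0 * (w s)\<^sup>2
        + \<theta> * \<zeta> * (LINT r:{0..s}|lborel. (w r)\<^sup>2 * deriv K (\<zeta> * (s - r)))
        - inverse \<theta> * (LINT r:{0..s}|lborel. K (\<zeta> * (s - r))))
     / sqrt (LINT r:{0..s}|lborel. (w r)\<^sup>2))"

end

theory Submission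
  imports Defs
begin

text \<open>Summation by parts and \<open>\<Delta>(Y\<^sup>2) = 2 Y \<Delta>Y + \<epsilon>\<^sup>2\<close> write the statistic as a functional of the rescaled
  partial sum path and of the quadratic variation \<open>\<Sum>\<epsilon>\<^sup>2\<close>, whose rescaling tends uniformly to \<open>\<sigma>\<^sup>2 s\<close>
  in probability by the second invariance principle. This functional converges along every sequence of
  paths that converges to a continuous path not vanishing near 0: its sums are integrals of step functions,
  to which dominated convergence applies, and uniformity in \<open>s\<close> comes from compactness of \<open>[\<kappa>, 1]\<close>.
  Almost all Brownian paths are of this kind, so the limit law follows from an extended continuous mapping
  theorem, which is proved with Lipschitz envelopes and needs neither tightness nor almost sure
  representations.\<close>

section \<open>Weak convergence in metric spaces\<close>

text \<open>Two obstacles shape the argument. The invariance principles for the innovations and for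
  their squares are assumed separately, so no joint law of the two partial sum processes is
  available. But the quadratic variation is divided by \<open>T\<close> and not by the
  \<open>sqrt T\<close> of its fluctuations, hence its limit is deterministic and its error can
  enter as a remainder that is small in mean. Moreover the functional changes with \<open>T\<close>,
  through \<open>h T\<close> and the grid, so a continuous mapping theorem for one fixed functional
  does not apply. The version used here compares sample points instead: any sample point with large
  \<open>T\<close>, a path near a typical limit path and a small remainder must give a value near
  the limiting one. Since the sample points may change with \<open>T\<close>, this is a question
  about arbitrary deterministic sequences. An envelope is a supremum over possibly uncountably many
  sample points, yet it is continuous, so its measurability costs nothing. Times start at
  \<open>\<kappa>\<close> because the denominator of the limit degenerates at 0.\<close>

context Metric_space
begin

lemma continuous_map_real_iff:
  fixes f :: "'a \<Rightarrow> real"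
  shows "continuous_map mtopology euclideanreal f \<longleftrightarrow>
    (\<forall>x\<in>M. \<forall>e>0. \<exists>r>0. \<forall>y\<in>M. d x y < r \<longrightarrow> \<bar>f x - f y\<bar> < e)" (is "?L \<longleftrightarrow> ?R")
proof
  assume L: ?L
  show ?R
  proof (intro ballI allI impI)
    fix x e assume x: "x \<in> M" and e: "(e::real) > 0"
    then obtain r where "r > 0" "\<And>y. y \<in> M \<Longrightarrow> d x y < r \<Longrightarrow> f y \<in> ball (f x) e"
      using L unfolding continuous_map_from_metric
      by (metis centre_in_ball open_ball open_openin)
    then show "\<exists>r>0. \<forall>y\<in>M. d x y < r \<longrightarrow> \<bar>f x - f y\<bar> < e"
      by (auto simp: dist_real_def)
  qed
next
  assume R: ?R
  show ?L unfolding continuous_map_from_metric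
  proof (intro conjI ballI allI impI)
    fix x U assume x: "x \<in> M" and U: "openin euclideanreal U \<and> f x \<in> U"
    then obtain e where e: "e > 0" "ball (f x) e \<subseteq> U" by (auto simp: open_contains_ball)
    then obtain r where "r > 0" "\<forall>y\<in>M. d x y < r \<longrightarrow> \<bar>f x - f y\<bar> < e" using R x by blast
    then show "\<exists>r>0. \<forall>y. y \<in> M \<and> d x y < r \<longrightarrow> f y \<in> U"
      using e by (intro exI[of _ r]) (auto simp: dist_real_def subset_iff)
  qed auto
qed

text \<open>A supremum of \<open>k\<close>-Lipschitz functions is \<open>k\<close>-Lipschitz
  whatever its index set, and the bound \<open>C\<close> keeps it finite. Nothing is asked of
  \<open>c\<close> or \<open>y\<close> as functions of the index, so the indices can later be pairs
  of a time and a sample point.\<close>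

lemma lipschitz_envelope:
  fixes c :: "'i \<Rightarrow> real"
  assumes I: "I \<noteq> {}" and c: "\<And>i. i \<in> I \<Longrightarrow> c i \<le> C" and y: "\<And>i. i \<in> I \<Longrightarrow> y i \<in> M" and k: "0 \<le> k"
  shows "bdd_above ((\<lambda>i. c i - k * d x (y i)) ` I)"
    and "continuous_map mtopology euclideanreal (\<lambda>x. SUP i\<in>I. c i - k * d x (y i))"
proof -
  show bdd: "bdd_above ((\<lambda>i. c i - k * d x (y i)) ` I)" for x
    using c k by (intro bdd_aboveI2[of _ _ C]) (smt (verit) mult_nonneg_nonneg nonneg)
  let ?g = "\<lambda>x. SUP i\<in>I. c i - k * d x (y i)"
  have le: "?g x \<le> ?g z + k * d x z" if "x \<in> M" "z \<in> M" for x z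
  proof (rule cSUP_least[OF I])
    fix i assume i: "i \<in> I"
    have "d z (y i) \<le> d x z + d x (y i)" using triangle[of z x "y i"] that y[OF i] by (simp add: commute)
    then have "k * d z (y i) \<le> k * (d x z + d x (y i))" using k by (rule mult_left_mono)
    moreover have "c i - k * d z (y i) \<le> ?g z" by (rule cSUP_upper[OF i bdd])
    ultimately show "c i - k * d x (y i) \<le> ?g z + k * d x z" by (simp add: algebra_simps)
  qed
  show "continuous_map mtopology euclideanreal ?g" unfolding continuous_map_real_iff
  proof (intro ballI allI impI)
    fix x and e :: real assume x: "x \<in> M" and e: "e > 0"
    \<comment> \<open>The radius is taken with \<open>k + 1\<close> because \<open>k\<close> may be
      0.\<close>
    have "\<bar>?g x - ?g z\<bar> < e" if z: "z \<in> M" and xz: "d x z < e / (k + 1)" for z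
    proof -
      have "k * d x z \<le> (k + 1) * d x z" using nonneg by (simp add: algebra_simps)
      also have "\<dots> < e" using xz k by (simp add: field_simps)
      finally show ?thesis using le[OF x z] le[OF z x] commute[of x z] by (simp add: abs_less_iff)
    qed
    then show "\<exists>r>0. \<forall>z\<in>M. d x z < r \<longrightarrow> \<bar>?g x - ?g z\<bar> < e"
      using e k by (intro exI[of _ "e / (k + 1)"]) auto
  qed
qed

text \<open>The function is the distance to the complement; its negative \<open>h\<close> is an
  envelope with \<open>c = 0\<close> and \<open>k = 1\<close>. The whole space is treated apart
  because its complement is empty and leaves no supremum to take.\<close>

lemma open_eq_positive_set:
  assumes U: "openin mtopology U"
  obtains g :: "'a \<Rightarrow> real" where "continuous_map mtopology euclideanreal g" "U = {x \<in> M. g x > 0}"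
proof (cases "U = M")
  case True
  then show ?thesis using that[of "\<lambda>_. 1"] by simp
next
  case False
  have UM: "U \<subseteq> M" using U by (simp add: openin_mtopology)
  then have ne: "M - U \<noteq> {}" using False by blast
  define h where "h x = (SUP y\<in>M - U. 0 - 1 * d x y)" for x
  have bdd: "bdd_above ((\<lambda>y. 0 - 1 * d x y) ` (M - U))" for x
    by (rule lipschitz_envelope(1)[OF ne, of "\<lambda>_. 0" 0 "\<lambda>y. y" 1]) auto
  have cont: "continuous_map mtopology euclideanreal h"
    unfolding h_def by (rule lipschitz_envelope(2)[OF ne, of "\<lambda>_. 0" 0 "\<lambda>y. y" 1]) auto
  have pos: "- h x > 0" if x: "x \<in> U" for x
  proof -
    obtain r where r: "r > 0" "mball x r \<subseteq> U" using U x unfolding openin_mtopology by blast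
    have "h x \<le> - r" unfolding h_def
    proof (rule cSUP_least[OF ne])
      fix y assume "y \<in> M - U"
      then have "y \<notin> mball x r" "y \<in> M" using r(2) by blast+
      then have "r \<le> d x y" using x UM by (simp add: subset_iff)
      then show "0 - 1 * d x y \<le> - r" by simp
    qed
    then show ?thesis using r by simp
  qed
  have npos: "\<not> - h x > 0" if x: "x \<in> M - U" for x
  proof -
    have "0 - 1 * d x x \<le> h x" unfolding h_def by (rule cSUP_upper[OF x bdd])
    then show ?thesis using mdist_zero[of x] x by simp
  qed
  have "U = {x \<in> M. - h x > 0}" using pos npos UM by blast
  then show ?thesis by (rule that[OF continuous_map_minus[OF cont]])
qed

end

section \<open>Borel sets of a topology and measurable random elements\<close>

lemma space_borel_on [simp]: "space (borel_on S) = topspace S"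
  by (simp add: borel_on_def space_measure_of_conv)

lemma sets_borel_on: "sets (borel_on S) = sigma_sets (topspace S) {U. openin S U}"
  unfolding borel_on_def by (rule sets_measure_of) (use openin_subset in blast)

lemma borel_measurable_continuous_map:
  fixes f :: "'a \<Rightarrow> real"
  assumes "continuous_map S euclideanreal f"
  shows "f \<in> borel_measurable (borel_on S)"
proof (rule borel_measurableI)
  fix U :: "real set" assume "open U"
  then have "openin S {x \<in> topspace S. f x \<in> U}"
    using assms by (auto simp: continuous_map_def)
  moreover have "f -` U \<inter> space (borel_on S) = {x \<in> topspace S. f x \<in> U}" by auto
  ultimately show "f -` U \<inter> space (borel_on S) \<in> sets (borel_on S)"
    by (simp only: sets_borel_on) (auto intro: sigma_sets.Basic)
qed

context Metric_space
begin

text \<open>Open sets are positivity sets of continuous functions, so continuous real functions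
  generate the Borel sets and measurability can be tested on them.\<close>

lemma measurable_borel_onI:
  assumes X: "\<And>w. w \<in> space N \<Longrightarrow> X w \<in> M"
    and g: "\<And>g :: 'a \<Rightarrow> real. continuous_map mtopology euclideanreal g \<Longrightarrow> (\<lambda>w. g (X w)) \<in> borel_measurable N"
  shows "X \<in> measurable N (borel_on mtopology)"
  unfolding borel_on_def
proof (rule measurable_measure_of)
  show "{U. openin mtopology U} \<subseteq> Pow (topspace mtopology)" using openin_subset by blast
  show "X \<in> space N \<rightarrow> topspace mtopology" using X by simp
  fix U assume "U \<in> {U. openin mtopology U}"
  then obtain f :: "'a \<Rightarrow> real" where f: "continuous_map mtopology euclideanreal f" "U = {x \<in> M. f x > 0}"
    using open_eq_positive_set by blast
  have "X -` U \<inter> space N = {w \<in> space N. f (X w) > 0}" using f X by auto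
  also have "\<dots> \<in> sets N" using g[OF f(1)] by measurable
  finally show "X -` U \<inter> space N \<in> sets N" .
qed

text \<open>Composed with a continuous real function, this is closure of real random variables under
  pointwise limits.\<close>

lemma measurable_borel_on_limit:
  assumes Xk: "\<And>k. Xk k \<in> measurable N (borel_on mtopology)"
    and X: "\<And>w. w \<in> space N \<Longrightarrow> X w \<in> M"
    and lim: "\<And>w. w \<in> space N \<Longrightarrow> (\<lambda>k. d (Xk k w) (X w)) \<longlonglongrightarrow> 0"
  shows "X \<in> measurable N (borel_on mtopology)"
proof (rule measurable_borel_onI[OF X])
  fix g :: "'a \<Rightarrow> real" assume g: "continuous_map mtopology euclideanreal g"
  show "(\<lambda>w. g (X w)) \<in> borel_measurable N"
  proof (rule borel_measurable_LIMSEQ_real)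
    show "(\<lambda>w. g (Xk k w)) \<in> borel_measurable N" for k
      using measurable_compose[OF Xk borel_measurable_continuous_map[OF g]] .
    fix w assume w: "w \<in> space N"
    have XkM: "Xk k w \<in> M" for k using measurable_space[OF Xk w] by simp
    then have "limitin mtopology (\<lambda>k. Xk k w) (X w) sequentially"
      using X[OF w] lim[OF w] by (simp add: limitin_metric_dist_null)
    from continuous_map_limit[OF g this] show "(\<lambda>k. g (Xk k w)) \<longlonglongrightarrow> g (X w)"
      by (simp add: o_def)
  qed
qed auto

text \<open>The functions \<open>V n\<close> of the proof are Lipschitz upper envelopes of the family \<open>W T\<close>, \<open>T \<ge> n\<close>,
  along \<open>X T\<close>, with the remainder \<open>q\<close> penalized; weak convergence controls their means, and they
  decrease to the limit variable.\<close>

lemma weak_conv_limsup: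
  fixes W :: "nat \<Rightarrow> 'c \<Rightarrow> real" and W' :: "'b \<Rightarrow> real"
  assumes P: "prob_space P" and N: "prob_space N"
    and X: "\<And>T. X T \<in> measurable P (borel_on mtopology)" and X': "X' \<in> measurable N (borel_on mtopology)"
    and wc: "weak_conv_on mtopology (\<lambda>T. distr P (borel_on mtopology) (X T)) (distr N (borel_on mtopology) X')"
    and W: "\<And>T. W T \<in> borel_measurable P" and W': "W' \<in> borel_measurable N"
    and bW: "\<And>T w. w \<in> space P \<Longrightarrow> \<bar>W T w\<bar> \<le> C" and bW': "\<And>w. w \<in> space N \<Longrightarrow> \<bar>W' w\<bar> \<le> C"
    and q: "\<And>T. q T \<in> borel_measurable P" "\<And>T w. 0 \<le> q T w" "\<And>T w. q T w \<le> (1::real)" "(\<lambda>T. \<integral>w. q T w \<partial>P) \<longlonglongrightarrow> 0"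
    and A: "AE w in P. w \<in> A" and A': "AE w in N. w \<in> A'"
    and close: "\<And>w' e. w' \<in> A' \<Longrightarrow> w' \<in> space N \<Longrightarrow> e > 0 \<Longrightarrow> \<exists>n. \<forall>T\<ge>n. \<forall>w\<in>A \<inter> space P.
        d (X T w) (X' w') < 1 / Suc n \<longrightarrow> q T w < 1 / Suc n \<longrightarrow> W T w \<le> W' w' + e"
    and e: "e > 0"
  shows "eventually (\<lambda>T. (\<integral>w. W T w \<partial>P) \<le> (\<integral>w. W' w \<partial>N) + e) sequentially"
proof -
  interpret P: prob_space P by fact
  interpret N: prob_space N by fact
  have C: "0 \<le> C" using bW'[of "SOME w. w \<in> space N"] N.not_empty by (force simp: some_in_eq)
  have XM: "X T w \<in> M" if "w \<in> space P" for T w using measurable_space[OF X that] by simp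
  have X'M: "X' w \<in> M" if "w \<in> space N" for w using measurable_space[OF X' that] by simp
  define I where "I n = {(T, w). n \<le> T \<and> w \<in> A \<inter> space P}" for n :: nat
  \<comment> \<open>\<open>c\<close> charges the remainder at the same rate \<open>n\<close> at
    which \<open>H\<close> charges the distance, so that an index far away in either sense drops out
    as \<open>n\<close> grows.\<close>
  define c where "c n i = W (fst i) (snd i) - real n * q (fst i) (snd i)" for n and i :: "nat \<times> 'c"
  define H where "H n x = (SUP i\<in>I n. c n i - real n * d x (X (fst i) (snd i)))" for n x
  \<comment> \<open>\<open>H n\<close> need not be bounded below. The cut at \<open>- C\<close>
    makes it an admissible test function and does no harm, since \<open>W'\<close> is at least
    \<open>- C\<close>.\<close>
  define V where "V n x = max (- C) (H n x)" for n x
  have "\<exists>w. w \<in> A \<and> w \<in> space P"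
  proof (rule ccontr)
    assume none: "\<not> ?thesis"
    have "AE w in P. False" using A AE_space by eventually_elim (use none in blast)
    then show False by (simp add: P.AE_False)
  qed
  then have ne: "I n \<noteq> {}" for n by (auto simp: I_def)
  have cle: "c n i \<le> C" if "i \<in> I n" for n i
  proof -
    have "W (fst i) (snd i) \<le> C" using bW[of "snd i" "fst i"] that by (auto simp: I_def abs_le_iff)
    moreover have "0 \<le> real n * q (fst i) (snd i)" using q by simp
    ultimately show ?thesis by (simp add: c_def)
  qed
  have XI: "X (fst i) (snd i) \<in> M" if "i \<in> I n" for n i using that XM by (auto simp: I_def)
  have bdd: "bdd_above ((\<lambda>i. c n i - real n * d x (X (fst i) (snd i))) ` I n)" for n x
    by (rule lipschitz_envelope(1)[OF ne cle XI]) auto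
  have Hcont: "continuous_map mtopology euclideanreal (H n)" for n
    unfolding H_def by (rule lipschitz_envelope(2)[OF ne cle XI]) auto
  have Vcont: "continuous_map mtopology euclideanreal (V n)" for n
    unfolding V_def using Hcont by (intro continuous_map_real_max) auto
  have HC: "H n x \<le> C" if "x \<in> M" for n x
    unfolding H_def
  proof (rule cSUP_least[OF ne])
    fix i assume i: "i \<in> I n"
    show "c n i - real n * d x (X (fst i) (snd i)) \<le> C"
    proof -
      have "0 \<le> real n * d x (X (fst i) (snd i))" by (intro mult_nonneg_nonneg nonneg) simp
      then show ?thesis using cle[OF i] by linarith
    qed
  qed
  have VC: "\<bar>V n x\<bar> \<le> C" if "x \<in> M" for n x using HC[OF that, of n] C by (simp add: V_def abs_le_iff)
  have bV: "bounded (V n ` topspace mtopology)" for n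
    unfolding bounded_real using VC by auto
  have Vm: "V n \<in> borel_measurable (borel_on mtopology)" for n
    by (rule borel_measurable_continuous_map[OF Vcont])
  have VX: "(\<lambda>w. V n (X T w)) \<in> borel_measurable P" for n T by (rule measurable_compose[OF X Vm])
  have VX': "(\<lambda>w. V n (X' w)) \<in> borel_measurable N" for n by (rule measurable_compose[OF X' Vm])
  have conv: "(\<lambda>T. \<integral>w. V n (X T w) \<partial>P) \<longlonglongrightarrow> (\<integral>w. V n (X' w) \<partial>N)" for n
    using wc Vcont[of n] bV[of n] unfolding weak_conv_on_def
    by (auto simp: integral_distr[OF X Vm] integral_distr[OF X' Vm])
  have up: "(\<integral>w. W T w \<partial>P) \<le> (\<integral>w. V n (X T w) \<partial>P) + real n * (\<integral>w. q T w \<partial>P)" if T: "n \<le> T" for n T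
  proof -
    have i1: "integrable P (\<lambda>w. V n (X T w))"
      by (rule P.integrable_const_bound[of _ C]) (use VX VC XM in auto)
    have i2: "integrable P (q T)"
      by (rule P.integrable_const_bound[of _ 1]) (use q in auto)
    have i3: "integrable P (W T)"
      by (rule P.integrable_const_bound[of _ C]) (use W bW in auto)
    have "(\<integral>w. W T w \<partial>P) \<le> (\<integral>w. V n (X T w) + real n * q T w \<partial>P)"
    proof (rule integral_mono_AE)
      \<comment> \<open>The pair \<open>(T, w)\<close> itself competes in the supremum at
        \<open>X T w\<close>, where its distance penalty is 0.\<close>
      show "AE w in P. W T w \<le> V n (X T w) + real n * q T w"
        using A AE_space
      proof eventually_elim
        fix w assume w: "w \<in> A" "w \<in> space P"
        then have i: "(T, w) \<in> I n" using T by (simp add: I_def)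
        have "W T w - real n * q T w \<le> H n (X T w)"
          using cSUP_upper[OF i bdd, of "X T w"] mdist_zero XM[OF w(2)] by (simp add: H_def c_def)
        then show "W T w \<le> V n (X T w) + real n * q T w" by (simp add: V_def)
      qed
    qed (use i1 i2 i3 in auto)
    also have "\<dots> = (\<integral>w. V n (X T w) \<partial>P) + real n * (\<integral>w. q T w \<partial>P)"
      using i1 i2 by simp
    finally show ?thesis .
  qed
  \<comment> \<open>The maximum with \<open>W'\<close> leaves only an upper bound for
    \<open>V n\<close> to prove. Indices close to \<open>X' w\<close> with small remainder are
    controlled by \<open>close\<close>; any other index pays at least \<open>n / Suc m\<close>,
    which from \<open>k\<close> on is at least the oscillation \<open>2 * C\<close>.\<close>
  have Vlim: "(\<lambda>n. max (V n (X' w)) (W' w)) \<longlonglongrightarrow> W' w" if w: "w \<in> A'" "w \<in> space N" for w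
  proof (rule LIMSEQ_I)
    fix r :: real assume r: "0 < r"
    then obtain m where m: "\<And>T v. m \<le> T \<Longrightarrow> v \<in> A \<inter> space P \<Longrightarrow> d (X T v) (X' w) < 1 / Suc m \<Longrightarrow>
        q T v < 1 / Suc m \<Longrightarrow> W T v \<le> W' w + r / 2"
      using close[OF w, of "r/2"] by auto
    obtain k :: nat where k: "2 * C * Suc m \<le> k" using real_arch_simple by blast
    have "V n (X' w) \<le> W' w + r / 2" if n: "max m k \<le> n" for n
    proof -
      have far: "W T v - real n * z \<le> - C" if "v \<in> space P" "\<not> z < 1 / Suc m" for z T v
      proof -
        have "2 * C = (2 * C * Suc m) * (1 / Suc m)" by simp
        also have "\<dots> \<le> real n * z" using that k n C by (intro mult_mono) auto
        finally show ?thesis using bW[OF that(1), of T] by simp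
      qed
      have "H n (X' w) \<le> W' w + r / 2" unfolding H_def
      proof (rule cSUP_least[OF ne])
        fix i assume i: "i \<in> I n"
        obtain T v where Tv: "i = (T, v)" by (cases i)
        have T: "n \<le> T" "v \<in> A \<inter> space P" using i Tv by (auto simp: I_def)
        have n1: "0 \<le> real n * q T v" "0 \<le> real n * d (X' w) (X T v)" using q by auto
        have "W T v - real n * q T v - real n * d (X' w) (X T v) \<le> W' w + r / 2"
        proof (cases "d (X T v) (X' w) < 1 / Suc m \<and> q T v < 1 / Suc m")
          case True
          then have "W T v \<le> W' w + r / 2" using m[of T v] T n by simp
          then show ?thesis using n1 by linarith
        next
          case False
          then have "W T v - real n * q T v \<le> - C \<or> W T v - real n * d (X' w) (X T v) \<le> - C"
            using far[of v "q T v" T] far[of v "d (X' w) (X T v)" T] T commute[of "X' w" "X T v"] by auto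
          then have "W T v - real n * q T v - real n * d (X' w) (X T v) \<le> - C" using n1 by linarith
          then show ?thesis using bW'[OF w(2)] r by (simp add: abs_le_iff)
        qed
        then show "c n i - real n * d (X' w) (X (fst i) (snd i)) \<le> W' w + r / 2" by (simp add: Tv c_def)
      qed
      then show ?thesis using bW'[OF w(2)] r by (simp add: V_def abs_le_iff)
    qed
    then show "\<exists>no. \<forall>n\<ge>no. norm (max (V n (X' w)) (W' w) - W' w) < r"
    proof (intro exI[of _ "max m k"] allI impI)
      fix n assume "max m k \<le> n"
      then have "V n (X' w) \<le> W' w + r / 2" by fact
      then show "norm (max (V n (X' w)) (W' w) - W' w) < r" using r by (simp add: max_def)
    qed
  qed
  have maxC: "norm (max (V n (X' w)) (W' w)) \<le> C" if "w \<in> space N" for n w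
    using VC[OF X'M[OF that], of n] bW'[OF that] by (simp add: max_def)
  have "(\<lambda>n. \<integral>w. max (V n (X' w)) (W' w) \<partial>N) \<longlonglongrightarrow> (\<integral>w. W' w \<partial>N)"
  proof (rule integral_dominated_convergence[where w = "\<lambda>_. C"])
    show "AE w in N. (\<lambda>n. max (V n (X' w)) (W' w)) \<longlonglongrightarrow> W' w" using A' AE_space
      by eventually_elim (rule Vlim)
    show "AE w in N. norm (max (V n (X' w)) (W' w)) \<le> C" for n
      using maxC by (rule AE_I2)
    show "(\<lambda>w. max (V n (X' w)) (W' w)) \<in> borel_measurable N" for n
      using VX' W' by measurable
  qed (use W' in auto)
  then have "eventually (\<lambda>n. (\<integral>w. max (V n (X' w)) (W' w) \<partial>N) < (\<integral>w. W' w \<partial>N) + e / 3) sequentially"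
    by (rule order_tendstoD) (use e in simp)
  \<comment> \<open>\<open>n\<close> is fixed before \<open>T\<close> tends to infinity, so the
    factor \<open>n\<close> in front of the mean of \<open>q T\<close> is harmless.\<close>
  then obtain n where n: "(\<integral>w. max (V n (X' w)) (W' w) \<partial>N) < (\<integral>w. W' w \<partial>N) + e / 3"
    using eventually_happens by force
  have "(\<integral>w. V n (X' w) \<partial>N) \<le> (\<integral>w. max (V n (X' w)) (W' w) \<partial>N)"
  proof (rule integral_mono)
    show "integrable N (\<lambda>w. V n (X' w))"
      by (rule N.integrable_const_bound[of _ C]) (use VX' VC X'M in auto)
    show "integrable N (\<lambda>w. max (V n (X' w)) (W' w))"
    proof (rule N.integrable_const_bound[of _ C])
      show "AE w in N. norm (max (V n (X' w)) (W' w)) \<le> C"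
        using maxC by (rule AE_I2)
      show "(\<lambda>w. max (V n (X' w)) (W' w)) \<in> borel_measurable N" using VX' W' by measurable
    qed
  qed auto
  then have "(\<integral>w. V n (X' w) \<partial>N) < (\<integral>w. W' w \<partial>N) + e / 3" using n by simp
  then have 1: "eventually (\<lambda>T. (\<integral>w. V n (X T w) \<partial>P) < (\<integral>w. W' w \<partial>N) + e / 3) sequentially"
    by (rule order_tendstoD(2)[OF conv])
  have "(\<lambda>T. real n * (\<integral>w. q T w \<partial>P)) \<longlonglongrightarrow> real n * 0" by (intro tendsto_intros q)
  then have 2: "eventually (\<lambda>T. real n * (\<integral>w. q T w \<partial>P) < e / 3) sequentially"
    by (rule order_tendstoD) (use e in simp)
  from 1 2 eventually_ge_at_top[of n] show ?thesis
  proof eventually_elim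
    fix T assume a: "(\<integral>w. V n (X T w) \<partial>P) < (\<integral>w. W' w \<partial>N) + e / 3"
      "real n * (\<integral>w. q T w \<partial>P) < e / 3" "n \<le> T"
    show "(\<integral>w. W T w \<partial>P) \<le> (\<integral>w. W' w \<partial>N) + e" using up[OF a(3)] a e by linarith
  qed
qed

text \<open>An extended continuous mapping theorem in terms of means. \<open>W T\<close> need not be
  a function of the path \<open>X T\<close>; it is enough that \<open>close\<close> holds across
  sample points. The two halves are the one-sided bound for \<open>W\<close> and for
  \<open>- W\<close>.\<close>

lemma weak_conv_mapping:
  fixes W :: "nat \<Rightarrow> 'c \<Rightarrow> real" and W' :: "'b \<Rightarrow> real"
  assumes P: "prob_space P" and N: "prob_space N"
    and X: "\<And>T. X T \<in> measurable P (borel_on mtopology)" and X': "X' \<in> measurable N (borel_on mtopology)"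
    and wc: "weak_conv_on mtopology (\<lambda>T. distr P (borel_on mtopology) (X T)) (distr N (borel_on mtopology) X')"
    and W: "\<And>T. W T \<in> borel_measurable P" and W': "W' \<in> borel_measurable N"
    and bW: "\<And>T w. w \<in> space P \<Longrightarrow> \<bar>W T w\<bar> \<le> C" and bW': "\<And>w. w \<in> space N \<Longrightarrow> \<bar>W' w\<bar> \<le> C"
    and q: "\<And>T. q T \<in> borel_measurable P" "\<And>T w. 0 \<le> q T w" "\<And>T w. q T w \<le> (1::real)" "(\<lambda>T. \<integral>w. q T w \<partial>P) \<longlonglongrightarrow> 0"
    and A: "AE w in P. w \<in> A" and A': "AE w in N. w \<in> A'"
    and close: "\<And>w' e. w' \<in> A' \<Longrightarrow> w' \<in> space N \<Longrightarrow> e > 0 \<Longrightarrow> \<exists>n. \<forall>T\<ge>n. \<forall>w\<in>A \<inter> space P.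
        d (X T w) (X' w') < 1 / Suc n \<longrightarrow> q T w < 1 / Suc n \<longrightarrow> \<bar>W T w - W' w'\<bar> \<le> e"
  shows "(\<lambda>T. \<integral>w. W T w \<partial>P) \<longlonglongrightarrow> (\<integral>w. W' w \<partial>N)"
proof (rule LIMSEQ_I)
  fix r :: real assume r: "0 < r"
  have up: "eventually (\<lambda>T. (\<integral>w. W T w \<partial>P) \<le> (\<integral>w. W' w \<partial>N) + r / 2) sequentially"
  proof (rule weak_conv_limsup[OF P N X X' wc W W' bW bW' q A A'])
    fix w' e assume "w' \<in> A'" "w' \<in> space N" "(e::real) > 0"
    from close[OF this] show "\<exists>n. \<forall>T\<ge>n. \<forall>w\<in>A \<inter> space P.
        d (X T w) (X' w') < 1 / Suc n \<longrightarrow> q T w < 1 / Suc n \<longrightarrow> W T w \<le> W' w' + e"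
      by (simp add: abs_le_iff algebra_simps) blast
  qed (use r in auto)
  have "eventually (\<lambda>T. (\<integral>w. - W T w \<partial>P) \<le> (\<integral>w. - W' w \<partial>N) + r / 2) sequentially"
  proof (rule weak_conv_limsup[OF P N X X' wc _ _ _ _ q A A'])
    fix w' e assume "w' \<in> A'" "w' \<in> space N" "(e::real) > 0"
    from close[OF this] show "\<exists>n. \<forall>T\<ge>n. \<forall>w\<in>A \<inter> space P.
        d (X T w) (X' w') < 1 / Suc n \<longrightarrow> q T w < 1 / Suc n \<longrightarrow> - W T w \<le> - W' w' + e"
      by (simp add: abs_le_iff algebra_simps) blast
  qed (use r W W' bW bW' in auto)
  with up have "eventually (\<lambda>T. norm ((\<integral>w. W T w \<partial>P) - (\<integral>w. W' w \<partial>N)) < r) sequentially"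
    by eventually_elim (use r in \<open>simp add: abs_less_iff\<close>)
  then show "\<exists>no. \<forall>T\<ge>no. norm ((\<integral>w. W T w \<partial>P) - (\<integral>w. W' w \<partial>N)) < r"
    by (simp add: eventually_sequentially)
qed

end

section \<open>Skorokhod space\<close>

lemma topspace_skorokhod [simp]: "topspace (skorokhod_topology a b) = cadlag_paths a b"
proof -
  interpret Metric_space "cadlag_paths a b" "skorokhod_dist a b" by (rule Metric_space_skorokhod)
  show ?thesis by (simp add: skorokhod_topology_def)
qed

lemma skorokhod_dist_le:
  assumes "x \<in> cadlag_paths a b" "y \<in> cadlag_paths a b" "0 \<le> e" "\<And>t. t \<in> {a..b} \<Longrightarrow> \<bar>x t - y t\<bar> \<le> e"
  shows "skorokhod_dist a b x y \<le> e"
proof -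
  have "skorokhod_bound a b x y e"
    using assms id_time_change[of a b] unfolding skorokhod_bound_def
    by (intro conjI bexI[of _ "\<lambda>t. t"]) auto
  then show ?thesis using assms
    by (auto simp: skorokhod_dist_def intro!: cInf_lower skorokhod_bound_bdd)
qed

lemma skorokhod_dist_lessD:
  assumes xy: "x \<in> cadlag_paths a b" "y \<in> cadlag_paths a b" and d: "skorokhod_dist a b x y < e"
  obtains l where "l \<in> time_changes a b" "\<And>t. t \<in> {a..b} \<Longrightarrow> \<bar>l t - t\<bar> < e"
    "\<And>t. t \<in> {a..b} \<Longrightarrow> \<bar>x t - y (l t)\<bar> < e"
proof -
  have "Inf {e. skorokhod_bound a b x y e} < e" using d xy by (simp add: skorokhod_dist_def)
  then obtain e' where e': "skorokhod_bound a b x y e'" "e' < e"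
    using cInf_lessD[of "{e. skorokhod_bound a b x y e}" e] skorokhod_bound_ex[OF xy] by auto
  then obtain l where "l \<in> time_changes a b" "\<forall>t\<in>{a..b}. \<bar>l t - t\<bar> \<le> e' \<and> \<bar>x t - y (l t)\<bar> \<le> e'"
    unfolding skorokhod_bound_def by blast
  with e'(2) show ?thesis by (intro that[of l]) force+
qed

lemma continuous_cadlag:
  assumes "continuous_on {a..b} x"
  shows "restrict x {a..b} \<in> cadlag_paths a b"
proof -
  have R: "(restrict x {a..b} \<longlongrightarrow> x t) (at_right t)" if t: "t \<in> {a..<b}" for t
  proof -
    have "(x \<longlongrightarrow> x t) (at t within {a..b})" using assms t by (auto simp: continuous_on)
    then have "(x \<longlongrightarrow> x t) (at t within {t<..<b})"
      by (rule tendsto_within_subset) (use t in auto)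
    moreover have "at t within {t<..<b} = at_right t"
      by (rule at_within_nhd[of t "{..<b}"]) (use t in auto)
    ultimately have "(x \<longlongrightarrow> x t) (at_right t)" by simp
    moreover have "eventually (\<lambda>s. x s = restrict x {a..b} s) (at_right t)"
      using t eventually_at_right_less[of t] unfolding eventually_at_right_field
      by (intro exI[of _ b]) auto
    ultimately show ?thesis by (rule Lim_transform_eventually)
  qed
  have L: "(restrict x {a..b} \<longlongrightarrow> x t) (at_left t)" if t: "t \<in> {a<..b}" for t
  proof -
    have "(x \<longlongrightarrow> x t) (at t within {a..b})" using assms t by (auto simp: continuous_on)
    then have "(x \<longlongrightarrow> x t) (at t within {a<..<t})"
      by (rule tendsto_within_subset) (use t in auto)
    moreover have "at t within {a<..<t} = at_left t"
      by (rule at_within_nhd[of t "{a<..}"]) (use t in auto)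
    ultimately have "(x \<longlongrightarrow> x t) (at_left t)" by simp
    moreover have "eventually (\<lambda>s. x s = restrict x {a..b} s) (at_left t)"
      using t unfolding eventually_at_left_field by (intro exI[of _ a]) auto
    ultimately show ?thesis by (rule Lim_transform_eventually)
  qed
  show ?thesis unfolding cadlag_paths_def using R L by fastforce
qed

text \<open>The affine index serves two grids: \<open>c = T\<close>, \<open>e = 0\<close> is the
  sample grid of the statistic, and \<open>c = Suc k\<close>, \<open>e = - a * Suc k\<close> a grid
  anchored at \<open>a\<close>. Negative indices collapse to \<open>v 0\<close>.\<close>

definition step_path :: "real \<Rightarrow> real \<Rightarrow> real \<Rightarrow> real \<Rightarrow> (nat \<Rightarrow> real) \<Rightarrow> real \<Rightarrow> real" where
  "step_path a b c e v = (\<lambda>t\<in>{a..b}. v (nat \<lfloor>c * t + e\<rfloor>))"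

lemma step_path_cadlag:
  assumes c: "0 \<le> c"
  shows "step_path a b c e v \<in> cadlag_paths a b"
proof -
  have cont: "((\<lambda>s. c * s + e) \<longlongrightarrow> c * t + e) (at t within S)" for t S by (intro tendsto_intros)
  have R: "(step_path a b c e v \<longlongrightarrow> step_path a b c e v t) (at_right t)" if t: "t \<in> {a..<b}" for t
  proof (rule tendsto_eventually)
    have "eventually (\<lambda>s. c * s + e < of_int \<lfloor>c * t + e\<rfloor> + 1) (at_right t)"
      by (rule order_tendstoD(2)[OF cont]) linarith
    moreover have "eventually (\<lambda>s. s < b) (at_right t)"
      using t unfolding eventually_at_right_field by (intro exI[of _ b]) auto
    ultimately show "eventually (\<lambda>s. step_path a b c e v s = step_path a b c e v t) (at_right t)"
      using eventually_at_right_less[of t]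
    proof eventually_elim
      fix s assume s: "c * s + e < of_int \<lfloor>c * t + e\<rfloor> + 1" "s < b" "t < s"
      have "c * t \<le> c * s" using s c by (intro mult_left_mono) auto
      then have "\<lfloor>c * s + e\<rfloor> = \<lfloor>c * t + e\<rfloor>" using s(1) by (intro floor_unique) linarith+
      then show "step_path a b c e v s = step_path a b c e v t" using s t by (simp add: step_path_def)
    qed
  qed
  have L: "\<exists>l. (step_path a b c e v \<longlongrightarrow> l) (at_left t)" if t: "t \<in> {a<..b}" for t
  proof (cases "c = 0")
    case True
    show ?thesis
    proof (intro exI tendsto_eventually)
      show "eventually (\<lambda>s. step_path a b c e v s = v (nat \<lfloor>e\<rfloor>)) (at_left t)"
        using t True unfolding eventually_at_left_field
        by (intro exI[of _ a]) (auto simp: step_path_def)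
    qed
  next
    case False
    show ?thesis
    proof (intro exI tendsto_eventually)
      \<comment> \<open>Just left of \<open>t\<close> the floor settles at the ceiling of
        \<open>c * t + e\<close> minus 1, whether or not \<open>t\<close> is a jump time.\<close>
      have "eventually (\<lambda>s. c * s + e > of_int \<lceil>c * t + e\<rceil> - 1) (at_left t)"
        by (rule order_tendstoD(1)[OF cont]) linarith
      moreover have "eventually (\<lambda>s. a < s \<and> s < t) (at_left t)"
        using t unfolding eventually_at_left_field by (intro exI[of _ a]) auto
      ultimately show "eventually (\<lambda>s. step_path a b c e v s = v (nat (\<lceil>c * t + e\<rceil> - 1))) (at_left t)"
      proof eventually_elim
        fix s assume s: "c * s + e > of_int \<lceil>c * t + e\<rceil> - 1" "a < s \<and> s < t"
        have "c * s < c * t" using s c False by (intro mult_strict_left_mono) auto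
        then have "\<lfloor>c * s + e\<rfloor> = \<lceil>c * t + e\<rceil> - 1" using s(1) by (intro floor_unique) (simp, linarith)
        then show "step_path a b c e v s = v (nat (\<lceil>c * t + e\<rceil> - 1))" using s t by (simp add: step_path_def)
      qed
    qed
  qed
  show ?thesis using R L by (auto simp: cadlag_paths_def) (simp add: step_path_def)
qed

text \<open>On \<open>{a..b}\<close> only the coordinates of \<open>v\<close> up to a fixed
  \<open>L\<close> are visible, so the step path depends continuously on the sequence in the product
  topology. A continuous test function of it is then Borel on sequence space, whose Borel sets are
  the product ones.\<close>

lemma step_path_measurable:
  fixes v :: "nat \<Rightarrow> 'a \<Rightarrow> real"
  assumes c: "0 \<le> c" and v: "\<And>n. v n \<in> borel_measurable M"
  shows "(\<lambda>w. step_path a b c e (\<lambda>n. v n w)) \<in> measurable M (borel_on (skorokhod_topology a b))"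
  unfolding skorokhod_topology_def
proof (rule Metric_space.measurable_borel_onI[OF Metric_space_skorokhod])
  interpret Metric_space "cadlag_paths a b" "skorokhod_dist a b" by (rule Metric_space_skorokhod)
  let ?S = "step_path a b c e"
  show "?S (\<lambda>n. v n w) \<in> cadlag_paths a b" for w by (rule step_path_cadlag[OF c])
  fix g :: "(real \<Rightarrow> real) \<Rightarrow> real" assume g: "continuous_map mtopology euclideanreal g"
  have "continuous_on UNIV (\<lambda>u. g (?S u))"
  proof (rule continuous_on_sequentiallyI)
    fix u :: "nat \<Rightarrow> nat \<Rightarrow> real" and u0 assume u: "u \<longlonglongrightarrow> u0"
    have coord: "(\<lambda>k. u k i) \<longlonglongrightarrow> u0 i" for i
      using continuous_on_tendsto_compose[OF continuous_on_product_coordinates[of i] u] by simp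
    define L where "L = nat \<lfloor>c * b + e\<rfloor>"
    define s where "s k = (\<Sum>i\<le>L. \<bar>u k i - u0 i\<bar>)" for k
    have "s \<longlonglongrightarrow> (\<Sum>i\<le>L. \<bar>u0 i - u0 i\<bar>)" unfolding s_def by (intro tendsto_intros coord)
    then have s0: "s \<longlonglongrightarrow> 0" by simp
    have le: "skorokhod_dist a b (?S (u k)) (?S u0) \<le> s k" for k
    proof (rule skorokhod_dist_le[OF step_path_cadlag[OF c] step_path_cadlag[OF c]])
      show "0 \<le> s k" unfolding s_def by (simp add: sum_nonneg)
      fix t assume t: "t \<in> {a..b}"
      have "c * t \<le> c * b" using c t by (intro mult_left_mono) auto
      then have "nat \<lfloor>c * t + e\<rfloor> \<in> {..L}" unfolding L_def by (simp add: floor_mono nat_mono)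
      then have "\<bar>u k (nat \<lfloor>c * t + e\<rfloor>) - u0 (nat \<lfloor>c * t + e\<rfloor>)\<bar> \<le> s k"
        unfolding s_def by (intro member_le_sum[of _ _ "\<lambda>i. \<bar>u k i - u0 i\<bar>"]) auto
      then show "\<bar>?S (u k) t - ?S u0 t\<bar> \<le> s k" using t by (simp add: step_path_def)
    qed
    have "(\<lambda>k. skorokhod_dist a b (?S (u k)) (?S u0)) \<longlonglongrightarrow> 0"
      by (rule tendsto_sandwich[OF _ _ tendsto_const s0]) (use le in auto)
    then have "limitin mtopology (\<lambda>k. ?S (u k)) (?S u0) sequentially"
      using step_path_cadlag[OF c] by (simp add: limitin_metric_dist_null)
    from continuous_map_limit[OF g this] show "(\<lambda>k. g (?S (u k))) \<longlonglongrightarrow> g (?S u0)"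
      by (simp add: o_def)
  qed
  then have "(\<lambda>u. g (?S u)) \<in> borel_measurable borel" by (rule borel_measurable_continuous_onI)
  moreover have "(\<lambda>w n. v n w) \<in> measurable M borel"
  proof -
    have "(\<lambda>w n. v n w) \<in> measurable M (Pi\<^sub>M UNIV (\<lambda>_. borel))"
      by (rule measurable_PiM_single') (use v in \<open>auto simp: space_PiM\<close>)
    then show ?thesis using measurable_cong_sets[OF refl sets_PiM_equal_borel] by blast
  qed
  ultimately show "(\<lambda>w. g (?S (\<lambda>n. v n w))) \<in> borel_measurable M"
    by (rule measurable_compose[rotated])
qed

text \<open>Continuous paths are uniform limits of their discretizations.\<close>

lemma continuous_path_measurable:
  fixes Z :: "real \<Rightarrow> 'a \<Rightarrow> real"
  assumes m: "\<And>t. t \<in> {a..b} \<Longrightarrow> Z t \<in> borel_measurable M"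
    and c: "\<And>w. w \<in> space M \<Longrightarrow> continuous_on {a..b} (\<lambda>t. Z t w)"
  shows "(\<lambda>w. \<lambda>t\<in>{a..b}. Z t w) \<in> measurable M (borel_on (skorokhod_topology a b))"
proof (cases "a \<le> b")
  case False
  \<comment> \<open>On an empty interval every restricted path is the everywhere undefined
    one.\<close>
  then have "(\<lambda>w. \<lambda>t\<in>{a..b}. Z t w) = (\<lambda>w. step_path a b 0 0 (\<lambda>n. 0))"
    by (auto simp: step_path_def fun_eq_iff)
  then show ?thesis using step_path_measurable[of 0 "\<lambda>_ _. 0" M a b 0] by simp
next
  case ab: True
  \<comment> \<open>\<open>min b\<close> keeps the grid points inside the interval, where
    \<open>Z\<close> is known to be measurable.\<close>
  define p where "p k i = min b (a + real i / Suc k)" for k i :: nat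
  define Xk where "Xk k w = step_path a b (Suc k) (- a * real (Suc k)) (\<lambda>i. Z (p k i) w)" for k w
  have p: "p k i \<in> {a..b}" for k i using ab by (auto simp: p_def)
  have Xk: "Xk k \<in> measurable M (borel_on (skorokhod_topology a b))" for k
    unfolding Xk_def by (rule step_path_measurable) (use m p in auto)
  have XkD: "Xk k w \<in> cadlag_paths a b" for k w unfolding Xk_def by (rule step_path_cadlag) simp
  have near: "\<bar>p k (nat \<lfloor>real (Suc k) * t + - a * real (Suc k)\<rfloor>) - t\<bar> \<le> 1 / Suc k" if t: "t \<in> {a..b}" for k and t :: real
  proof -
    define i where "i = nat \<lfloor>real (Suc k) * t + - a * real (Suc k)\<rfloor>"
    have e: "real (Suc k) * t + - a * real (Suc k) = (t - a) * real (Suc k)" by (simp add: algebra_simps)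
    have "0 \<le> (t - a) * real (Suc k)" using t by simp
    then have "real i \<le> (t - a) * real (Suc k)" "(t - a) * real (Suc k) < real i + 1"
      unfolding i_def e by linarith+
    then have "real i / Suc k \<le> t - a" "t - a < real i / Suc k + 1 / Suc k"
      by (simp_all add: field_simps)
    then show ?thesis using t unfolding i_def[symmetric] by (auto simp: p_def)
  qed
  show ?thesis unfolding skorokhod_topology_def
  proof (rule Metric_space.measurable_borel_on_limit[OF Metric_space_skorokhod])
    show "Xk k \<in> measurable M (borel_on (Metric_space.mtopology (cadlag_paths a b) (skorokhod_dist a b)))" for k
      using Xk unfolding skorokhod_topology_def .
    fix w assume w: "w \<in> space M"
    show ZD: "(\<lambda>t\<in>{a..b}. Z t w) \<in> cadlag_paths a b" by (rule continuous_cadlag[OF c[OF w]])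
    have uc: "uniformly_continuous_on {a..b} (\<lambda>t. Z t w)"
      by (rule compact_uniformly_continuous[OF c[OF w]]) simp
    show "(\<lambda>k. skorokhod_dist a b (Xk k w) (\<lambda>t\<in>{a..b}. Z t w)) \<longlonglongrightarrow> 0"
    proof (rule LIMSEQ_I)
      fix r :: real assume r: "0 < r"
      then obtain \<delta> where \<delta>: "\<delta> > 0" "\<And>s t. s \<in> {a..b} \<Longrightarrow> t \<in> {a..b} \<Longrightarrow> dist s t < \<delta> \<Longrightarrow> dist (Z s w) (Z t w) < r / 2"
        using uc unfolding uniformly_continuous_on_def by (metis half_gt_zero)
      obtain k0 where k0: "1 / real (Suc k0) < \<delta>" using nat_approx_posE[OF \<delta>(1)] by blast
      have "norm (skorokhod_dist a b (Xk k w) (\<lambda>t\<in>{a..b}. Z t w) - 0) < r" if k: "k0 \<le> k" for k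
      proof -
        have "1 / real (Suc k) \<le> 1 / Suc k0" using k by (simp add: frac_le)
        then have k': "1 / real (Suc k) < \<delta>" using k0 by linarith
        have "skorokhod_dist a b (Xk k w) (\<lambda>t\<in>{a..b}. Z t w) \<le> r / 2"
        proof (rule skorokhod_dist_le[OF XkD ZD])
          fix t assume t: "t \<in> {a..b}"
          have "dist (p k (nat \<lfloor>real (Suc k) * t + - a * real (Suc k)\<rfloor>)) t < \<delta>"
            using near[OF t, of k] k' by (simp add: dist_real_def)
          from \<delta>(2)[OF p t this] show "\<bar>Xk k w t - (\<lambda>t\<in>{a..b}. Z t w) t\<bar> \<le> r / 2"
            using t by (simp add: Xk_def step_path_def dist_real_def)
        qed (use r in simp)
        moreover have "0 \<le> skorokhod_dist a b (Xk k w) (\<lambda>t\<in>{a..b}. Z t w)"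
          using Metric_space.nonneg[OF Metric_space_skorokhod] .
        ultimately show ?thesis using r by simp
      qed
      then show "\<exists>no. \<forall>n\<ge>no. norm (skorokhod_dist a b (Xk n w) (\<lambda>t\<in>{a..b}. Z t w) - 0) < r" by blast
    qed
  qed
qed

text \<open>Sampling at the points \<open>i / Suc k\<close> gives functions assembled from countably
  many measurable pieces, and continuity of the paths makes them converge. Joint measurability is
  what turns path integrals into random variables.\<close>

lemma continuous_paths_jointly_measurable:
  fixes Z :: "real \<Rightarrow> 'a \<Rightarrow> real"
  assumes m: "\<And>t. Z t \<in> borel_measurable M"
    and c: "\<And>w. w \<in> space M \<Longrightarrow> continuous_on UNIV (\<lambda>t. Z t w)"
  shows "(\<lambda>(w, t). Z t w) \<in> borel_measurable (M \<Otimes>\<^sub>M borel)"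
proof (rule borel_measurable_LIMSEQ_real)
  define p where "p k (i::int) = real_of_int i / Suc k" for k i
  show "(\<lambda>(w, t). Z (p k \<lfloor>real (Suc k) * t\<rfloor>) w) \<in> borel_measurable (M \<Otimes>\<^sub>M borel)" for k
  proof -
    have "(\<lambda>x. (\<lambda>i x. Z (p k i) (fst x)) \<lfloor>real (Suc k) * snd x\<rfloor> x) \<in> borel_measurable (M \<Otimes>\<^sub>M borel)"
    proof (rule measurable_compose_countable)
      show "(\<lambda>x. Z (p k i) (fst x)) \<in> borel_measurable (M \<Otimes>\<^sub>M borel)" for i
        by (rule measurable_compose[OF measurable_fst m])
      show "(\<lambda>x. \<lfloor>real (Suc k) * snd x\<rfloor>) \<in> measurable (M \<Otimes>\<^sub>M borel) (count_space UNIV)"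
        by (rule measurable_compose[OF _ measurable_real_floor]) simp
    qed
    then show ?thesis by (simp add: case_prod_beta')
  qed
  fix x assume "x \<in> space (M \<Otimes>\<^sub>M (borel :: real measure))"
  then have w: "fst x \<in> space M" by (auto simp: space_pair_measure)
  have lim: "(\<lambda>k. p k \<lfloor>real (Suc k) * snd x\<rfloor>) \<longlonglongrightarrow> snd x"
  proof (rule LIMSEQ_I)
    fix r :: real assume "0 < r"
    then obtain k0 where k0: "1 / real (Suc k0) < r" using nat_approx_posE by blast
    have "norm (p k \<lfloor>real (Suc k) * snd x\<rfloor> - snd x) < r" if k: "k0 \<le> k" for k
    proof -
      have "1 / real (Suc k) \<le> 1 / Suc k0" using k by (simp add: frac_le)
      then have k': "1 / real (Suc k) < r" using k0 by linarith
      define j where "j = \<lfloor>real (Suc k) * snd x\<rfloor>"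
      have "real_of_int j \<le> real (Suc k) * snd x" "real (Suc k) * snd x < j + 1" unfolding j_def by linarith+
      then have "p k j \<le> snd x" "snd x < p k j + 1 / Suc k" by (simp_all add: p_def field_simps)
      then show ?thesis using k' unfolding j_def[symmetric] by simp
    qed
    then show "\<exists>no. \<forall>k\<ge>no. norm (p k \<lfloor>real (Suc k) * snd x\<rfloor> - snd x) < r" by blast
  qed
  show "(\<lambda>k. (case x of (w, t) \<Rightarrow> Z (p k \<lfloor>real (Suc k) * t\<rfloor>) w)) \<longlonglongrightarrow> (case x of (w, t) \<Rightarrow> Z t w)"
    using continuous_on_tendsto_compose[OF c[OF w] lim] by (simp add: case_prod_beta')
qed

section \<open>Deterministic limit of the statistic\<close>

text \<open>A sum of varying length becomes an integral over one fixed measure space, where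
  dominated convergence is available.\<close>

lemma sum_step_integral:
  fixes a :: "nat \<Rightarrow> real" and T :: nat
  assumes T: "1 \<le> T"
  shows "(\<Sum>t<m. a t) / T = (\<integral>r. indicator {0..<real m / T} r * a (nat \<lfloor>real T * r\<rfloor>) \<partial>lborel)"
proof -
  have e: "indicator {0..<real m / T} r * a (nat \<lfloor>real T * r\<rfloor>) =
      (\<Sum>t<m. a t * indicator {real t / T..<(real t + 1) / T} r)" for r
  proof (cases "0 \<le> r")
    case False
    moreover have "0 \<le> real t / real T" for t :: nat by simp
    ultimately have "\<not> real t / T \<le> r" for t :: nat by (meson order_trans)
    then have "indicator {real t / T..<(real t + 1) / T} r = (0::real)" for t :: nat
      by (simp add: indicator_def)
    then show ?thesis using False by simp
  next
    case True
    define i where "i = nat \<lfloor>real T * r\<rfloor>"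
    have "0 \<le> real T * r" using True by simp
    then have i: "real i \<le> real T * r" "real T * r < real i + 1" unfolding i_def by linarith+
    have ind: "indicator {real t / T..<(real t + 1) / T} r = (if t = i then 1 else (0::real))" for t
    proof -
      have "r \<in> {real t / T..<(real t + 1) / T} \<longleftrightarrow> real t \<le> real T * r \<and> real T * r < real t + 1"
        using T by (auto simp: field_simps)
      also have "\<dots> \<longleftrightarrow> t = i" using i by auto
      finally show ?thesis by (simp add: indicator_def)
    qed
    have "r < real m / T \<longleftrightarrow> i < m"
    proof -
      have "r < real m / T \<longleftrightarrow> real T * r < real m" using T by (auto simp: field_simps)
      then show ?thesis using i by auto
    qed
    then show ?thesis using True unfolding ind i_def[symmetric]
      by (simp add: indicator_def if_distrib[where f = "(*) _"] cong: if_cong)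
  qed
  have "(\<integral>r. indicator {0..<real m / T} r * a (nat \<lfloor>real T * r\<rfloor>) \<partial>lborel)
      = (\<Sum>t<m. \<integral>r. a t * indicator {real t / T..<(real t + 1) / T} r \<partial>lborel)"
    unfolding e by (rule Bochner_Integration.integral_sum) (auto simp: integrable_mult_right_iff divide_right_mono)
  also have "\<dots> = (\<Sum>t<m. a t * (1 / T))"
  proof (rule sum.cong)
    fix t
    have "(real t + 1) / T - real t / T = 1 / T" by (simp add: add_divide_distrib)
    then show "(\<integral>r. a t * indicator {real t / T..<(real t + 1) / T} r \<partial>lborel) = a t * (1 / T)"
      by (simp add: divide_right_mono)
  qed simp
  also have "\<dots> = (\<Sum>t<m. a t) / T" by (simp add: sum_divide_distrib)
  finally show ?thesis by simp
qed

text \<open>Since \<open>m n \<le> T n\<close>, all the step functions live on \<open>[0, 1]\<close>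
  and are dominated there by a constant.\<close>

lemma riemann_sum_limit:
  fixes a :: "nat \<Rightarrow> nat \<Rightarrow> real" and T m :: "nat \<Rightarrow> nat"
  assumes T: "\<And>n. 1 \<le> T n" and mT: "\<And>n. m n \<le> T n"
    and lim: "(\<lambda>n. real (m n) / T n) \<longlonglongrightarrow> s"
    and bound: "\<And>n t. t < m n \<Longrightarrow> \<bar>a n t\<bar> \<le> C"
    and g: "continuous_on {0..s} g"
    and conv: "\<And>r. 0 < r \<Longrightarrow> r < s \<Longrightarrow> (\<lambda>n. a n (nat \<lfloor>real (T n) * r\<rfloor>)) \<longlonglongrightarrow> g r"
  shows "(\<lambda>n. (\<Sum>t<m n. a n t) / T n) \<longlonglongrightarrow> (LINT r:{0..s}|lborel. g r)"
  unfolding sum_step_integral[OF T] set_lebesgue_integral_def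
proof (rule integral_dominated_convergence[where w = "\<lambda>r. \<bar>C\<bar> * indicator {0..1} r"])
  show "(\<lambda>r. indicator {0..s} r *\<^sub>R g r) \<in> borel_measurable lborel"
    using borel_measurable_continuous_on_indicator[OF _ g] by simp
  show "(\<lambda>r. indicator {0..<real (m n) / T n} r * a n (nat \<lfloor>real (T n) * r\<rfloor>)) \<in> borel_measurable lborel" for n
    by measurable
  show "integrable lborel (\<lambda>r. \<bar>C\<bar> * indicator {0..1::real} r)"
    by (auto simp: integrable_mult_right_iff)
  show "AE r in lborel. norm (indicator {0..<real (m n) / T n} r * a n (nat \<lfloor>real (T n) * r\<rfloor>)) \<le> \<bar>C\<bar> * indicator {0..1} r" for n
  proof (rule AE_I2)
    fix r
    show "norm (indicator {0..<real (m n) / T n} r * a n (nat \<lfloor>real (T n) * r\<rfloor>)) \<le> \<bar>C\<bar> * indicator {0..1} r"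
    proof (cases "r \<in> {0..<real (m n) / T n}")
      case True
      have "real (m n) / T n \<le> 1" using mT[of n] T[of n] by (simp add: divide_le_eq)
      moreover have "real (T n) * r < m n" using True T[of n] by (auto simp: field_simps)
      then have "nat \<lfloor>real (T n) * r\<rfloor> < m n" using True T[of n] by (auto simp: nat_less_iff floor_less_iff)
      then have "\<bar>a n (nat \<lfloor>real (T n) * r\<rfloor>)\<bar> \<le> \<bar>C\<bar>" using bound by fastforce
      ultimately show ?thesis using True by (simp add: indicator_def)
    qed simp
  qed
  \<comment> \<open>Neither endpoint is covered by \<open>conv\<close>, and at \<open>s\<close> the
    indicators may oscillate; both points are null.\<close>
  have "AE r in lborel. r \<noteq> 0 \<and> r \<noteq> s"
    using AE_lborel_singleton[of "0::real"] AE_lborel_singleton[of s] by eventually_elim auto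
  then show "AE r in lborel. (\<lambda>n. indicator {0..<real (m n) / T n} r * a n (nat \<lfloor>real (T n) * r\<rfloor>)) \<longlonglongrightarrow> indicator {0..s} r *\<^sub>R g r"
  proof eventually_elim
    fix r assume r: "r \<noteq> 0 \<and> r \<noteq> s"
    consider "r < 0" | "0 < r" "r < s" | "0 < r" "s < r" using r by linarith
    then show "(\<lambda>n. indicator {0..<real (m n) / T n} r * a n (nat \<lfloor>real (T n) * r\<rfloor>)) \<longlonglongrightarrow> indicator {0..s} r *\<^sub>R g r"
    proof cases
      case 1 then show ?thesis by simp
    next
      case 2
      have "eventually (\<lambda>n. r < real (m n) / T n) sequentially"
        by (rule order_tendstoD(1)[OF lim 2(2)])
      then have "eventually (\<lambda>n. a n (nat \<lfloor>real (T n) * r\<rfloor>) = indicator {0..<real (m n) / T n} r * a n (nat \<lfloor>real (T n) * r\<rfloor>)) sequentially"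
        by eventually_elim (use 2 in simp)
      from Lim_transform_eventually[OF conv[OF 2] this] show ?thesis using 2 by simp
    next
      case 3
      have "eventually (\<lambda>n. real (m n) / T n < r) sequentially"
        by (rule order_tendstoD(2)[OF lim 3(2)])
      then have "eventually (\<lambda>n. indicator {0..<real (m n) / T n} r * a n (nat \<lfloor>real (T n) * r\<rfloor>) = 0) sequentially"
        by eventually_elim simp
      then show ?thesis using 3 by (simp add: tendsto_eventually)
    qed
  qed
qed

section \<open>Kernel sums of increments and their integral limits\<close>

lemma inverse_seq_tendsto_0:
  fixes T :: "nat \<Rightarrow> nat"
  assumes T: "filterlim T at_top sequentially"
  shows "(\<lambda>n. 1 / real (T n)) \<longlonglongrightarrow> 0"
  using tendsto_divide_0[OF tendsto_const filterlim_at_top_imp_at_infinity[OF filterlim_compose[OF filterlim_real_sequentially T]]]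
  by simp

lemma floor_ratio_limit:
  fixes T :: "nat \<Rightarrow> nat"
  assumes T: "\<And>n. 1 \<le> T n" "filterlim T at_top sequentially"
    and r: "\<And>n. 0 \<le> r n" "r \<longlonglongrightarrow> r0"
  shows "(\<lambda>n. real (nat \<lfloor>real (T n) * r n\<rfloor>) / T n) \<longlonglongrightarrow> r0"
proof -
  have inv: "(\<lambda>n. 1 / real (T n)) \<longlonglongrightarrow> 0" by (rule inverse_seq_tendsto_0[OF T(2)])
  have "(\<lambda>n. real (nat \<lfloor>real (T n) * r n\<rfloor>) / T n - r n) \<longlonglongrightarrow> 0"
  proof (rule tendsto_rabs_zero_cancel, rule tendsto_sandwich[OF _ _ tendsto_const inv])
    show "eventually (\<lambda>n. \<bar>real (nat \<lfloor>real (T n) * r n\<rfloor>) / T n - r n\<bar> \<le> 1 / T n) sequentially"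
    proof (rule always_eventually, rule allI)
      fix n
      have "0 \<le> real (T n) * r n" using r by simp
      then have "\<bar>real (nat \<lfloor>real (T n) * r n\<rfloor>) - real (T n) * r n\<bar> \<le> 1" by linarith
      then have "\<bar>real (nat \<lfloor>real (T n) * r n\<rfloor>) - real (T n) * r n\<bar> / T n \<le> 1 / T n" by (rule divide_right_mono) simp
      moreover have "\<bar>real (nat \<lfloor>real (T n) * r n\<rfloor>) - real (T n) * r n\<bar> / T n = \<bar>(real (nat \<lfloor>real (T n) * r n\<rfloor>) - real (T n) * r n) / T n\<bar>"
        by simp
      moreover have "(real (nat \<lfloor>real (T n) * r n\<rfloor>) - real (T n) * r n) / T n = real (nat \<lfloor>real (T n) * r n\<rfloor>) / T n - r n"
        using T(1)[of n] by (simp add: diff_divide_distrib)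
      ultimately show "\<bar>real (nat \<lfloor>real (T n) * r n\<rfloor>) / T n - r n\<bar> \<le> 1 / T n" by simp
    qed
  qed auto
  from tendsto_add[OF this r(2)] show ?thesis by simp
qed

lemma summation_by_parts:
  fixes A c :: "nat \<Rightarrow> real"
  shows "(\<Sum>t=1..m. (A t - A (t - 1)) * c t) = A m * c m + (\<Sum>t<m. A t * (c t - c (Suc t))) - A 0 * c 0"
  by (induction m) (simp_all add: algebra_simps)

text \<open>Summation by parts moves the differences from \<open>A\<close> to the kernel. A kernel
  increment is \<open>K' z / h\<close> by the mean value theorem and \<open>T / h\<close> tends to
  \<open>\<zeta>\<close>, so a Riemann sum with weight \<open>\<zeta> * K'\<close> remains; the
  boundary term at \<open>t = m\<close> carries the weight \<open>K 0\<close>.\<close>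

lemma kernel_sum_limit:
  fixes A :: "nat \<Rightarrow> nat \<Rightarrow> real" and T m :: "nat \<Rightarrow> nat"
  assumes K: "\<And>z. (K has_real_derivative K' z) (at z)" "continuous_on UNIV K'" "\<And>z. \<bar>K' z\<bar> \<le> D"
    and T: "\<And>n. 1 \<le> T n" "filterlim T at_top sequentially"
    and h: "\<And>n. 0 < h n" and hlim: "(\<lambda>n. T n / h n) \<longlonglongrightarrow> \<zeta>"
    and mT: "\<And>n. m n \<le> T n" and lim: "(\<lambda>n. real (m n) / T n) \<longlonglongrightarrow> s"
    and A0: "\<And>n. A n 0 = 0"
    and bound: "\<And>n t. t \<le> T n \<Longrightarrow> \<bar>A n t / T n\<bar> \<le> C"
    and a: "continuous_on {0..s} a"
    and conv: "\<And>r. 0 < r \<Longrightarrow> r < s \<Longrightarrow> (\<lambda>n. A n (nat \<lfloor>real (T n) * r\<rfloor>) / T n) \<longlonglongrightarrow> a r"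
    and final: "(\<lambda>n. A n (m n) / T n) \<longlonglongrightarrow> a s"
  shows "(\<lambda>n. (\<Sum>t=1..m n. (A n t - A n (t - 1)) * K ((real (m n) - real t) / h n)) / T n)
    \<longlonglongrightarrow> K 0 * a s + \<zeta> * (LINT r:{0..s}|lborel. a r * K' (\<zeta> * (s - r)))"
proof -
  define c where "c n t = K ((real (m n) - real t) / h n)" for n t
  have "\<exists>z. (real (m n) - real (Suc t)) / h n < z \<and> z < (real (m n) - real t) / h n \<and>
      c n t - c n (Suc t) = K' z / h n" for n t
  proof -
    have lt: "(real (m n) - real (Suc t)) / h n < (real (m n) - real t) / h n"
      using h[of n] by (simp add: divide_strict_right_mono)
    have df: "(real (m n) - real t) / h n - (real (m n) - real (Suc t)) / h n = 1 / h n"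
      by (simp add: diff_divide_distrib add_divide_distrib)
    from MVT2[OF lt K(1)] show ?thesis unfolding c_def df by auto
  qed
  then obtain z where z: "\<And>n t. (real (m n) - real (Suc t)) / h n < z n t" "\<And>n t. z n t < (real (m n) - real t) / h n"
      "\<And>n t. c n t - c n (Suc t) = K' (z n t) / h n"
    by metis
  \<comment> \<open>The mean value point lies between the kernel arguments for \<open>Suc t\<close>
    and \<open>t\<close>, which differ by \<open>1 / h n\<close> and share their limit.\<close>
  have zlim: "(\<lambda>n. z n (nat \<lfloor>real (T n) * r\<rfloor>)) \<longlonglongrightarrow> \<zeta> * (s - r)" if r: "0 < r" for r
  proof -
    let ?t = "\<lambda>n. nat \<lfloor>real (T n) * r\<rfloor>"
    have tl: "(\<lambda>n. real (?t n) / T n) \<longlonglongrightarrow> r" by (rule floor_ratio_limit[OF T]) (use r in auto)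
    have inv: "(\<lambda>n. 1 / real (T n)) \<longlonglongrightarrow> 0" by (rule inverse_seq_tendsto_0[OF T(2)])
    have "(\<lambda>n. (T n / h n) * (real (m n) / T n - real (?t n) / T n)) \<longlonglongrightarrow> \<zeta> * (s - r)"
      by (intro tendsto_intros hlim lim tl)
    moreover have "(T n / h n) * (real (m n) / T n - real (?t n) / T n) = (real (m n) - real (?t n)) / h n" for n
      using T(1)[of n] h[of n] by (simp add: field_simps)
    ultimately have up: "(\<lambda>n. (real (m n) - real (?t n)) / h n) \<longlonglongrightarrow> \<zeta> * (s - r)" by (simp only:)
    have "(\<lambda>n. (real (m n) - real (?t n)) / h n - (T n / h n) * (1 / real (T n))) \<longlonglongrightarrow> \<zeta> * (s - r) - \<zeta> * 0"
      by (intro tendsto_intros up inv hlim)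
    then have "(\<lambda>n. (real (m n) - real (?t n)) / h n - (T n / h n) * (1 / real (T n))) \<longlonglongrightarrow> \<zeta> * (s - r)"
      by (simp only: mult_zero_right diff_zero)
    moreover have "(real (m n) - real (?t n)) / h n - (T n / h n) * (1 / real (T n)) = (real (m n) - real (Suc (?t n))) / h n" for n
      using T(1)[of n] h[of n] by (simp add: field_simps)
    ultimately have lo: "(\<lambda>n. (real (m n) - real (Suc (?t n))) / h n) \<longlonglongrightarrow> \<zeta> * (s - r)" by (simp only:)
    show ?thesis
      by (rule tendsto_sandwich[OF _ _ lo up]) (intro always_eventually allI less_imp_le z)+
  qed
  obtain Z where Z: "\<And>n. \<bar>T n / h n\<bar> \<le> Z"
    using convergent_imp_Bseq[of "\<lambda>n. real (T n) / h n"] hlim unfolding convergent_def Bseq_def by auto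
  have "(\<lambda>n. (\<Sum>t<m n. A n t * (c n t - c n (Suc t))) / T n)
      \<longlonglongrightarrow> (LINT r:{0..s}|lborel. a r * (\<zeta> * K' (\<zeta> * (s - r))))"
  proof (rule riemann_sum_limit[OF T(1) mT lim])
    \<comment> \<open>\<open>A\<close> may grow like \<open>T\<close> and the kernel increments
      shrink like \<open>1 / h\<close>; regrouped in this way, every factor is bounded and
      converges.\<close>
    have e: "A n t * (c n t - c n (Suc t)) = A n t / T n * (T n / h n * K' (z n t))" for n t
      using T(1)[of n] by (simp add: z(3))
    show "\<bar>A n t * (c n t - c n (Suc t))\<bar> \<le> C * (Z * D)" if "t < m n" for n t
      unfolding e abs_mult[of "A n t / T n"] abs_mult[of "T n / h n"]
    proof (intro mult_mono)
      show "\<bar>A n t / T n\<bar> \<le> C" using bound that mT[of n] by simp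
      then show "0 \<le> C" using abs_ge_zero order_trans by blast
      show "0 \<le> Z" using Z[of n] abs_ge_zero order_trans by blast
    qed (use Z K in auto)
    show "continuous_on {0..s} (\<lambda>r. a r * (\<zeta> * K' (\<zeta> * (s - r))))"
      by (intro continuous_intros a continuous_on_compose2[OF K(2)]) auto
    fix r assume r: "0 < r" "r < s"
    have "(\<lambda>n. K' (z n (nat \<lfloor>real (T n) * r\<rfloor>))) \<longlonglongrightarrow> K' (\<zeta> * (s - r))"
      by (rule continuous_on_tendsto_compose[OF K(2) zlim]) (use r in auto)
    then show "(\<lambda>n. A n (nat \<lfloor>real (T n) * r\<rfloor>) * (c n (nat \<lfloor>real (T n) * r\<rfloor>) - c n (Suc (nat \<lfloor>real (T n) * r\<rfloor>)))) \<longlonglongrightarrow> a r * (\<zeta> * K' (\<zeta> * (s - r)))"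
      unfolding e by (intro tendsto_intros conv r hlim)
  qed
  from tendsto_add[OF tendsto_mult[OF final tendsto_const[of "K 0"]] this]
  have "(\<lambda>n. A n (m n) / T n * K 0 + (\<Sum>t<m n. A n t * (c n t - c n (Suc t))) / T n)
      \<longlonglongrightarrow> a s * K 0 + (LINT r:{0..s}|lborel. a r * (\<zeta> * K' (\<zeta> * (s - r))))" .
  moreover have "A n (m n) / T n * K 0 + (\<Sum>t<m n. A n t * (c n t - c n (Suc t))) / T n =
      (\<Sum>t=1..m n. (A n t - A n (t - 1)) * c n t) / T n" for n
    unfolding summation_by_parts A0 by (simp add: c_def add_divide_distrib)
  moreover have "(LINT r:{0..s}|lborel. a r * (\<zeta> * K' (\<zeta> * (s - r)))) = \<zeta> * (LINT r:{0..s}|lborel. a r * K' (\<zeta> * (s - r)))"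
    by (simp add: mult.left_commute[of _ \<zeta>])
  ultimately show ?thesis unfolding c_def by (simp add: mult.commute)
qed

text \<open>Integrates the derivative of \<open>r * K (\<zeta> * (s - r))\<close>. It collapses what
  the linear drift \<open>\<sigma>\<^sup>2 * r\<close> contributes to the numerator into a plain
  kernel integral.\<close>

lemma kernel_integration_by_parts:
  assumes K: "\<And>z. (K has_real_derivative K' z) (at z)" "continuous_on UNIV K'" and s: "0 \<le> s"
  shows "s * K 0 + \<zeta> * (LINT r:{0..s}|lborel. r * K' (\<zeta> * (s - r))) = (LINT r:{0..s}|lborel. K (\<zeta> * (s - r)))"
proof -
  have Kc: "continuous_on UNIV K" using K(1) by (meson DERIV_continuous continuous_at_imp_continuous_on)
  have c1: "continuous_on {0..s} (\<lambda>r. K (\<zeta> * (s - r)))"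
    by (intro continuous_intros continuous_on_compose2[OF Kc]) auto
  have c2: "continuous_on {0..s} (\<lambda>r. \<zeta> * (r * K' (\<zeta> * (s - r))))"
    by (intro continuous_intros continuous_on_compose2[OF K(2)]) auto
  have "has_bochner_integral lborel (\<lambda>r. indicator {0..s} r *\<^sub>R (K (\<zeta> * (s - r)) - \<zeta> * (r * K' (\<zeta> * (s - r)))))
      (s * K (\<zeta> * (s - s)) - 0 * K (\<zeta> * (s - 0)))"
  proof (rule has_bochner_integral_FTC_Icc[OF s])
    show "continuous_on {0..s} (\<lambda>r. K (\<zeta> * (s - r)) - \<zeta> * (r * K' (\<zeta> * (s - r))))"
      by (intro continuous_on_diff c1 c2)
    fix r
    have "((\<lambda>r. K (\<zeta> * (s - r))) has_real_derivative K' (\<zeta> * (s - r)) * (- \<zeta>)) (at r)"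
      by (rule DERIV_chain2[OF K(1)]) (auto intro!: derivative_eq_intros)
    then have "((\<lambda>r. r * K (\<zeta> * (s - r))) has_real_derivative K (\<zeta> * (s - r)) - \<zeta> * (r * K' (\<zeta> * (s - r)))) (at r)"
      by (auto intro!: derivative_eq_intros simp: algebra_simps)
    then show "((\<lambda>r. r * K (\<zeta> * (s - r))) has_vector_derivative K (\<zeta> * (s - r)) - \<zeta> * (r * K' (\<zeta> * (s - r)))) (at r within {0..s})"
      by (simp add: has_real_derivative_iff_has_vector_derivative[symmetric] has_field_derivative_at_within)
  qed
  then have "(LINT r:{0..s}|lborel. K (\<zeta> * (s - r)) - \<zeta> * (r * K' (\<zeta> * (s - r)))) = s * K 0"
    unfolding set_lebesgue_integral_def by (simp add: has_bochner_integral_integral_eq)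
  moreover have "(LINT r:{0..s}|lborel. K (\<zeta> * (s - r)) - \<zeta> * (r * K' (\<zeta> * (s - r)))) =
      (LINT r:{0..s}|lborel. K (\<zeta> * (s - r))) - \<zeta> * (LINT r:{0..s}|lborel. r * K' (\<zeta> * (s - r)))"
    by (subst set_integral_diff(2)) (auto intro!: borel_integrable_atLeastAtMost' c1 c2)
  ultimately show ?thesis by simp
qed

text \<open>Regressing the increments on \<open>y (t - 1)\<close> gives slope \<open>X / P\<close>
  and residual sum \<open>Q - X\<^sup>2 / P\<close>. Telescoping the squares of \<open>y\<close>
  gives \<open>X = ((y m)\<^sup>2 - Q) / 2\<close>, so the estimator involves only the end value,
  \<open>Q\<close> and \<open>P\<close>.\<close>

lemma S_sq_unit_root:
  assumes y0: "y 0 = 0" and P: "(\<Sum>t=1..m. (y (t - 1))\<^sup>2) \<noteq> 0"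
  shows "S_sq y m = 1 / (real m - 1) *
    ((\<Sum>t=1..m. (y t - y (t - 1))\<^sup>2) - (((y m)\<^sup>2 - (\<Sum>t=1..m. (y t - y (t - 1))\<^sup>2)) / 2)\<^sup>2 / (\<Sum>t=1..m. (y (t - 1))\<^sup>2))"
proof -
  define P where "P = (\<Sum>t=1..m. (y (t - 1))\<^sup>2)"
  define Q where "Q = (\<Sum>t=1..m. (y t - y (t - 1))\<^sup>2)"
  define X where "X = (\<Sum>t=1..m. y (t - 1) * (y t - y (t - 1)))"
  have P0: "P \<noteq> 0" using P by (simp add: P_def)
  have XQ: "X = ((y m)\<^sup>2 - Q) / 2" unfolding X_def Q_def
    using y0 by (induction m) (simp_all add: power2_eq_square field_simps)
  have num: "(\<Sum>t=1..m. y (t - 1) * y t) = P + X"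
    unfolding P_def X_def sum.distrib[symmetric] by (intro sum.cong) (simp_all add: power2_eq_square algebra_simps)
  have rho: "rho_hat y m = 1 + X / P"
    unfolding rho_hat_def P_def[symmetric] num using P0 by (simp add: add_divide_distrib)
  have "(\<Sum>t=1..m. (y t - rho_hat y m * y (t - 1))\<^sup>2) =
      (\<Sum>t=1..m. (y t - y (t - 1))\<^sup>2 - 2 * (X / P) * (y (t - 1) * (y t - y (t - 1))) + (X / P)\<^sup>2 * (y (t - 1))\<^sup>2)"
    unfolding rho by (intro sum.cong) (simp_all add: power2_eq_square algebra_simps)
  also have "\<dots> = Q - 2 * (X / P) * X + (X / P)\<^sup>2 * P"
    unfolding sum.distrib sum_subtractf sum_distrib_left[symmetric] Q_def[symmetric] X_def[symmetric] P_def[symmetric] ..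
  also have "\<dots> = Q - X\<^sup>2 / P" using P0 by (simp add: power2_eq_square field_simps)
  finally show ?thesis by (simp add: S_sq_def XQ Q_def P_def)
qed

text \<open>With \<open>\<Delta>(y\<^sup>2) = 2 y \<Delta>y + (\<Delta>y)\<^sup>2\<close> the numerator becomes a kernel sum of increments of
  \<open>y\<^sup>2 - Q\<close>, \<open>Q\<close> the quadratic variation; the rescaled \<open>Q\<close> is asymptotically linear.\<close>

lemma t_type_DF_limit:
  fixes y :: "nat \<Rightarrow> nat \<Rightarrow> real" and T :: "nat \<Rightarrow> nat"
  assumes K: "\<And>z. (K has_real_derivative K' z) (at z)" "continuous_on UNIV K'" "\<And>z. \<bar>K' z\<bar> \<le> D"
    and T: "\<And>n. 1 \<le> T n" "filterlim T at_top sequentially"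
    and h: "\<And>n. 0 < h n" and hlim: "(\<lambda>n. T n / h n) \<longlonglongrightarrow> \<zeta>"
    and y0: "\<And>n. y n 0 = 0"
    and w: "continuous_on {0..1} w"
    and conv: "\<And>r r0. (\<And>n. r n \<in> {0..1}) \<Longrightarrow> r \<longlonglongrightarrow> r0 \<Longrightarrow> r0 \<in> {0..1} \<Longrightarrow>
        (\<lambda>n. y n (nat \<lfloor>real (T n) * r n\<rfloor>) / sqrt (T n)) \<longlonglongrightarrow> w r0"
    and bound: "\<And>n t. t \<le> T n \<Longrightarrow> \<bar>y n t / sqrt (T n)\<bar> \<le> C"
    and Q: "\<And>n t. t \<le> T n \<Longrightarrow> \<bar>((\<Sum>i=1..t. (y n i - y n (i - 1))\<^sup>2) - real t * \<sigma>\<^sup>2) / T n\<bar> \<le> p n"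
    and p: "p \<longlonglongrightarrow> 0"
    and s: "\<And>n. s n \<in> {0<..1}" "s \<longlonglongrightarrow> s0" "0 < s0" and \<sigma>: "0 < \<sigma>"
    and pos: "0 < (LINT r:{0..s0}|lborel. (w r)\<^sup>2)"
  shows "(\<lambda>n. t_type_DF K (h n) (y n) (T n) (s n)) \<longlonglongrightarrow>
    (1 / 2) * (K 0 * (w s0)\<^sup>2 + \<zeta> * (LINT r:{0..s0}|lborel. (w r)\<^sup>2 * K' (\<zeta> * (s0 - r)))
      - \<sigma>\<^sup>2 * (LINT r:{0..s0}|lborel. K (\<zeta> * (s0 - r)))) / (sqrt (LINT r:{0..s0}|lborel. (w r)\<^sup>2) * \<sigma>)"
proof -
  define m where "m n = nat \<lfloor>real (T n) * s n\<rfloor>" for n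
  define q where "q n t = (\<Sum>i=1..t. (y n i - y n (i - 1))\<^sup>2)" for n t
  define A where "A n t = (y n t)\<^sup>2 - q n t" for n t
  define a where "a r = (w r)\<^sup>2 - \<sigma>\<^sup>2 * r" for r
  define I where "I = (LINT r:{0..s0}|lborel. (w r)\<^sup>2)"
  define P where "P n = (\<Sum>t=1..m n. (y n (t - 1))\<^sup>2)" for n
  define U where "U n = P n / (T n)\<^sup>2" for n
  define Nm where "Nm n = (\<Sum>t=1..m n. y n (t - 1) * (y n t - y n (t - 1)) * K ((real (m n) - real t) / h n))" for n
  have s01: "s0 \<in> {0..1}"
    using s LIMSEQ_le_const2[OF s(2), of 1] by (auto intro: less_imp_le)
  have w': "continuous_on {0..s0} w" by (rule continuous_on_subset[OF w]) (use s01 in auto)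
  have inv: "(\<lambda>n. 1 / real (T n)) \<longlonglongrightarrow> 0" by (rule inverse_seq_tendsto_0[OF T(2)])
  have mT: "m n \<le> T n" for n
  proof -
    have "real (T n) * s n \<le> real (T n) * 1" using s(1)[of n] by (intro mult_left_mono) auto
    then show ?thesis unfolding m_def by linarith
  qed
  have mlim: "(\<lambda>n. real (m n) / T n) \<longlonglongrightarrow> s0"
    unfolding m_def by (rule floor_ratio_limit[OF T _ s(2)]) (use s(1) in \<open>auto intro: less_imp_le\<close>)
  have ysq: "(y n t)\<^sup>2 / T n = (y n t / sqrt (T n))\<^sup>2" for n t by (simp add: power_divide)
  have ylim: "(\<lambda>n. (y n (nat \<lfloor>real (T n) * r n\<rfloor>))\<^sup>2 / T n) \<longlonglongrightarrow> (w r0)\<^sup>2"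
    if "\<And>n. r n \<in> {0..1}" "r \<longlonglongrightarrow> r0" "r0 \<in> {0..1}" for r r0
    unfolding ysq by (intro tendsto_power conv that)
  have ybound: "\<bar>(y n t)\<^sup>2 / T n\<bar> \<le> C\<^sup>2" if "t \<le> T n" for n t
    using power_mono[OF bound[OF that], of 2] unfolding ysq by (simp add: abs_le_iff power2_abs power_divide)
  have qlim: "(\<lambda>n. q n (t n) / T n) \<longlonglongrightarrow> \<sigma>\<^sup>2 * r0"
    if t: "\<And>n. t n \<le> T n" "(\<lambda>n. real (t n) / T n) \<longlonglongrightarrow> r0" for t r0
  proof -
    have "(\<lambda>n. (q n (t n) - real (t n) * \<sigma>\<^sup>2) / T n) \<longlonglongrightarrow> 0"
      by (rule tendsto_rabs_zero_cancel, rule tendsto_sandwich[OF _ _ tendsto_const p])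
        (use Q t(1) in \<open>auto simp: q_def\<close>)
    from tendsto_add[OF this tendsto_mult[OF t(2) tendsto_const[of "\<sigma>\<^sup>2"]]]
    show ?thesis by (simp add: diff_divide_distrib mult.commute)
  qed
  have Alim: "(\<lambda>n. A n (nat \<lfloor>real (T n) * r n\<rfloor>) / T n) \<longlonglongrightarrow> a r0"
    if r: "\<And>n. r n \<in> {0..1}" "r \<longlonglongrightarrow> r0" "r0 \<in> {0..1}" for r r0
    unfolding A_def a_def diff_divide_distrib
  proof (intro tendsto_diff ylim r qlim)
    show "nat \<lfloor>real (T n) * r n\<rfloor> \<le> T n" for n
    proof -
      have "real (T n) * r n \<le> real (T n) * 1" using r(1)[of n] by (intro mult_left_mono) auto
      then show ?thesis by linarith
    qed
    show "(\<lambda>n. real (nat \<lfloor>real (T n) * r n\<rfloor>) / T n) \<longlonglongrightarrow> r0"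
      by (rule floor_ratio_limit[OF T _ r(2)]) (use r(1) in auto)
  qed
  obtain p1 where p1: "\<And>n. \<bar>p n\<bar> \<le> p1"
    using convergent_imp_Bseq[of p] p unfolding convergent_def Bseq_def by auto
  have Abound: "\<bar>A n t / T n\<bar> \<le> C\<^sup>2 + (p1 + \<sigma>\<^sup>2)" if t: "t \<le> T n" for n t
  proof -
    have "real t / T n \<le> 1" using t T(1)[of n] by simp
    then have "real t / T n * \<sigma>\<^sup>2 \<le> 1 * \<sigma>\<^sup>2" by (intro mult_right_mono) auto
    moreover have "0 \<le> real t / T n * \<sigma>\<^sup>2" by simp
    moreover have "\<bar>q n t / T n - real t / T n * \<sigma>\<^sup>2\<bar> \<le> p n"
      using Q[OF t] by (simp add: q_def diff_divide_distrib)
    moreover have "\<bar>x\<bar> \<le> v + c" if "b \<le> 1 * c" "0 \<le> b" "\<bar>x - b\<bar> \<le> u" "\<bar>u\<bar> \<le> v" for x b c u v :: real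
      using that by linarith
    ultimately have "\<bar>q n t / T n\<bar> \<le> p1 + \<sigma>\<^sup>2" using p1[of n] by blast
    then show ?thesis unfolding A_def diff_divide_distrib
      by (rule order_trans[OF abs_triangle_ineq4 add_mono[OF ybound[OF t]]])
  qed
  have "(\<lambda>n. (\<Sum>t=1..m n. (A n t - A n (t - 1)) * K ((real (m n) - real t) / h n)) / T n)
      \<longlonglongrightarrow> K 0 * a s0 + \<zeta> * (LINT r:{0..s0}|lborel. a r * K' (\<zeta> * (s0 - r)))"
  proof (rule kernel_sum_limit[OF K T h hlim mT mlim _ Abound])
    show "A n 0 = 0" for n by (simp add: A_def q_def y0)
    show "continuous_on {0..s0} a" unfolding a_def by (intro continuous_intros w')
    show "(\<lambda>n. A n (nat \<lfloor>real (T n) * r\<rfloor>) / T n) \<longlonglongrightarrow> a r" if "0 < r" "r < s0" for r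
      by (rule Alim) (use that s01 in auto)
    show "(\<lambda>n. A n (m n) / T n) \<longlonglongrightarrow> a s0"
      unfolding m_def by (rule Alim) (use s s01 in \<open>auto intro: less_imp_le\<close>)
  qed auto
  moreover have "(A n t - A n (t - 1)) = 2 * (y n (t - 1) * (y n t - y n (t - 1)))" if "1 \<le> t" for n t
  proof -
    from that have "t = Suc (t - 1)" by simp
    then obtain u where "t = Suc u" by blast
    then show ?thesis by (simp add: A_def q_def power2_eq_square algebra_simps)
  qed
  then have "(\<Sum>t=1..m n. (A n t - A n (t - 1)) * K ((real (m n) - real t) / h n)) = 2 * Nm n" for n
    unfolding Nm_def sum_distrib_left by (intro sum.cong) auto
  \<comment> \<open>The linear part of \<open>a\<close> contributes
    \<open>- \<sigma>\<^sup>2\<close> times the left side of the integration by parts formula, hence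
    only the kernel integral.\<close>
  moreover have "K 0 * a s0 + \<zeta> * (LINT r:{0..s0}|lborel. a r * K' (\<zeta> * (s0 - r))) =
      K 0 * (w s0)\<^sup>2 + \<zeta> * (LINT r:{0..s0}|lborel. (w r)\<^sup>2 * K' (\<zeta> * (s0 - r)))
      - \<sigma>\<^sup>2 * (LINT r:{0..s0}|lborel. K (\<zeta> * (s0 - r)))"
  proof -
    have c1: "continuous_on {0..s0} (\<lambda>r. (w r)\<^sup>2 * K' (\<zeta> * (s0 - r)))"
      by (intro continuous_intros w' continuous_on_compose2[OF K(2)]) auto
    have c2: "continuous_on {0..s0} (\<lambda>r. \<sigma>\<^sup>2 * (r * K' (\<zeta> * (s0 - r))))"
      by (intro continuous_intros continuous_on_compose2[OF K(2)]) auto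
    have "(LINT r:{0..s0}|lborel. a r * K' (\<zeta> * (s0 - r))) =
       (LINT r:{0..s0}|lborel. (w r)\<^sup>2 * K' (\<zeta> * (s0 - r)) - \<sigma>\<^sup>2 * (r * K' (\<zeta> * (s0 - r))))"
      by (simp add: a_def left_diff_distrib mult.assoc)
    also have "\<dots> = (LINT r:{0..s0}|lborel. (w r)\<^sup>2 * K' (\<zeta> * (s0 - r))) - \<sigma>\<^sup>2 * (LINT r:{0..s0}|lborel. r * K' (\<zeta> * (s0 - r)))"
      by (subst set_integral_diff(2)) (auto intro!: borel_integrable_atLeastAtMost' c1 c2)
    finally have split: "(LINT r:{0..s0}|lborel. a r * K' (\<zeta> * (s0 - r))) =
      (LINT r:{0..s0}|lborel. (w r)\<^sup>2 * K' (\<zeta> * (s0 - r))) - \<sigma>\<^sup>2 * (LINT r:{0..s0}|lborel. r * K' (\<zeta> * (s0 - r)))" .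
    show ?thesis unfolding split kernel_integration_by_parts[OF K(1,2) less_imp_le[OF s(3)], symmetric]
      by (simp add: a_def algebra_simps)
  qed
  ultimately have "(\<lambda>n. 2 * Nm n / T n) \<longlonglongrightarrow>
      K 0 * (w s0)\<^sup>2 + \<zeta> * (LINT r:{0..s0}|lborel. (w r)\<^sup>2 * K' (\<zeta> * (s0 - r)))
      - \<sigma>\<^sup>2 * (LINT r:{0..s0}|lborel. K (\<zeta> * (s0 - r)))" by simp
  from tendsto_mult[OF tendsto_const[of "1/2"] this] have Nlim: "(\<lambda>n. Nm n / T n) \<longlonglongrightarrow>
      (1 / 2) * (K 0 * (w s0)\<^sup>2 + \<zeta> * (LINT r:{0..s0}|lborel. (w r)\<^sup>2 * K' (\<zeta> * (s0 - r)))
      - \<sigma>\<^sup>2 * (LINT r:{0..s0}|lborel. K (\<zeta> * (s0 - r))))" by simp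
  have "(\<lambda>n. (\<Sum>t<m n. (y n t)\<^sup>2 / T n) / T n) \<longlonglongrightarrow> I"
    unfolding I_def
  proof (rule riemann_sum_limit[OF T(1) mT mlim])
    show "\<bar>(y n t)\<^sup>2 / T n\<bar> \<le> C\<^sup>2" if "t < m n" for n t using ybound that mT[of n] by simp
    show "continuous_on {0..s0} (\<lambda>r. (w r)\<^sup>2)" by (intro continuous_intros w')
    show "(\<lambda>n. (y n (nat \<lfloor>real (T n) * r\<rfloor>))\<^sup>2 / T n) \<longlonglongrightarrow> (w r)\<^sup>2" if "0 < r" "r < s0" for r
      by (rule ylim) (use that s01 in auto)
  qed
  moreover have "(\<Sum>t<m n. (y n t)\<^sup>2 / T n) / T n = U n" for n
  proof -
    have "(\<Sum>t<k. (y n t)\<^sup>2) = (\<Sum>t=1..k. (y n (t - 1))\<^sup>2)" for k by (induction k) auto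
    then have "(\<Sum>t<m n. (y n t)\<^sup>2) = P n" unfolding P_def .
    then show ?thesis by (simp add: U_def sum_divide_distrib[symmetric] power2_eq_square)
  qed
  ultimately have Ulim: "U \<longlonglongrightarrow> I" by simp
  have I0: "0 < I" using pos by (simp add: I_def)
  have evU: "eventually (\<lambda>n. 0 < U n) sequentially" by (rule order_tendstoD(1)[OF Ulim I0])
  have evm: "eventually (\<lambda>n. 0 < real (m n) / T n) sequentially" by (rule order_tendstoD(1)[OF mlim s(3)])
  have Slim: "(\<lambda>n. S_sq (y n) (m n)) \<longlonglongrightarrow> \<sigma>\<^sup>2"
  proof -
    have ql: "(\<lambda>n. q n (m n) / T n) \<longlonglongrightarrow> \<sigma>\<^sup>2 * s0" by (rule qlim[OF mT mlim])
    have Al: "(\<lambda>n. A n (m n) / T n) \<longlonglongrightarrow> a s0"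
      unfolding m_def by (rule Alim) (use s s01 in \<open>auto intro: less_imp_le\<close>)
    \<comment> \<open>In the correction term \<open>A\<^sup>2 / P\<close>, numerator and denominator
      are both at most of order \<open>T\<^sup>2\<close>, with \<open>P\<close> exactly so; the
      further division by \<open>T\<close> makes the term vanish. The variance estimate thus behaves
      like \<open>q / m\<close>.\<close>
    have "(\<lambda>n. (q n (m n) / T n - (A n (m n) / T n / 2)\<^sup>2 / U n * (1 / T n)) / (real (m n) / T n - 1 / T n))
        \<longlonglongrightarrow> (\<sigma>\<^sup>2 * s0 - (a s0 / 2)\<^sup>2 / I * 0) / (s0 - 0)"
      by (intro tendsto_intros ql Al Ulim inv mlim) (use I0 s(3) in auto)
    then have "(\<lambda>n. (q n (m n) / T n - (A n (m n) / T n / 2)\<^sup>2 / U n * (1 / T n)) / (real (m n) / T n - 1 / T n))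
        \<longlonglongrightarrow> \<sigma>\<^sup>2" using s(3) by simp
    moreover have "eventually (\<lambda>n. (q n (m n) / T n - (A n (m n) / T n / 2)\<^sup>2 / U n * (1 / T n)) / (real (m n) / T n - 1 / T n)
        = S_sq (y n) (m n)) sequentially"
      using evU
    proof eventually_elim
      fix n assume U0: "0 < U n"
      define \<tau> where "\<tau> = real (T n)"
      have T0: "0 < \<tau>" using T(1)[of n] by (simp add: \<tau>_def)
      have P0: "P n \<noteq> 0" using U0 by (auto simp: U_def)
      have PU: "P n = U n * \<tau>\<^sup>2" using T0 by (simp add: U_def \<tau>_def)
      have "S_sq (y n) (m n) = 1 / (real (m n) - 1) * (q n (m n) - (A n (m n) / 2)\<^sup>2 / P n)"
        using S_sq_unit_root[of "y n" "m n", OF y0] P0 unfolding P_def q_def A_def by simp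
      \<comment> \<open>For \<open>m n = 1\<close> both sides are 0, because division by 0 gives
        0.\<close>
      also have "\<dots> = (q n (m n) - (A n (m n) / 2)\<^sup>2 / P n) / \<tau> / ((real (m n) - 1) / \<tau>)"
        using T0 by (cases "real (m n) - 1 = 0") (simp_all add: field_simps)
      also have "(q n (m n) - (A n (m n) / 2)\<^sup>2 / P n) / \<tau> =
          q n (m n) / \<tau> - (A n (m n) / \<tau> / 2)\<^sup>2 / U n * (1 / \<tau>)"
        unfolding PU using T0 U0 by (simp add: power2_eq_square field_simps)
      finally show "(q n (m n) / T n - (A n (m n) / T n / 2)\<^sup>2 / U n * (1 / T n)) / (real (m n) / T n - 1 / T n)
        = S_sq (y n) (m n)" unfolding \<tau>_def by (simp add: diff_divide_distrib)
    qed
    ultimately show ?thesis by (rule Lim_transform_eventually)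
  qed
  have "(\<lambda>n. Nm n / T n / (sqrt (U n) * sqrt (S_sq (y n) (m n)))) \<longlonglongrightarrow>
    (1 / 2) * (K 0 * (w s0)\<^sup>2 + \<zeta> * (LINT r:{0..s0}|lborel. (w r)\<^sup>2 * K' (\<zeta> * (s0 - r)))
      - \<sigma>\<^sup>2 * (LINT r:{0..s0}|lborel. K (\<zeta> * (s0 - r)))) / (sqrt I * sqrt (\<sigma>\<^sup>2))"
    by (intro tendsto_divide Nlim tendsto_mult tendsto_real_sqrt Ulim Slim) (use I0 \<sigma> in auto)
  moreover have "eventually (\<lambda>n. Nm n / T n / (sqrt (U n) * sqrt (S_sq (y n) (m n))) =
      t_type_DF K (h n) (y n) (T n) (s n)) sequentially"
    using evU evm
  proof eventually_elim
    fix n assume U0: "0 < U n" and m0: "0 < real (m n) / T n"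
    define \<tau> where "\<tau> = real (T n)"
    have T0: "0 < \<tau>" using T(1)[of n] by (simp add: \<tau>_def)
    have m0': "0 < real (m n)" using m0 T0 by (auto simp: zero_less_divide_iff)
    have PU: "P n = U n * \<tau>\<^sup>2" using T0 by (simp add: U_def \<tau>_def)
    have P0: "0 < P n" using PU U0 T0 by simp
    have sP: "sqrt (P n) = sqrt (U n) * \<tau>" using T0 by (simp add: PU real_sqrt_mult)
    have "t_type_DF K (h n) (y n) (T n) (s n) =
        (1 / real (m n) * Nm n) / (1 / (real (m n))\<^sup>2 * P n) / (real (m n) * sqrt (S_sq (y n) (m n) / P n))"
      using s(1)[of n] by (simp add: t_type_DF_def weighted_DF_def xi_hat_def m_def[symmetric] Let_def Nm_def P_def)
    \<comment> \<open>All explicit powers of the sample size cancel. What is left is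
      \<open>Nm\<close> over \<open>sqrt P\<close>, both of scale \<open>T\<close>, and over the
      standard deviation estimate.\<close>
    also have "\<dots> = Nm n * sqrt (P n) / (P n * sqrt (S_sq (y n) (m n)))"
      using m0' P0 by (simp add: real_sqrt_divide power2_eq_square field_simps)
    also have "\<dots> = Nm n / (sqrt (P n) * sqrt (S_sq (y n) (m n)))"
    proof -
      \<comment> \<open>\<open>S\<close> is arbitrary: a vanishing variance estimate is absorbed by
        division by 0.\<close>
      have "x * r / (r * r * S) = x / (r * S)" if "0 < r" for x r S :: real using that by simp
      from this[of "sqrt (P n)"] show ?thesis using P0 by simp
    qed
    also have "\<dots> = Nm n / \<tau> / (sqrt (U n) * sqrt (S_sq (y n) (m n)))"
      unfolding sP by (simp add: mult_ac)
    finally show "Nm n / T n / (sqrt (U n) * sqrt (S_sq (y n) (m n))) = t_type_DF K (h n) (y n) (T n) (s n)"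
      by (simp add: \<tau>_def)
  qed
  ultimately have "(\<lambda>n. t_type_DF K (h n) (y n) (T n) (s n)) \<longlonglongrightarrow>
    (1 / 2) * (K 0 * (w s0)\<^sup>2 + \<zeta> * (LINT r:{0..s0}|lborel. (w r)\<^sup>2 * K' (\<zeta> * (s0 - r)))
      - \<sigma>\<^sup>2 * (LINT r:{0..s0}|lborel. K (\<zeta> * (s0 - r)))) / (sqrt I * sqrt (\<sigma>\<^sup>2))"
    by (rule Lim_transform_eventually)
  then show ?thesis using \<sigma> by (simp add: I_def)
qed

section \<open>Random paths\<close>

text \<open>Both the domain and the integrand move with \<open>s\<close>. Along a sequence the
  indicators converge except at the null point \<open>r = s0\<close>, and dominated convergence does
  the rest.\<close>

lemma moving_kernel_integral_continuous:
  fixes u k :: "real \<Rightarrow> real"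
  assumes u: "continuous_on {0..1} u" and k: "continuous_on UNIV k" "\<And>z. \<bar>k z\<bar> \<le> D"
  shows "continuous_on {0..1} (\<lambda>s. LINT r:{0..s}|lborel. u r * k (\<zeta> * (s - r)))"
proof (rule continuous_on_sequentiallyI)
  fix s :: "nat \<Rightarrow> real" and s0 assume s: "\<forall>n. s n \<in> {0..1}" "s0 \<in> {0..1}" "s \<longlonglongrightarrow> s0"
  have "bounded (u ` {0..1})" by (intro compact_imp_bounded compact_continuous_image u compact_Icc)
  then obtain C where "\<forall>x\<in>u ` {0..1}. \<bar>x\<bar> \<le> C" unfolding bounded_real by blast
  then have C: "\<And>r. r \<in> {0..1} \<Longrightarrow> \<bar>u r\<bar> \<le> C" by blast
  have C0: "0 \<le> C" using C[of 0] by simp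
  have D0: "0 \<le> D" using k(2)[of 0] by simp
  have meas: "(\<lambda>r. indicator {0..x} r *\<^sub>R (u r * k (\<zeta> * (x - r)))) \<in> borel_measurable lborel" if "x \<in> {0..1}" for x
  proof -
    have "continuous_on {0..x} (\<lambda>r. u r * k (\<zeta> * (x - r)))"
      by (intro continuous_intros continuous_on_subset[OF u] continuous_on_compose2[OF k(1)]) (use that in auto)
    from borel_measurable_continuous_on_indicator[OF _ this] show ?thesis by simp
  qed
  show "(\<lambda>n. LINT r:{0..s n}|lborel. u r * k (\<zeta> * (s n - r))) \<longlonglongrightarrow> (LINT r:{0..s0}|lborel. u r * k (\<zeta> * (s0 - r)))"
    unfolding set_lebesgue_integral_def
  proof (rule integral_dominated_convergence[where w = "\<lambda>r. (C * D) * indicator {0..1} r"])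
    show "integrable lborel (\<lambda>r. (C * D) * indicator {0..1::real} r)" by auto
    show "AE r in lborel. norm (indicator {0..s n} r *\<^sub>R (u r * k (\<zeta> * (s n - r)))) \<le> (C * D) * indicator {0..1} r" for n
    proof (rule AE_I2)
      fix r
      show "norm (indicator {0..s n} r *\<^sub>R (u r * k (\<zeta> * (s n - r)))) \<le> (C * D) * indicator {0..1} r"
      proof (cases "r \<in> {0..s n}")
        case True
        then have r: "r \<in> {0..1}" using s(1)[rule_format, of n] by auto
        have "\<bar>u r\<bar> * \<bar>k (\<zeta> * (s n - r))\<bar> \<le> C * D"
          by (rule mult_mono[OF C[OF r] k(2) C0]) simp
        then show ?thesis using True r by (simp add: abs_mult)
      next
        case False
        then show ?thesis using C0 D0 by (simp add: indicator_def)
      qed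
    qed
    have "AE r in lborel. r \<noteq> s0" by (rule AE_lborel_singleton)
    then show "AE r in lborel. (\<lambda>n. indicator {0..s n} r *\<^sub>R (u r * k (\<zeta> * (s n - r)))) \<longlonglongrightarrow> indicator {0..s0} r *\<^sub>R (u r * k (\<zeta> * (s0 - r)))"
    proof eventually_elim
      fix r assume r: "r \<noteq> s0"
      have "(\<lambda>n. k (\<zeta> * (s n - r))) \<longlonglongrightarrow> k (\<zeta> * (s0 - r))"
        by (rule continuous_on_tendsto_compose[OF k(1)]) (auto intro!: tendsto_intros s(3))
      moreover have "(\<lambda>n. indicator {0..s n} r :: real) \<longlonglongrightarrow> indicator {0..s0} r"
      proof (rule tendsto_eventually)
        show "eventually (\<lambda>n. indicator {0..s n} r = (indicator {0..s0} r :: real)) sequentially"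
        proof (cases "r < s0")
          case True
          from order_tendstoD(1)[OF s(3) this] show ?thesis
            by eventually_elim (use True in \<open>auto simp: indicator_def\<close>)
        next
          case False
          then have "s0 < r" using r by simp
          from order_tendstoD(2)[OF s(3) this] show ?thesis
            by eventually_elim (use False r in \<open>auto simp: indicator_def\<close>)
        qed
      qed
      ultimately show "(\<lambda>n. indicator {0..s n} r *\<^sub>R (u r * k (\<zeta> * (s n - r)))) \<longlonglongrightarrow> indicator {0..s0} r *\<^sub>R (u r * k (\<zeta> * (s0 - r)))"
        by (intro tendsto_intros)
    qed
  qed (use meas s in auto)
qed

lemma limit_DF_continuous:
  assumes K: "continuous_on UNIV K" "\<And>z. \<bar>K z\<bar> \<le> D" "continuous_on UNIV (deriv K)" "\<And>z. \<bar>deriv K z\<bar> \<le> D"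
    and w: "continuous_on {0..1} w" and pos: "\<And>s. s \<in> {0<..1} \<Longrightarrow> 0 < (LINT r:{0..s}|lborel. (w r)\<^sup>2)"
  shows "continuous_on {0<..1} (limit_DF K \<zeta> \<theta> w)"
proof -
  have 1: "continuous_on {0..1} (\<lambda>s. LINT r:{0..s}|lborel. (w r)\<^sup>2 * deriv K (\<zeta> * (s - r)))"
    by (rule moving_kernel_integral_continuous[OF _ K(3,4)]) (intro continuous_intros w)
  have "continuous_on {0..1} (\<lambda>s. LINT r:{0..s}|lborel. 1 * K (\<zeta> * (s - r)))"
    by (rule moving_kernel_integral_continuous[OF _ K(1,2)]) (intro continuous_intros)
  then have 2: "continuous_on {0..1} (\<lambda>s. LINT r:{0..s}|lborel. K (\<zeta> * (s - r)))" by simp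
  \<comment> \<open>The denominator is an integral of the same kind with the constant kernel
    1.\<close>
  have "continuous_on {0..1} (\<lambda>s. LINT r:{0..s}|lborel. (w r)\<^sup>2 * (\<lambda>_. 1) (\<zeta> * (s - r)))"
    by (rule moving_kernel_integral_continuous[of _ _ 1]) (auto intro!: continuous_intros w)
  then have 3: "continuous_on {0..1} (\<lambda>s. LINT r:{0..s}|lborel. (w r)\<^sup>2)" by simp
  have sub: "{0<..1} \<subseteq> {0..1::real}" by auto
  have nz: "\<forall>s\<in>{0<..1}. sqrt (LINT r:{0..s}|lborel. (w r)\<^sup>2) \<noteq> 0" using pos by force
  have "continuous_on {0<..1} (\<lambda>s. (1 / 2) * (\<theta> * K 0 * (w s)\<^sup>2
        + \<theta> * \<zeta> * (LINT r:{0..s}|lborel. (w r)\<^sup>2 * deriv K (\<zeta> * (s - r)))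
        - inverse \<theta> * (LINT r:{0..s}|lborel. K (\<zeta> * (s - r))))
     / sqrt (LINT r:{0..s}|lborel. (w r)\<^sup>2))"
    by (intro continuous_on_divide continuous_on_mult continuous_on_add continuous_on_diff continuous_on_power
          continuous_on_real_sqrt continuous_on_const nz
          continuous_on_subset[OF 1 sub] continuous_on_subset[OF 2 sub] continuous_on_subset[OF 3 sub]
          continuous_on_subset[OF w sub])
  then show ?thesis
    by (rule continuous_on_eq) (simp add: limit_DF_def)
qed

text \<open>The scales enter only through their ratio: division by \<open>\<eta> * \<sigma>\<close>
  turns the factor \<open>\<eta>\<^sup>2\<close> into \<open>\<eta> / \<sigma>\<close> and
  \<open>\<sigma>\<^sup>2\<close> into its inverse.\<close>

lemma limit_DF_scaled:
  assumes \<eta>: "0 < \<eta>" and \<sigma>: "0 < \<sigma>" and s: "s \<noteq> 0"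
  shows "(1 / 2) * (K 0 * (\<eta> * b s)\<^sup>2 + \<zeta> * (LINT r:{0..s}|lborel. (\<eta> * b r)\<^sup>2 * deriv K (\<zeta> * (s - r)))
      - \<sigma>\<^sup>2 * (LINT r:{0..s}|lborel. K (\<zeta> * (s - r)))) / (sqrt (LINT r:{0..s}|lborel. (\<eta> * b r)\<^sup>2) * \<sigma>)
    = limit_DF K \<zeta> (\<eta> / \<sigma>) b s"
proof -
  define I where "I = (LINT r:{0..s}|lborel. (b r)\<^sup>2)"
  define J where "J = (LINT r:{0..s}|lborel. (b r)\<^sup>2 * deriv K (\<zeta> * (s - r)))"
  define L where "L = (LINT r:{0..s}|lborel. K (\<zeta> * (s - r)))"
  have 1: "(LINT r:{0..s}|lborel. (\<eta> * b r)\<^sup>2 * deriv K (\<zeta> * (s - r))) = \<eta>\<^sup>2 * J"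
    by (simp add: J_def power_mult_distrib mult.assoc)
  have 2: "(LINT r:{0..s}|lborel. (\<eta> * b r)\<^sup>2) = \<eta>\<^sup>2 * I"
    by (simp add: I_def power_mult_distrib)
  have "(1 / 2) * (K 0 * (\<eta> * b s)\<^sup>2 + \<zeta> * (\<eta>\<^sup>2 * J) - \<sigma>\<^sup>2 * L) / (sqrt (\<eta>\<^sup>2 * I) * \<sigma>)
      = (1 / 2) * ((K 0 * (\<eta> * b s)\<^sup>2 + \<zeta> * (\<eta>\<^sup>2 * J) - \<sigma>\<^sup>2 * L) / (\<eta> * \<sigma>)) / sqrt I"
    using \<eta> by (simp add: real_sqrt_mult mult_ac)
  also have "(K 0 * (\<eta> * b s)\<^sup>2 + \<zeta> * (\<eta>\<^sup>2 * J) - \<sigma>\<^sup>2 * L) / (\<eta> * \<sigma>) =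
      (\<eta> / \<sigma>) * K 0 * (b s)\<^sup>2 + (\<eta> / \<sigma>) * \<zeta> * J - inverse (\<eta> / \<sigma>) * L"
    using \<eta> \<sigma> by (simp add: power2_eq_square field_simps)
  finally show ?thesis unfolding 1 2 L_def[symmetric] using s
    by (simp add: limit_DF_def I_def J_def L_def)
qed

text \<open>The points \<open>1 / Suc k\<close> accumulate at 0, so every interval from 0 to
  \<open>s\<close> contains one at which the continuous integrand is positive. Countably many
  conditions thus serve all \<open>s\<close> at once, which suits an almost sure statement.\<close>

lemma square_integral_pos:
  fixes w :: "real \<Rightarrow> real"
  assumes w: "continuous_on {0..1} w" and nz: "\<And>k. w (1 / Suc k) \<noteq> 0" and s: "s \<in> {0<..1}"
  shows "0 < (LINT r:{0..s}|lborel. (w r)\<^sup>2)"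
proof -
  have c: "continuous_on {0..s} (\<lambda>r. (w r)\<^sup>2)"
    by (intro continuous_intros continuous_on_subset[OF w]) (use s in auto)
  have eq: "(LINT r:{0..s}|lborel. (w r)\<^sup>2) = integral {0..s} (\<lambda>r. (w r)\<^sup>2)"
    by (rule set_borel_integral_eq_integral(2)[OF borel_integrable_atLeastAtMost'[OF c]])
  have "integral {0..s} (\<lambda>r. (w r)\<^sup>2) \<noteq> 0"
  proof
    assume 0: "integral {0..s} (\<lambda>r. (w r)\<^sup>2) = 0"
    obtain k where k: "1 / real (Suc k) < s" using nat_approx_posE[of s] s by auto
    have "(w (1 / Suc k))\<^sup>2 = 0"
      using integral_eq_0_iff[OF c] 0 s k by auto
    then show False using nz[of k] by simp
  qed
  moreover have "0 \<le> integral {0..s} (\<lambda>r. (w r)\<^sup>2)" by (rule Henstock_Kurzweil_Integration.integral_nonneg[OF integrable_continuous_real[OF c]]) simp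
  ultimately show ?thesis using eq by simp
qed

text \<open>The time change shifts \<open>r n\<close> by a vanishing amount, which a continuous
  limit does not notice. Moving times are allowed because the evaluation times of the statistic vary
  along the sequence.\<close>

lemma skorokhod_tendsto_continuous:
  assumes x: "\<And>n. x n \<in> cadlag_paths a b" and y: "y \<in> cadlag_paths a b" "continuous_on {a..b} y"
    and d: "(\<lambda>n. skorokhod_dist a b (x n) y) \<longlonglongrightarrow> 0"
    and r: "\<And>n. r n \<in> {a..b}" "r \<longlonglongrightarrow> r0" "r0 \<in> {a..b}"
  shows "(\<lambda>n. x n (r n)) \<longlonglongrightarrow> y r0"
proof -
  \<comment> \<open>The infimum in the distance need not be attained; the extra
    \<open>1 / Suc n\<close> makes the inequality strict.\<close>
  define e where "e n = skorokhod_dist a b (x n) y + 1 / Suc n" for n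
  have e0: "e \<longlonglongrightarrow> 0" unfolding e_def using tendsto_add[OF d LIMSEQ_inverse_real_of_nat] by (simp add: inverse_eq_divide)
  have "\<exists>l. l \<in> time_changes a b \<and> (\<forall>t\<in>{a..b}. \<bar>l t - t\<bar> < e n \<and> \<bar>x n t - y (l t)\<bar> < e n)" for n
  proof -
    have "skorokhod_dist a b (x n) y < e n" by (simp add: e_def)
    from skorokhod_dist_lessD[OF x y(1) this] show ?thesis by metis
  qed
  then obtain l where l: "\<And>n. l n \<in> time_changes a b" "\<And>n t. t \<in> {a..b} \<Longrightarrow> \<bar>l n t - t\<bar> < e n"
      "\<And>n t. t \<in> {a..b} \<Longrightarrow> \<bar>x n t - y (l n t)\<bar> < e n" by metis
  have "(\<lambda>n. l n (r n) - r n) \<longlonglongrightarrow> 0"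
    by (rule tendsto_rabs_zero_cancel, rule tendsto_sandwich[OF _ _ tendsto_const e0])
      (use l(2) r(1) in \<open>auto intro!: always_eventually less_imp_le\<close>)
  from tendsto_add[OF this r(2)] have "(\<lambda>n. l n (r n)) \<longlonglongrightarrow> r0" by simp
  then have 1: "(\<lambda>n. y (l n (r n))) \<longlonglongrightarrow> y r0"
    by (rule continuous_on_tendsto_compose[OF y(2) _ r(3)]) (use time_change_mem[OF l(1) r(1)] in \<open>auto intro!: always_eventually\<close>)
  have "(\<lambda>n. x n (r n) - y (l n (r n))) \<longlonglongrightarrow> 0"
    by (rule tendsto_rabs_zero_cancel, rule tendsto_sandwich[OF _ _ tendsto_const e0])
      (use l(3) r(1) in \<open>auto intro!: always_eventually less_imp_le\<close>)
  from tendsto_add[OF this 1] show ?thesis by simp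
qed

lemma skorokhod_dist_bounded:
  assumes x: "x \<in> cadlag_paths a b" and y: "y \<in> cadlag_paths a b" and C: "\<And>t. t \<in> {a..b} \<Longrightarrow> \<bar>y t\<bar> \<le> C"
    and d: "skorokhod_dist a b x y < e" and t: "t \<in> {a..b}"
  shows "\<bar>x t\<bar> \<le> C + e"
proof -
  obtain l where l: "l \<in> time_changes a b" "\<And>t. t \<in> {a..b} \<Longrightarrow> \<bar>x t - y (l t)\<bar> < e"
    using skorokhod_dist_lessD[OF x y d] by metis
  have "\<bar>y (l t)\<bar> \<le> C" using C time_change_mem[OF l(1) t] by blast
  then show ?thesis using l(2)[OF t] by linarith
qed

section \<open>Moments of the innovations, nondegeneracy and measurability of the limit\<close>

lemma stationary_second_moment:
  assumes st: "strictly_stationary M \<epsilon>" and i: "1 \<le> i"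
  shows "(\<integral>\<omega>. (\<epsilon> i \<omega>)\<^sup>2 \<partial>M) = (\<integral>\<omega>. (\<epsilon> 1 \<omega>)\<^sup>2 \<partial>M)"
proof -
  define P where "P = (\<Pi>\<^sub>M j\<in>{1..1::nat}. borel :: real measure)"
  define R where "R k \<omega> = (\<lambda>j\<in>{1..1}. \<epsilon> (j + k) \<omega>)" for k :: nat and \<omega>
  have R: "R k \<in> measurable M P" for k
    unfolding R_def P_def by (rule measurable_restrict) (use st in \<open>auto simp: strictly_stationary_def\<close>)
  have f: "(\<lambda>x. (x 1)\<^sup>2) \<in> borel_measurable P"
    unfolding P_def by (intro borel_measurable_power measurable_component_singleton) simp
  have e: "(\<integral>\<omega>. (\<epsilon> (1 + k) \<omega>)\<^sup>2 \<partial>M) = (\<integral>x. (x 1)\<^sup>2 \<partial>distr M P (R k))" for k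
    unfolding integral_distr[OF R f] by (simp add: R_def)
  have "distr M P (R (i - 1)) = distr M P (R 0)"
    using st[unfolded strictly_stationary_def, THEN conjunct2, rule_format, of 1 "i - 1"]
    by (simp add: P_def R_def[abs_def])
  then show ?thesis using e[of "i - 1"] e[of 0] i by simp
qed

text \<open>An increment has a Gaussian density, hence no atom at 0, and the path starts at 0 almost
  surely.\<close>

lemma brownian_nonzero_AE:
  assumes "standard_brownian_motion N B"
  shows "AE \<omega> in N. \<forall>k. B (1 / Suc k) \<omega> \<noteq> 0"
  unfolding AE_all_countable
proof
  fix k :: nat
  let ?t = "1 / real (Suc k)" and ?D = "\<lambda>x. ennreal (normal_density 0 (sqrt (1 / real (Suc k) - 0)) x)"
  have D: "distributed N lborel (\<lambda>\<omega>. B ?t \<omega> - B 0 \<omega>) ?D" and 0: "AE \<omega> in N. B 0 \<omega> = 0"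
    using assms unfolding standard_brownian_motion_def by auto
  have "AE x in distr N lborel (\<lambda>\<omega>. B ?t \<omega> - B 0 \<omega>). x \<noteq> 0"
    unfolding distributed_distr_eq_density[OF D]
    using AE_lborel_singleton[of "0::real"] by (subst AE_density) auto
  from AE_distrD[OF distributed_measurable[OF D] this] 0
  show "AE \<omega> in N. B ?t \<omega> \<noteq> 0" by eventually_elim simp
qed

text \<open>If the variance were 0, \<open>\<epsilon> 1\<close> would vanish almost surely, its
  products with later innovations would have mean 0, and the long-run variance
  \<open>\<eta>\<^sup>2\<close> would be 0 as well. Positivity makes
  \<open>\<eta> / \<sigma>\<close> meaningful.\<close>

lemma innovation_variance_pos:
  assumes M: "prob_space M" and m: "\<And>t. t \<ge> 1 \<Longrightarrow> \<epsilon> t \<in> borel_measurable M"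
    and i4: "integrable M (\<lambda>\<omega>. \<bar>\<epsilon> 1 \<omega>\<bar> ^ 4)" and \<eta>: "0 < \<eta>"
    and lim: "(\<lambda>T. (\<integral>\<omega>. (\<epsilon> 1 \<omega>)\<^sup>2 \<partial>M) +
          2 * (\<Sum>t = 1..T. (real T - real t) / real T * (\<integral>\<omega>. \<epsilon> 1 \<omega> * \<epsilon> (1 + t) \<omega> \<partial>M)))
       \<longlonglongrightarrow> \<eta>\<^sup>2"
  shows "0 < (\<integral>\<omega>. (\<epsilon> 1 \<omega>)\<^sup>2 \<partial>M)"
proof (rule ccontr)
  assume n: "\<not> ?thesis"
  interpret prob_space M by fact
  have [measurable]: "\<epsilon> 1 \<in> borel_measurable M" using m by simp
  have z: "(\<integral>\<omega>. (\<epsilon> 1 \<omega>)\<^sup>2 \<partial>M) = 0"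
  proof -
    have "0 \<le> (\<integral>\<omega>. (\<epsilon> 1 \<omega>)\<^sup>2 \<partial>M)" by (rule Bochner_Integration.integral_nonneg) simp
    then show ?thesis using n by linarith
  qed
  have "integrable M (\<lambda>\<omega>. (\<epsilon> 1 \<omega>)\<^sup>2)"
  proof (rule Bochner_Integration.integrable_bound)
    show "integrable M (\<lambda>\<omega>. 1 + \<bar>\<epsilon> 1 \<omega>\<bar> ^ 4)" using i4 by simp
    show "AE \<omega> in M. norm ((\<epsilon> 1 \<omega>)\<^sup>2) \<le> norm (1 + \<bar>\<epsilon> 1 \<omega>\<bar> ^ 4)"
    proof (rule AE_I2)
      fix \<omega>
      \<comment> \<open>Completing the square; at \<open>x = (\<epsilon> 1 \<omega>)\<^sup>2\<close>
        it bounds the second moment by the fourth.\<close>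
      have "x \<le> 1 + x\<^sup>2" if "0 \<le> x" for x :: real
        using zero_le_power2[of "x - 1/2"] by (simp add: power2_eq_square algebra_simps)
      from this[of "(\<epsilon> 1 \<omega>)\<^sup>2"] have "(\<epsilon> 1 \<omega>)\<^sup>2 \<le> 1 + \<bar>\<epsilon> 1 \<omega>\<bar> ^ 4" by (simp add: power_even_abs)
      then show "norm ((\<epsilon> 1 \<omega>)\<^sup>2) \<le> norm (1 + \<bar>\<epsilon> 1 \<omega>\<bar> ^ 4)" by simp
    qed
  qed measurable
  then have "AE \<omega> in M. (\<epsilon> 1 \<omega>)\<^sup>2 = 0" using z integral_nonneg_eq_0_iff_AE[of M "\<lambda>\<omega>. (\<epsilon> 1 \<omega>)\<^sup>2"] by simp
  then have "(\<integral>\<omega>. \<epsilon> 1 \<omega> * \<epsilon> (1 + t) \<omega> \<partial>M) = 0" for t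
    by (intro integral_eq_zero_AE) (auto elim: eventually_mono)
  then have "(\<lambda>T::nat. 0) \<longlonglongrightarrow> \<eta>\<^sup>2" using lim z by simp
  then show False using \<eta> by (simp add: LIMSEQ_const_iff)
qed

text \<open>The path integrals are measurable by joint measurability in \<omega> and time. That
  argument samples all real times, hence the continuity on the whole line.\<close>

lemma limit_DF_measurable:
  fixes Z :: "real \<Rightarrow> 'b \<Rightarrow> real"
  assumes K: "continuous_on UNIV K" "continuous_on UNIV (deriv K)"
    and m: "\<And>t. Z t \<in> borel_measurable N"
    and c: "\<And>\<omega>. \<omega> \<in> space N \<Longrightarrow> continuous_on UNIV (\<lambda>t. Z t \<omega>)"
  shows "(\<lambda>\<omega>. limit_DF K \<zeta> \<theta> (\<lambda>r. Z r \<omega>) s) \<in> borel_measurable N"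
proof -
  have J[measurable]: "(\<lambda>(\<omega>, t). Z t \<omega>) \<in> borel_measurable (N \<Otimes>\<^sub>M lborel)"
    using continuous_paths_jointly_measurable[OF m c]
      measurable_cong_sets[OF sets_pair_measure_cong[OF refl sets_lborel] refl] by blast
  have [measurable]: "(\<lambda>r. deriv K (\<zeta> * (s - r))) \<in> borel_measurable borel"
    by (intro borel_measurable_continuous_onI continuous_on_compose2[OF K(2)] continuous_intros) auto
  have 1: "(\<lambda>\<omega>. LINT r:{0..s}|lborel. (Z r \<omega>)\<^sup>2 * deriv K (\<zeta> * (s - r))) \<in> borel_measurable N"
    unfolding set_lebesgue_integral_def
    by (rule lborel.borel_measurable_lebesgue_integral) measurable
  have 2: "(\<lambda>\<omega>. LINT r:{0..s}|lborel. (Z r \<omega>)\<^sup>2) \<in> borel_measurable N"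
    unfolding set_lebesgue_integral_def
    by (rule lborel.borel_measurable_lebesgue_integral) measurable
  show ?thesis unfolding limit_DF_def using m 1 2 by measurable
qed

text \<open>Truncated at 1, so that convergence to 0 in probability is convergence of the means.\<close>

definition qv_error :: "(nat \<Rightarrow> 'a \<Rightarrow> real) \<Rightarrow> real \<Rightarrow> nat \<Rightarrow> 'a \<Rightarrow> real" where
  "qv_error \<epsilon> v T \<omega> = min 1 (MAX t\<in>{..T}. \<bar>((\<Sum>i=1..t. (\<epsilon> i \<omega>)\<^sup>2) - real t * v) / real T\<bar>)"

lemma qv_error_bounds: "0 \<le> qv_error \<epsilon> v T \<omega>" "qv_error \<epsilon> v T \<omega> \<le> 1"
proof -
  have "\<bar>((\<Sum>i=1..0. (\<epsilon> i \<omega>)\<^sup>2) - real 0 * v) / real T\<bar> \<le> (MAX t\<in>{..T}. \<bar>((\<Sum>i=1..t. (\<epsilon> i \<omega>)\<^sup>2) - real t * v) / real T\<bar>)"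
    by (rule Max_ge) (auto intro: image_eqI[of _ _ 0])
  then show "0 \<le> qv_error \<epsilon> v T \<omega>" by (simp add: qv_error_def)
qed (simp add: qv_error_def)

lemma qv_error_measurable:
  assumes "\<And>i. i \<ge> 1 \<Longrightarrow> \<epsilon> i \<in> borel_measurable M"
  shows "qv_error \<epsilon> v T \<in> borel_measurable M"
proof -
  have "(\<lambda>\<omega>. \<Sum>i=1..t. (\<epsilon> i \<omega>)\<^sup>2) \<in> borel_measurable M" for t
    by (intro borel_measurable_sum borel_measurable_power assms) auto
  then show ?thesis unfolding qv_error_def[abs_def] by measurable
qed

lemma qv_error_le:
  assumes "t \<le> T" "qv_error \<epsilon> v T \<omega> < e" "e \<le> 1"
  shows "\<bar>((\<Sum>i=1..t. (\<epsilon> i \<omega>)\<^sup>2) - real t * v) / real T\<bar> \<le> e"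
proof -
  have "\<bar>((\<Sum>i=1..t. (\<epsilon> i \<omega>)\<^sup>2) - real t * v) / real T\<bar> \<le> (MAX t\<in>{..T}. \<bar>((\<Sum>i=1..t. (\<epsilon> i \<omega>)\<^sup>2) - real t * v) / real T\<bar>)"
    by (rule Max_ge) (use assms(1) in auto)
  then show ?thesis using assms(2,3) unfolding qv_error_def by linarith
qed

text \<open>The centred sums of squares are of order \<open>sqrt T\<close>, so dividing by
  \<open>T\<close> leaves a spare factor \<open>1 / sqrt T\<close>: near a limit path bounded by
  \<open>C\<close> the error is at most \<open>(C + 1) / sqrt T\<close>. This is the mapping theorem
  with limit variable 0 and remainder 0, in effect a uniform law of large numbers.\<close>

lemma qv_error_mean_tendsto_0:
  assumes M: "prob_space M" and N: "prob_space N"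
    and m: "\<And>i. i \<ge> 1 \<Longrightarrow> \<epsilon> i \<in> borel_measurable M"
    and v: "\<And>i. i \<ge> 1 \<Longrightarrow> (\<integral>\<omega>. (\<epsilon> i \<omega>)\<^sup>2 \<partial>M) = v"
    and wc: "skorokhod_weak_conv 0 1 M
       (\<lambda>T s \<omega>. (1 / sqrt (real T)) *
          (\<Sum>i = 1..nat \<lfloor>real T * s\<rfloor>. (\<epsilon> i \<omega>)\<^sup>2 - (\<integral>\<omega>'. (\<epsilon> i \<omega>')\<^sup>2 \<partial>M))) N Z"
  shows "(\<lambda>T. \<integral>\<omega>. qv_error \<epsilon> v T \<omega> \<partial>M) \<longlonglongrightarrow> 0"
proof -
  interpret M: prob_space M by fact
  define S where "S T s \<omega> = (1 / sqrt (real T)) *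
          (\<Sum>i = 1..nat \<lfloor>real T * s\<rfloor>. (\<epsilon> i \<omega>)\<^sup>2 - (\<integral>\<omega>'. (\<epsilon> i \<omega>')\<^sup>2 \<partial>M))" for T :: nat and s \<omega>
  obtain X' Z' where X': "\<And>T. skorokhod_version M 0 1 (S T) (X' T)" and Z': "skorokhod_version N 0 1 Z Z'"
    and conv: "weak_conv_on (skorokhod_topology 0 1)
          (\<lambda>T. distr M (borel_on (skorokhod_topology 0 1)) (X' T))
          (distr N (borel_on (skorokhod_topology 0 1)) Z')"
    using wc unfolding skorokhod_weak_conv_def S_def by blast
  have X'm: "X' T \<in> measurable M (borel_on (skorokhod_topology 0 1))" for T
    using X' by (simp add: skorokhod_version_def)
  have Z'm: "Z' \<in> measurable N (borel_on (skorokhod_topology 0 1))"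
    using Z' by (simp add: skorokhod_version_def)
  define A where "A = {\<omega>. \<forall>T. \<forall>t\<in>{0..1}. X' T \<omega> t = S T t \<omega>}"
  have "(\<lambda>T. \<integral>\<omega>. qv_error \<epsilon> v T \<omega> \<partial>M) \<longlonglongrightarrow> (\<integral>\<omega>. 0 \<partial>N)"
  proof (rule Metric_space.weak_conv_mapping[OF Metric_space_skorokhod M N X'm[unfolded skorokhod_topology_def]
        Z'm[unfolded skorokhod_topology_def] conv[unfolded skorokhod_topology_def], where C = 1 and q = "\<lambda>_ _. 0"
        and A = A and A' = UNIV])
    show "\<bar>qv_error \<epsilon> v T \<omega>\<bar> \<le> 1" for T \<omega>
      using qv_error_bounds[of \<epsilon> v T \<omega>] by (simp add: abs_le_iff)
    show "AE \<omega> in M. \<omega> \<in> A" using X' by (simp add: A_def AE_all_countable skorokhod_version_def)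
    fix w' and e :: real assume w': "w' \<in> space N" and e: "e > 0"
    have Zc: "Z' w' \<in> cadlag_paths 0 1" using measurable_space[OF Z'm w'] by simp
    obtain C where C: "0 \<le> C" "\<And>t. t \<in> {0..1} \<Longrightarrow> \<bar>Z' w' t\<bar> \<le> C" using cadlag_bounded[OF Zc] by blast
    \<comment> \<open>Chosen so that \<open>(C + 1) / sqrt T \<le> e\<close> for all later
      \<open>T\<close>.\<close>
    obtain n :: nat where n: "((C + 1) / e)\<^sup>2 \<le> real n" using real_arch_simple by blast
    show "\<exists>n. \<forall>T\<ge>n. \<forall>w\<in>A \<inter> space M.
        skorokhod_dist 0 1 (X' T w) (Z' w') < 1 / real (Suc n) \<longrightarrow> 0 < 1 / real (Suc n) \<longrightarrow> \<bar>qv_error \<epsilon> v T w - 0\<bar> \<le> e"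
    proof (intro exI[of _ "Suc n"] allI ballI impI)
      fix T w assume T: "Suc n \<le> T" and w: "w \<in> A \<inter> space M"
        and d: "skorokhod_dist 0 1 (X' T w) (Z' w') < 1 / real (Suc (Suc n))"
      have T0: "0 < real T" using T by simp
      have Xc: "X' T w \<in> cadlag_paths 0 1" using measurable_space[OF X'm] w by fastforce
      have "\<bar>((\<Sum>i=1..t. (\<epsilon> i w)\<^sup>2) - real t * v) / real T\<bar> \<le> e" if t: "t \<le> T" for t
      proof -
        have t1: "real t / real T \<in> {0..1}" using t T0 by simp
        have eq: "nat \<lfloor>real T * (real t / real T)\<rfloor> = t" using T0 by simp
        have "S T (real t / real T) w = (1 / sqrt (real T)) * (\<Sum>i = 1..t. (\<epsilon> i w)\<^sup>2 - v)"
          unfolding S_def eq using v by simp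
        also have "\<dots> = ((\<Sum>i=1..t. (\<epsilon> i w)\<^sup>2) - real t * v) / sqrt (real T)"
          by (simp add: sum_subtractf)
        finally have "\<bar>((\<Sum>i=1..t. (\<epsilon> i w)\<^sup>2) - real t * v) / sqrt (real T)\<bar> = \<bar>X' T w (real t / real T)\<bar>"
          using w t1 by (simp add: A_def)
        also have "\<dots> \<le> C + 1 / real (Suc (Suc n))" by (rule skorokhod_dist_bounded[OF Xc Zc C(2) d t1])
        also have "\<dots> \<le> C + 1" by simp
        finally have 1: "\<bar>((\<Sum>i=1..t. (\<epsilon> i w)\<^sup>2) - real t * v) / sqrt (real T)\<bar> \<le> C + 1" .
        have "((C + 1) / e)\<^sup>2 \<le> real T" using n T by simp
        then have "(C + 1) / e \<le> sqrt (real T)" by (rule real_le_rsqrt)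
        then have 2: "(C + 1) / sqrt (real T) \<le> e" using e T0 by (simp add: field_simps)
        have "\<bar>((\<Sum>i=1..t. (\<epsilon> i w)\<^sup>2) - real t * v) / real T\<bar> =
          \<bar>((\<Sum>i=1..t. (\<epsilon> i w)\<^sup>2) - real t * v) / sqrt (real T)\<bar> / sqrt (real T)"
          by (simp add: abs_divide)
        also have "\<dots> \<le> (C + 1) / sqrt (real T)" by (rule divide_right_mono[OF 1]) simp
        finally show ?thesis using 2 by linarith
      qed
      then have "(MAX t\<in>{..T}. \<bar>((\<Sum>i=1..t. (\<epsilon> i w)\<^sup>2) - real t * v) / real T\<bar>) \<le> e"
        by (intro Max.boundedI) auto
      then show "\<bar>qv_error \<epsilon> v T w - 0\<bar> \<le> e" using qv_error_bounds(1)[of \<epsilon> v T w] unfolding qv_error_def by linarith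
    qed
  qed (use qv_error_measurable[of \<epsilon> M v] m in auto)
  then show ?thesis by simp
qed

text \<open>For \<open>s \<noteq> 0\<close> the process depends on \<open>s\<close> only through the
  sample size. These are the values of its step path, which yields cadlag paths and
  measurability.\<close>

definition t_stat_DF :: "(real \<Rightarrow> real) \<Rightarrow> real \<Rightarrow> (nat \<Rightarrow> real) \<Rightarrow> nat \<Rightarrow> real" where
  "t_stat_DF K h y n =
     ((1 / real n) * (\<Sum>t = 1..n. y (t - 1) * (y t - y (t - 1)) * K ((real n - real t) / h))) /
     ((1 / (real n)\<^sup>2) * (\<Sum>t = 1..n. (y (t - 1))\<^sup>2)) / (real n * xi_hat y n)"

lemma t_type_DF_eq_t_stat: "s \<noteq> 0 \<Longrightarrow> t_type_DF K h y T s = t_stat_DF K h y (nat \<lfloor>real T * s\<rfloor>)"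
  by (simp add: t_type_DF_def t_stat_DF_def weighted_DF_def Let_def)

lemma t_stat_DF_measurable:
  assumes [measurable]: "\<And>t. Y t \<in> borel_measurable M"
  shows "(\<lambda>\<omega>. t_stat_DF K h (\<lambda>t. Y t \<omega>) n) \<in> borel_measurable M"
  unfolding t_stat_DF_def xi_hat_def S_sq_def rho_hat_def by measurable

theorem theorem2p4:
  fixes M :: "'a measure" and N :: "'b measure" and N2 :: "'c measure"
    and \<epsilon> Y :: "nat \<Rightarrow> 'a \<Rightarrow> real"
    and B :: "real \<Rightarrow> 'b \<Rightarrow> real" and B2 :: "real \<Rightarrow> 'c \<Rightarrow> real"
    and K :: "real \<Rightarrow> real" and h :: "nat \<Rightarrow> real"
    and \<rho> \<eta> \<eta>' \<sigma> \<theta> \<zeta> \<kappa> :: real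
  assumes innov: "innovation_conditions M \<epsilon> \<eta> \<eta>' N B N2 B2"
    and Y_0: "\<And>\<omega>. \<omega> \<in> space M \<Longrightarrow> Y 0 \<omega> = 0"
    and Y_rec: "\<And>t \<omega>. t \<ge> 1 \<Longrightarrow> \<omega> \<in> space M \<Longrightarrow> Y t \<omega> = \<rho> * Y (t - 1) \<omega> + \<epsilon> t \<omega>"
    and unit_root: "\<rho> = 1"
    and kernel: "kernel_conditions K"
    and h_pos: "\<And>T. T \<ge> 1 \<Longrightarrow> 0 < h T"
    and h_lim: "(\<lambda>T. real T / h T) \<longlonglongrightarrow> \<zeta>"
    and zeta: "1 \<le> \<zeta>"
    and sigma: "\<sigma> = sqrt (\<integral>\<omega>. (\<epsilon> 1 \<omega>)\<^sup>2 \<partial>M)"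
    and theta: "\<theta> = \<eta> / \<sigma>"
    and kappa: "\<kappa> \<in> {0<..<1}"
  shows "skorokhod_weak_conv \<kappa> 1
           M (\<lambda>T s \<omega>. t_type_DF K (h T) (\<lambda>t. Y t \<omega>) T s)
           N (\<lambda>s \<omega>. limit_DF K \<zeta> \<theta> (\<lambda>r. B r \<omega>) s) \<and>
         (AE \<omega> in N. continuous_on {0<..1} (\<lambda>s. limit_DF K \<zeta> \<theta> (\<lambda>r. B r \<omega>) s))"
proof -
  define S where "S T s \<omega> = (1 / sqrt (real T)) * (\<Sum>i = 1..nat \<lfloor>real T * s\<rfloor>. \<epsilon> i \<omega>)" for T :: nat and s \<omega>
  have M: "prob_space M" and st: "strictly_stationary M \<epsilon>"
    and i4: "integrable M (\<lambda>\<omega>. \<bar>\<epsilon> 1 \<omega>\<bar> ^ 4)"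
    and \<eta>: "0 < \<eta>" and bm: "standard_brownian_motion N B" and bm2: "standard_brownian_motion N2 B2"
    and S_conv: "skorokhod_weak_conv 0 1 M S N (\<lambda>s \<omega>. \<eta> * B s \<omega>)"
    and Q_conv: "skorokhod_weak_conv 0 1 M
       (\<lambda>T s \<omega>. (1 / sqrt (real T)) *
          (\<Sum>i = 1..nat \<lfloor>real T * s\<rfloor>. (\<epsilon> i \<omega>)\<^sup>2 - (\<integral>\<omega>'. (\<epsilon> i \<omega>')\<^sup>2 \<partial>M)))
       N2 (\<lambda>s \<omega>. \<eta>' * B2 s \<omega>)"
    and \<eta>_lim: "(\<lambda>T. (\<integral>\<omega>. (\<epsilon> 1 \<omega>)\<^sup>2 \<partial>M) +
          2 * (\<Sum>t = 1..T. (real T - real t) / real T * (\<integral>\<omega>. \<epsilon> 1 \<omega> * \<epsilon> (1 + t) \<omega> \<partial>M)))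
       \<longlonglongrightarrow> \<eta>\<^sup>2"
    using innov unfolding innovation_conditions_def S_def by blast+
  have N: "prob_space N" and N2: "prob_space N2" using bm bm2 by (auto simp: standard_brownian_motion_def)
  have \<epsilon>m: "\<epsilon> i \<in> borel_measurable M" if "i \<ge> 1" for i using st that by (simp add: strictly_stationary_def)
  have var_pos: "0 < (\<integral>\<omega>. (\<epsilon> 1 \<omega>)\<^sup>2 \<partial>M)"
    by (rule innovation_variance_pos[OF M \<epsilon>m i4 \<eta> \<eta>_lim])
  then have \<sigma>: "0 < \<sigma>" and \<sigma>2: "(\<integral>\<omega>. (\<epsilon> 1 \<omega>)\<^sup>2 \<partial>M) = \<sigma>\<^sup>2" by (simp_all add: sigma)
  have var: "(\<integral>\<omega>. (\<epsilon> i \<omega>)\<^sup>2 \<partial>M) = \<sigma>\<^sup>2" if "i \<ge> 1" for i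
    using stationary_second_moment[OF st that] \<sigma>2 by simp
  \<comment> \<open>All that is carried forward from the second invariance principle; the relation
    between \<open>B2\<close> and \<open>B\<close> never enters.\<close>
  have q_lim: "(\<lambda>T. \<integral>\<omega>. qv_error \<epsilon> (\<sigma>\<^sup>2) T \<omega> \<partial>M) \<longlonglongrightarrow> 0"
    by (rule qv_error_mean_tendsto_0[OF M N2 \<epsilon>m var Q_conv])

  have Y_diff: "Y t \<omega> - Y (t - 1) \<omega> = \<epsilon> t \<omega>" if "1 \<le> t" "\<omega> \<in> space M" for t \<omega>
    using Y_rec[OF that] unit_root by simp
  have Y_sum: "Y t \<omega> = (\<Sum>i=1..t. \<epsilon> i \<omega>)" if "\<omega> \<in> space M" for t \<omega>
  proof (induction t)
    case (Suc t)
    then show ?case using Y_diff[of "Suc t" \<omega>] that by simp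
  qed (use Y_0 that in simp)
  have Ym: "Y t \<in> borel_measurable M" for t
  proof -
    have "(\<lambda>\<omega>. \<Sum>i=1..t. \<epsilon> i \<omega>) \<in> borel_measurable M" by (intro borel_measurable_sum \<epsilon>m) auto
    then show ?thesis using Y_sum by (subst measurable_cong[where g = "\<lambda>\<omega>. \<Sum>i=1..t. \<epsilon> i \<omega>"]) auto
  qed

  have K1: "(K has_real_derivative deriv K z) (at z)" for z
    using kernel by (simp add: kernel_conditions_def DERIV_deriv_iff_real_differentiable)
  have Kc: "continuous_on UNIV K" using K1 by (meson DERIV_continuous continuous_at_imp_continuous_on)
  have K2: "continuous_on UNIV (deriv K)"
    using kernel by (auto simp: kernel_conditions_def intro!: continuous_at_imp_continuous_on differentiable_imp_continuous_within)
  have "bounded (range K)" "bounded (range (deriv K))" using kernel by (simp_all add: kernel_conditions_def)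
  then obtain D1 D2 where "\<forall>x\<in>range K. \<bar>x\<bar> \<le> D1" "\<forall>x\<in>range (deriv K). \<bar>x\<bar> \<le> D2"
    unfolding bounded_real by blast
  then have D12: "\<bar>K z\<bar> \<le> D1" "\<bar>deriv K z\<bar> \<le> D2" for z by blast+
  define D where "D = max D1 D2"
  have D: "\<bar>K z\<bar> \<le> D" "\<bar>deriv K z\<bar> \<le> D" for z using D12[of z] by (auto simp: D_def)

  \<comment> \<open>The pathwise properties behind the limit: continuity, and nonzero values at
    points accumulating at 0, which make the denominator positive.\<close>
  define good where "good w \<longleftrightarrow> continuous_on {0..} w \<and> (\<forall>k. w (1 / Suc k) \<noteq> 0)" for w :: "real \<Rightarrow> real"
  have good_AE: "AE \<omega> in N. good (\<lambda>t. B t \<omega>)"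
    using brownian_nonzero_AE[OF bm] bm unfolding good_def standard_brownian_motion_def by auto
  have good_cont: "continuous_on {0..1} w" if "good w" for w
    using that by (auto simp: good_def intro: continuous_on_subset)
  have good_pos: "0 < (LINT r:{0..s}|lborel. (w r)\<^sup>2)" if "good w" "s \<in> {0<..1}" for w s
    by (rule square_integral_pos[OF good_cont[OF that(1)] _ that(2)]) (use that in \<open>simp add: good_def\<close>)
  have good_limit: "continuous_on {0<..1} (limit_DF K \<zeta> \<theta> w)" if "good w" for w
    by (rule limit_DF_continuous[OF Kc D(1) K2 D(2) good_cont[OF that] good_pos[OF that]])

  obtain N0 where N0: "{\<omega> \<in> space N. \<not> good (\<lambda>t. B t \<omega>)} \<subseteq> N0" "emeasure N N0 = 0" "N0 \<in> sets N"
    using AE_E[OF good_AE] by blast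
  \<comment> \<open>On the exceptional null set the path is replaced by one that is continuous and does not vanish on \<open>(0, 1]\<close>.\<close>
  define W where "W t \<omega> = (if \<omega> \<in> N0 then max 0 t else B (max 0 t) \<omega>)" for t \<omega>
  have Wm: "W t \<in> borel_measurable N" for t
  proof -
    have [measurable]: "B (max 0 t) \<in> borel_measurable N"
      using bm by (simp add: standard_brownian_motion_def)
    show ?thesis unfolding W_def[abs_def] using N0(3) by measurable
  qed
  \<comment> \<open>Composing with \<open>max 0\<close> extends the paths continuously to negative
    times, as the joint measurability argument requires.\<close>
  have Wc: "continuous_on UNIV (\<lambda>t. W t \<omega>)" if "\<omega> \<in> space N" for \<omega>
  proof (cases "\<omega> \<in> N0")
    case True
    then show ?thesis by (auto simp: W_def intro!: continuous_intros)
  next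
    case False
    then have "continuous_on {0..} (\<lambda>t. B t \<omega>)" using N0(1) that by (auto simp: good_def)
    then have "continuous_on UNIV (\<lambda>t. B (max 0 t) \<omega>)"
      by (rule continuous_on_compose2) (auto intro!: continuous_intros)
    then show ?thesis using False by (simp add: W_def)
  qed
  have W_good: "good (\<lambda>t. W t \<omega>)" if "\<omega> \<in> space N" for \<omega>
  proof -
    have "W (1 / Suc k) \<omega> \<noteq> 0" for k
    proof (cases "\<omega> \<in> N0")
      case False
      then have "B (1 / Suc k) \<omega> \<noteq> 0" using N0(1) that by (auto simp: good_def)
      then show ?thesis using False by (simp add: W_def max_def)
    qed (simp add: W_def max_def)
    then show ?thesis using continuous_on_subset[OF Wc[OF that]] by (auto simp: good_def)
  qed
  have W_limit: "limit_DF K \<zeta> \<theta> (\<lambda>r. W r \<omega>) s = limit_DF K \<zeta> \<theta> (\<lambda>r. B r \<omega>) s" if "\<omega> \<notin> N0" "0 \<le> s" for \<omega> s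
  proof -
    have W: "W r \<omega> = B r \<omega>" if "r \<in> {0..s}" for r using that \<open>\<omega> \<notin> N0\<close> by (simp add: W_def)
    have "(LINT r:{0..s}|lborel. (W r \<omega>)\<^sup>2 * g r) = (LINT r:{0..s}|lborel. (B r \<omega>)\<^sup>2 * g r)" for g
      by (rule set_lebesgue_integral_cong) (auto simp: W)
    \<comment> \<open>The instance with \<open>g\<close> constantly 1 handles the
      denominator.\<close>
    from this[of "\<lambda>r. deriv K (\<zeta> * (s - r))"] this[of "\<lambda>_. 1"] show ?thesis
      using W[of s] that(2) by (simp add: limit_DF_def)
  qed
  define Z' where "Z' \<omega> = (\<lambda>s\<in>{\<kappa>..1}. limit_DF K \<zeta> \<theta> (\<lambda>r. W r \<omega>) s)" for \<omega>
  have Z'm: "Z' \<in> measurable N (borel_on (skorokhod_topology \<kappa> 1))"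
    unfolding Z'_def[abs_def]
    by (rule continuous_path_measurable[OF limit_DF_measurable[OF Kc K2 Wm Wc] continuous_on_subset[OF good_limit[OF W_good]]])
      (use kappa in auto)
  have notN0: "AE \<omega> in N. \<omega> \<notin> N0" by (rule AE_not_in) (use N0 in \<open>simp add: null_sets_def\<close>)
  have Z'_version: "skorokhod_version N \<kappa> 1 (\<lambda>s \<omega>. limit_DF K \<zeta> \<theta> (\<lambda>r. B r \<omega>) s) Z'"
    unfolding skorokhod_version_def
  proof (intro conjI Z'm)
    show "AE \<omega> in N. \<forall>t\<in>{\<kappa>..1}. Z' \<omega> t = limit_DF K \<zeta> \<theta> (\<lambda>r. B r \<omega>) t"
      using notN0 by eventually_elim (use W_limit kappa in \<open>simp add: Z'_def\<close>)
  qed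

  \<comment> \<open>Time 0 lies outside \<open>[\<kappa>, 1]\<close>, so this step path agrees with
    the statistic at every sample point, not just almost surely.\<close>
  define X' where "X' T \<omega> = step_path \<kappa> 1 (real T) 0 (\<lambda>n. t_stat_DF K (h T) (\<lambda>t. Y t \<omega>) n)" for T \<omega>
  have X'm: "X' T \<in> measurable M (borel_on (skorokhod_topology \<kappa> 1))" for T
    unfolding X'_def[abs_def] by (rule step_path_measurable) (simp_all add: t_stat_DF_measurable Ym)
  have X'_eq: "X' T \<omega> s = t_type_DF K (h T) (\<lambda>t. Y t \<omega>) T s" if "s \<in> {\<kappa>..1}" for T \<omega> s
    using that kappa by (subst t_type_DF_eq_t_stat) (auto simp: X'_def step_path_def)
  have X'_version: "skorokhod_version M \<kappa> 1 ((\<lambda>T s \<omega>. t_type_DF K (h T) (\<lambda>t. Y t \<omega>) T s) T) (X' T)" for T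
    using X'm X'_eq by (simp add: skorokhod_version_def)

  obtain S' G where S': "\<And>T. skorokhod_version M 0 1 (S T) (S' T)"
    and G: "skorokhod_version N 0 1 (\<lambda>s \<omega>. \<eta> * B s \<omega>) G"
    and conv: "weak_conv_on (skorokhod_topology 0 1)
          (\<lambda>T. distr M (borel_on (skorokhod_topology 0 1)) (S' T))
          (distr N (borel_on (skorokhod_topology 0 1)) G)"
    using S_conv unfolding skorokhod_weak_conv_def by blast
  have S'm: "S' T \<in> measurable M (borel_on (skorokhod_topology 0 1))" for T
    using S' by (simp add: skorokhod_version_def)
  have Gm: "G \<in> measurable N (borel_on (skorokhod_topology 0 1))"
    using G by (simp add: skorokhod_version_def)
  \<comment> \<open>Sets of full measure on which the chosen versions agree with the processes, for
    all \<open>T\<close> at once; on them the argument is pathwise.\<close>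
  define A where "A = {\<omega>. \<forall>T. \<forall>t\<in>{0..1}. S' T \<omega> t = S T t \<omega>}"
  define A' where "A' = {\<omega>. \<omega> \<notin> N0 \<and> (\<forall>t\<in>{0..1}. G \<omega> t = \<eta> * B t \<omega>)}"
  have A: "AE \<omega> in M. \<omega> \<in> A" using S' by (simp add: A_def AE_all_countable skorokhod_version_def)
  have "AE \<omega> in N. \<forall>t\<in>{0..1}. G \<omega> t = \<eta> * B t \<omega>" using G by (simp add: skorokhod_version_def)
  with notN0 have A': "AE \<omega> in N. \<omega> \<in> A'" by eventually_elim (simp add: A'_def)

  \<comment> \<open>The sample points \<open>u n\<close> vary freely with \<open>n\<close>, so this
    is purely deterministic: probability enters only through membership in \<open>A\<close> and
    \<open>A'\<close>.\<close>
  have path_limit: "(\<lambda>n. t_type_DF K (h (T n)) (\<lambda>t. Y t (u n)) (T n) (s n)) \<longlonglongrightarrow> limit_DF K \<zeta> \<theta> (\<lambda>r. B r \<omega>) s0"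
    if \<omega>: "\<omega> \<in> A'" "\<omega> \<in> space N" and u: "\<And>n. u n \<in> A \<inter> space M"
      and T: "\<And>n. Suc n \<le> T n"
      and d: "\<And>n. skorokhod_dist 0 1 (S' (T n) (u n)) (G \<omega>) < 1 / Suc n"
      and q: "\<And>n. qv_error \<epsilon> (\<sigma>\<^sup>2) (T n) (u n) < 1 / Suc n"
      and s: "\<And>n. s n \<in> {\<kappa>..1}" "s \<longlonglongrightarrow> s0" "s0 \<in> {\<kappa>..1}"
    for \<omega> u T s s0
  proof -
    have gB: "good (\<lambda>t. B t \<omega>)" using \<omega> N0(1) by (auto simp: A'_def)
    have Gw: "G \<omega> t = \<eta> * B t \<omega>" if "t \<in> {0..1}" for t using \<omega>(1) that by (simp add: A'_def)
    have Gc: "G \<omega> \<in> cadlag_paths 0 1" using measurable_space[OF Gm \<omega>(2)] by simp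
    have S'c: "S' T (u n) \<in> cadlag_paths 0 1" for T n using measurable_space[OF S'm] u[of n] by fastforce
    have T1: "1 \<le> T n" for n using T[of n] by simp
    have T_inf: "filterlim T at_top sequentially"
      by (rule filterlim_at_top_mono[OF filterlim_ident always_eventually]) (use T in \<open>meson Suc_leD\<close>)
    have inv: "(\<lambda>n. 1 / real (Suc n)) \<longlonglongrightarrow> 0"
      using LIMSEQ_inverse_real_of_nat by (simp add: inverse_eq_divide)
    have d0: "(\<lambda>n. skorokhod_dist 0 1 (S' (T n) (u n)) (G \<omega>)) \<longlonglongrightarrow> 0"
      by (rule tendsto_sandwich[OF _ _ tendsto_const inv])
        (intro always_eventually allI less_imp_le d Metric_space.nonneg[OF Metric_space_skorokhod])+
    have wc: "continuous_on {0..1} (\<lambda>t. \<eta> * B t \<omega>)" by (intro continuous_intros good_cont[OF gB])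
    have Gcont: "continuous_on {0..1} (G \<omega>)"
      by (rule continuous_on_eq[OF wc]) (simp add: Gw)
    have S'Y: "S' (T n) (u n) r = Y (nat \<lfloor>real (T n) * r\<rfloor>) (u n) / sqrt (real (T n))" if "r \<in> {0..1}" for n r
      using u[of n] that Y_sum[of "u n"] by (simp add: A_def S_def)
    obtain C where C: "0 \<le> C" "\<And>t. t \<in> {0..1} \<Longrightarrow> \<bar>G \<omega> t\<bar> \<le> C" using cadlag_bounded[OF Gc] by blast
    have "(\<lambda>n. t_type_DF K (h (T n)) (\<lambda>t. Y t (u n)) (T n) (s n)) \<longlonglongrightarrow>
      (1 / 2) * (K 0 * (\<eta> * B s0 \<omega>)\<^sup>2 + \<zeta> * (LINT r:{0..s0}|lborel. (\<eta> * B r \<omega>)\<^sup>2 * deriv K (\<zeta> * (s0 - r)))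
        - \<sigma>\<^sup>2 * (LINT r:{0..s0}|lborel. K (\<zeta> * (s0 - r)))) / (sqrt (LINT r:{0..s0}|lborel. (\<eta> * B r \<omega>)\<^sup>2) * \<sigma>)"
    proof (rule t_type_DF_limit[OF K1 K2 D(2) T1 T_inf _ _ _ wc])
      show "0 < h (T n)" for n using h_pos T1 by blast
      show "(\<lambda>n. real (T n) / h (T n)) \<longlonglongrightarrow> \<zeta>" by (rule filterlim_compose[OF h_lim T_inf])
      show "Y 0 (u n) = 0" for n using Y_0 u by blast
      show "(\<lambda>n. Y (nat \<lfloor>real (T n) * r n\<rfloor>) (u n) / sqrt (real (T n))) \<longlonglongrightarrow> \<eta> * B r0 \<omega>"
        if r: "\<And>n. r n \<in> {0..1}" "r \<longlonglongrightarrow> r0" "r0 \<in> {0..1}" for r r0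
        using skorokhod_tendsto_continuous[OF S'c Gc Gcont d0 r] unfolding S'Y[OF r(1)] Gw[OF r(3)] .
      \<comment> \<open>At grid times the rescaled \<open>Y\<close> is the path \<open>S'\<close>,
        which lies within distance 1 of a path bounded by \<open>C\<close>.\<close>
      show "\<bar>Y t (u n) / sqrt (real (T n))\<bar> \<le> C + 1" if t: "t \<le> T n" for n t
      proof -
        have t1: "real t / real (T n) \<in> {0..1}" using t T1[of n] by simp
        have "nat \<lfloor>real (T n) * (real t / real (T n))\<rfloor> = t" using T1[of n] by simp
        then have "Y t (u n) / sqrt (real (T n)) = S' (T n) (u n) (real t / real (T n))" using S'Y[OF t1] by simp
        moreover have "\<bar>S' (T n) (u n) (real t / real (T n))\<bar> \<le> C + 1 / Suc n"
          by (rule skorokhod_dist_bounded[OF S'c Gc C(2) d t1])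
        moreover have "1 / real (Suc n) \<le> 1" by simp
        ultimately show ?thesis by linarith
      qed
      show "\<bar>((\<Sum>i=1..t. (Y i (u n) - Y (i - 1) (u n))\<^sup>2) - real t * \<sigma>\<^sup>2) / real (T n)\<bar> \<le> 1 / Suc n"
        if "t \<le> T n" for n t
      proof -
        have "(\<Sum>i=1..t. (Y i (u n) - Y (i - 1) (u n))\<^sup>2) = (\<Sum>i=1..t. (\<epsilon> i (u n))\<^sup>2)"
          by (rule sum.cong) (use Y_diff u in auto)
        then show ?thesis using qv_error_le[OF that q] by simp
      qed
      show "s n \<in> {0<..1}" for n using s(1)[of n] kappa by auto
      show "0 < s0" using s(3) kappa by auto
      have "0 < \<eta>\<^sup>2 * (LINT r:{0..s0}|lborel. (B r \<omega>)\<^sup>2)"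
        using good_pos[OF gB, of s0] s(3) kappa \<eta> by auto
      then show "0 < (LINT r:{0..s0}|lborel. (\<eta> * B r \<omega>)\<^sup>2)" by (simp add: power_mult_distrib)
    qed (use s(2) inv \<sigma> in auto)
    then show ?thesis unfolding theta
      by (subst limit_DF_scaled[OF \<eta> \<sigma>, symmetric]) (use s(3) kappa in auto)
  qed

  have weak: "weak_conv_on (skorokhod_topology \<kappa> 1)
      (\<lambda>T. distr M (borel_on (skorokhod_topology \<kappa> 1)) (X' T))
      (distr N (borel_on (skorokhod_topology \<kappa> 1)) Z')"
    unfolding weak_conv_on_def
  proof (intro allI impI)
    fix f :: "(real \<Rightarrow> real) \<Rightarrow> real"
    assume f: "continuous_map (skorokhod_topology \<kappa> 1) euclideanreal f" and b: "bounded (f ` topspace (skorokhod_topology \<kappa> 1))"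
    have fm: "f \<in> borel_measurable (borel_on (skorokhod_topology \<kappa> 1))" by (rule borel_measurable_continuous_map[OF f])
    obtain C where C: "\<And>x. x \<in> cadlag_paths \<kappa> 1 \<Longrightarrow> \<bar>f x\<bar> \<le> C" using b unfolding bounded_real by auto
    have X'c: "X' T \<omega> \<in> cadlag_paths \<kappa> 1" for T \<omega> unfolding X'_def by (rule step_path_cadlag) simp
    have Z'c: "Z' \<omega> \<in> cadlag_paths \<kappa> 1" if "\<omega> \<in> space N" for \<omega> using measurable_space[OF Z'm that] by simp
    have "(\<lambda>T. \<integral>\<omega>. f (X' T \<omega>) \<partial>M) \<longlonglongrightarrow> (\<integral>\<omega>. f (Z' \<omega>) \<partial>N)"
    proof (rule Metric_space.weak_conv_mapping[OF Metric_space_skorokhod M N S'm[unfolded skorokhod_topology_def]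
          Gm[unfolded skorokhod_topology_def] conv[unfolded skorokhod_topology_def], where C = C and q = "qv_error \<epsilon> (\<sigma>\<^sup>2)"
          and A = A and A' = A'])
      show "(\<lambda>\<omega>. f (X' T \<omega>)) \<in> borel_measurable M" for T by (rule measurable_compose[OF X'm fm])
      show "(\<lambda>\<omega>. f (Z' \<omega>)) \<in> borel_measurable N" by (rule measurable_compose[OF Z'm fm])
      show "qv_error \<epsilon> (\<sigma>\<^sup>2) T \<in> borel_measurable M" for T by (rule qv_error_measurable[OF \<epsilon>m])
      fix \<omega> and e :: real assume \<omega>: "\<omega> \<in> A'" "\<omega> \<in> space N" and e: "e > 0"
      obtain r where r: "r > 0" "\<And>y. y \<in> cadlag_paths \<kappa> 1 \<Longrightarrow> skorokhod_dist \<kappa> 1 (Z' \<omega>) y < r \<Longrightarrow> \<bar>f (Z' \<omega>) - f y\<bar> < e"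
        using f Z'c[OF \<omega>(2)] e
        unfolding skorokhod_topology_def Metric_space.continuous_map_real_iff[OF Metric_space_skorokhod] by blast
      show "\<exists>n. \<forall>T\<ge>n. \<forall>w\<in>A \<inter> space M.
        skorokhod_dist 0 1 (S' T w) (G \<omega>) < 1 / real (Suc n) \<longrightarrow> qv_error \<epsilon> (\<sigma>\<^sup>2) T w < 1 / real (Suc n) \<longrightarrow>
          \<bar>f (X' T w) - f (Z' \<omega>)\<bar> \<le> e"
      proof (rule ccontr)
        assume neg: "\<not> ?thesis"
        have "\<exists>T w s. Suc n \<le> T \<and> w \<in> A \<inter> space M \<and> skorokhod_dist 0 1 (S' T w) (G \<omega>) < 1 / real (Suc n) \<and>
            qv_error \<epsilon> (\<sigma>\<^sup>2) T w < 1 / real (Suc n) \<and> s \<in> {\<kappa>..1} \<and> \<bar>Z' \<omega> s - X' T w s\<bar> > r / 2" for n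
        proof -
          \<comment> \<open>Negating at \<open>Suc n\<close> makes \<open>T\<close> at least 1; the
            tolerance \<open>1 / Suc (Suc n)\<close> is relaxed afterwards.\<close>
          obtain T w where T: "Suc n \<le> T" and w: "w \<in> A \<inter> space M"
            and d: "skorokhod_dist 0 1 (S' T w) (G \<omega>) < 1 / real (Suc (Suc n))"
            and q: "qv_error \<epsilon> (\<sigma>\<^sup>2) T w < 1 / real (Suc (Suc n))" and far: "\<not> \<bar>f (X' T w) - f (Z' \<omega>)\<bar> \<le> e"
            using neg[simplified not_ex not_all not_imp, rule_format, of "Suc n"] by blast
          \<comment> \<open>The Skorokhod distance is at most the uniform one, so the paths must
            differ visibly at some time; \<open>r / 2\<close> leaves room for the strict inequality
            \<open>< r\<close>.\<close>
          have "\<exists>s\<in>{\<kappa>..1}. \<bar>Z' \<omega> s - X' T w s\<bar> > r / 2"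
          proof (rule ccontr)
            assume "\<not> ?thesis"
            then have "skorokhod_dist \<kappa> 1 (Z' \<omega>) (X' T w) \<le> r / 2"
              using r(1) by (intro skorokhod_dist_le Z'c[OF \<omega>(2)] X'c) force+
            then have "\<bar>f (Z' \<omega>) - f (X' T w)\<bar> < e" using r X'c by simp
            then show False using far by (simp add: abs_minus_commute)
          qed
          moreover have "1 / real (Suc (Suc n)) \<le> 1 / real (Suc n)" by (simp add: frac_le)
          ultimately show ?thesis using T w d q by (meson less_le_trans)
        qed
        then obtain T u s where T: "\<And>n. Suc n \<le> T n" and u: "\<And>n. u n \<in> A \<inter> space M"
          and d: "\<And>n. skorokhod_dist 0 1 (S' (T n) (u n)) (G \<omega>) < 1 / real (Suc n)"
          and q: "\<And>n. qv_error \<epsilon> (\<sigma>\<^sup>2) (T n) (u n) < 1 / real (Suc n)"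
          and s: "\<And>n. s n \<in> {\<kappa>..1}" and far: "\<And>n. \<bar>Z' \<omega> (s n) - X' (T n) (u n) (s n)\<bar> > r / 2"
          by metis
        \<comment> \<open>Compactness makes the bad times converge along a subsequence, so that
          convergence at moving times becomes uniform closeness on
          \<open>[\<kappa>, 1]\<close>.\<close>
        obtain s0 \<phi> where s0: "s0 \<in> {\<kappa>..1}" and \<phi>: "strict_mono \<phi>" and lim: "(s \<circ> \<phi>) \<longlonglongrightarrow> s0"
          using compact_Icc[of \<kappa> 1] s unfolding compact_def by metis
        have mono: "1 / real (Suc (\<phi> n)) \<le> 1 / real (Suc n)" for n
          using seq_suble[OF \<phi>, of n] by (simp add: frac_le)
        have "(\<lambda>n. t_type_DF K (h (T (\<phi> n))) (\<lambda>t. Y t (u (\<phi> n))) (T (\<phi> n)) (s (\<phi> n))) \<longlonglongrightarrow> limit_DF K \<zeta> \<theta> (\<lambda>r. B r \<omega>) s0"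
        proof (rule path_limit[OF \<omega>])
          show "Suc n \<le> T (\<phi> n)" for n using T[of "\<phi> n"] seq_suble[OF \<phi>, of n] by linarith
          show "skorokhod_dist 0 1 (S' (T (\<phi> n)) (u (\<phi> n))) (G \<omega>) < 1 / real (Suc n)" for n
            using d[of "\<phi> n"] mono[of n] by linarith
          show "qv_error \<epsilon> (\<sigma>\<^sup>2) (T (\<phi> n)) (u (\<phi> n)) < 1 / real (Suc n)" for n
            using q[of "\<phi> n"] mono[of n] by linarith
        qed (use u s s0 lim in \<open>auto simp: o_def\<close>)
        then have 1: "(\<lambda>n. X' (T (\<phi> n)) (u (\<phi> n)) (s (\<phi> n))) \<longlonglongrightarrow> limit_DF K \<zeta> \<theta> (\<lambda>r. B r \<omega>) s0"
          using X'_eq s by simp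
        have Z'_eq: "Z' \<omega> x = limit_DF K \<zeta> \<theta> (\<lambda>r. B r \<omega>) x" if "x \<in> {\<kappa>..1}" for x
          using that \<omega>(1) W_limit[of \<omega> x] kappa by (simp add: Z'_def A'_def)
        have gB: "good (\<lambda>t. B t \<omega>)" using \<omega> N0(1) by (auto simp: A'_def)
        \<comment> \<open>The limit path at the same moving times tends to the same value by
          continuity, which contradicts the persistent gap \<open>r / 2\<close>.\<close>
        have "(\<lambda>n. limit_DF K \<zeta> \<theta> (\<lambda>r. B r \<omega>) (s (\<phi> n))) \<longlonglongrightarrow> limit_DF K \<zeta> \<theta> (\<lambda>r. B r \<omega>) s0"
        proof (rule continuous_on_tendsto_compose[OF good_limit[OF gB]])
          show "(\<lambda>n. s (\<phi> n)) \<longlonglongrightarrow> s0" using lim by (simp add: o_def)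
          show "s0 \<in> {0<..1}" using s0 kappa by auto
          have "s (\<phi> n) \<in> {0<..1}" for n using s[of "\<phi> n"] kappa by auto
          then show "eventually (\<lambda>n. s (\<phi> n) \<in> {0<..1}) sequentially" by simp
        qed
        then have 2: "(\<lambda>n. Z' \<omega> (s (\<phi> n))) \<longlonglongrightarrow> limit_DF K \<zeta> \<theta> (\<lambda>r. B r \<omega>) s0"
          using Z'_eq s by simp
        have "(\<lambda>n. \<bar>Z' \<omega> (s (\<phi> n)) - X' (T (\<phi> n)) (u (\<phi> n)) (s (\<phi> n))\<bar>) \<longlonglongrightarrow> 0"
          using tendsto_rabs[OF tendsto_diff[OF 2 1]] by simp
        then have "eventually (\<lambda>n. \<bar>Z' \<omega> (s (\<phi> n)) - X' (T (\<phi> n)) (u (\<phi> n)) (s (\<phi> n))\<bar> < r / 2) sequentially"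
          by (rule order_tendstoD) (use r(1) in simp)
        then obtain n where "\<bar>Z' \<omega> (s (\<phi> n)) - X' (T (\<phi> n)) (u (\<phi> n)) (s (\<phi> n))\<bar> < r / 2"
          using eventually_happens by force
        then show False using far[of "\<phi> n"] by linarith
      qed
    qed (use C X'c Z'c A A' q_lim qv_error_bounds in auto)
    then show "(\<lambda>T. \<integral>x. f x \<partial>distr M (borel_on (skorokhod_topology \<kappa> 1)) (X' T)) \<longlonglongrightarrow>
        (\<integral>x. f x \<partial>distr N (borel_on (skorokhod_topology \<kappa> 1)) Z')"
      by (simp add: integral_distr[OF X'm fm] integral_distr[OF Z'm fm])
  qed
  have "AE \<omega> in N. continuous_on {0<..1} (\<lambda>s. limit_DF K \<zeta> \<theta> (\<lambda>r. B r \<omega>) s)"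
    using good_AE by eventually_elim (rule good_limit)
  moreover have "skorokhod_weak_conv \<kappa> 1
           M (\<lambda>T s \<omega>. t_type_DF K (h T) (\<lambda>t. Y t \<omega>) T s)
           N (\<lambda>s \<omega>. limit_DF K \<zeta> \<theta> (\<lambda>r. B r \<omega>) s)"
    unfolding skorokhod_weak_conv_def using X'_version Z'_version weak by blast
  ultimately show ?thesis by blast
qed

end
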